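(* Let $B$ be a $C^*$-algebra and let $A \subseteq B$ be a full hereditary $C^*$-subalgebra. The restriction map $T_{\mathbb R}(B) \to T_{\mathbb R}(A)$, $\tau\mapsto\tau|_{\mathrm{Ped}(A)}$, is an isomorphism of ordered topological vector spaces, and so is the induced map $T_{\mathbb R}(A)^* \to T_{\mathbb R}(B)^*$ (given by composing functionals on $T_{\mathbb R}(A)$ with the restriction map).
   Context: $A\subseteq B$ is full if $A$ generates $B$ as a closed two-sided ideal. For a $C^*$-algebra $A$, $\mathrm{Ped}(A)$ denotes the Pedersen ideal of $A$ (the unique minimal norm-dense two-sided ideal); for a $C^*$-subalgebra $A\subseteq B$ one has $\mathrm{Ped}(A)\subseteq\mathrm{Ped}(B)$. $\mathrm{Ped}(A)$ has the locally convex direct limit topology of its $C^*$-subalgebras: a linear functional on $\mathrm{Ped}(A)$ is continuous iff it is bounded on every $C^*$-subalgebra $D$ of $A$ contained in $\mathrm{Ped}(A)$. A linear functional $\tau$ on $\mathrm{Ped}(A)$ is a trace if $\tau(xy)=\tau(yx)$ for all $x,y$, self-adjoint if $\tau(x^* )=\overline{\tau(x)}$, positive if $\tau(a)\ge 0$ for $a\in \mathrm{Ped}(A)\cap A_+$. $T_{\mathbb R}(A)$ is the real vector space of continuous self-adjoint traces on $\mathrm{Ped}(A)$ with the weak$^*$-topology (pointwise convergence on $\mathrm{Ped}(A)$), ordered by the cone $T_+(A)$ of positive traces. $T_{\mathbb R}(A)^*$ is the space of weak$^*$-continuous linear functionals $T_{\mathbb R}(A)\to\mathbb R$ with the compact-open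 topology (uniform convergence on compact subsets of $T_{\mathbb R}(A)$) and the positive cone of functionals that are nonnegative on $T_+(A)$. An isomorphism of ordered topological vector spaces is a linear homeomorphism mapping the positive cone onto the positive cone. *)

theory Defs
  imports "HOL-Analysis.Analysis"
begin

text \<open>Algebras are not assumed to be unital, and the zero algebra is allowed.\<close>

class cstar_algebra = banach + real_normed_algebra +
  fixes scaleC :: "complex \<Rightarrow> 'a \<Rightarrow> 'a"
    and star :: "'a \<Rightarrow> 'a"
  assumes scaleC_add_right: "scaleC c (x + y) = scaleC c x + scaleC c y"
    and scaleC_add_left: "scaleC (c + d) x = scaleC c x + scaleC d x"
    and scaleC_scaleC: "scaleC c (scaleC d x) = scaleC (c * d) x"
    and scaleC_of_real: "scaleC (complex_of_real r) x = scaleR r x"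
    and mult_scaleC_left: "scaleC c x * y = scaleC c (x * y)"
    and mult_scaleC_right: "x * scaleC c y = scaleC c (x * y)"
    and norm_scaleC: "norm (scaleC c x) = cmod c * norm x"
    and star_add: "star (x + y) = star x + star y"
    and star_scaleC: "star (scaleC c x) = scaleC (cnj c) (star x)"
    and star_mult: "star (x * y) = star y * star x"
    and star_star: "star (star x) = x"
    and cstar_identity: "norm (star x * x) = (norm x)\<^sup>2"

global_interpretation complex_vector: vector_space "scaleC :: complex \<Rightarrow> 'a \<Rightarrow> 'a::cstar_algebra"
proof
  fix x :: 'a
  show "scaleC 1 x = x"
    using scaleC_of_real [of 1 x] by simp
qed (simp_all add: scaleC_add_right scaleC_add_left scaleC_scaleC)

definition cstar_subalgebra :: "'a::cstar_algebra set \<Rightarrow> bool" where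
  "cstar_subalgebra A \<longleftrightarrow>
     complex_vector.subspace A \<and> closed A \<and>
     (\<forall>x\<in>A. \<forall>y\<in>A. x * y \<in> A) \<and> (\<forall>x\<in>A. star x \<in> A)"

text \<open>Positive elements are taken in the form \<open>star x * x\<close>, which makes sense without a unit.\<close>

definition positive_part :: "'a::cstar_algebra set \<Rightarrow> 'a set" where
  "positive_part A = {star x * x |x. x \<in> A}"

text \<open>In the following definition \<open>0 \<le> b \<le> a\<close> refers to the order of the ambient algebra.\<close>

definition hereditary_cstar_subalgebra :: "'a::cstar_algebra set \<Rightarrow> bool" where
  "hereditary_cstar_subalgebra A \<longleftrightarrow>
     cstar_subalgebra A \<and>
     (\<forall>a \<in> positive_part A. \<forall>b \<in> positive_part UNIV. a - b \<in> positive_part UNIV \<longrightarrow> b \<in> A)"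

definition two_sided_ideal :: "'a::cstar_algebra set \<Rightarrow> 'a set \<Rightarrow> bool" where
  "two_sided_ideal A J \<longleftrightarrow>
     J \<subseteq> A \<and> complex_vector.subspace J \<and> (\<forall>a\<in>A. \<forall>x\<in>J. a * x \<in> J \<and> x * a \<in> J)"

definition full :: "'a::cstar_algebra set \<Rightarrow> bool" where
  "full A \<longleftrightarrow> (\<lambda>J. two_sided_ideal UNIV J \<and> closed J) hull A = UNIV"

definition dense_ideal :: "'a::cstar_algebra set \<Rightarrow> 'a set \<Rightarrow> bool" where
  "dense_ideal A J \<longleftrightarrow> two_sided_ideal A J \<and> A \<subseteq> closure J"

definition Ped :: "'a::cstar_algebra set \<Rightarrow> 'a set" where
  "Ped A = (THE J. dense_ideal A J \<and> (\<forall>K. dense_ideal A K \<and> K \<subseteq> J \<longrightarrow> K = J))"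

text \<open>
  The locally convex direct limit topology, that is, the finest locally convex topology for which
  the inclusions of all C*-subalgebras contained in the Pedersen ideal are continuous: a basis of
  neighbourhoods of \<open>0\<close> is given by the absolutely convex sets whose intersection with each
  such subalgebra is a norm neighbourhood of \<open>0\<close> there.
\<close>

definition ped_nhd0 :: "'a::cstar_algebra set \<Rightarrow> 'a set \<Rightarrow> bool" where
  "ped_nhd0 A V \<longleftrightarrow>
     V \<subseteq> Ped A \<and> convex V \<and> (\<forall>c. \<forall>x\<in>V. cmod c \<le> 1 \<longrightarrow> scaleC c x \<in> V) \<and>
     (\<forall>D. cstar_subalgebra D \<and> D \<subseteq> Ped A \<longrightarrow> (\<exists>e>0. \<forall>x\<in>D. norm x < e \<longrightarrow> x \<in> V))"

definition ped_topology :: "'a::cstar_algebra set \<Rightarrow> 'a topology" where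
  "ped_topology A =
     topology (\<lambda>U. U \<subseteq> Ped A \<and> (\<forall>x\<in>U. \<exists>V. ped_nhd0 A V \<and> (+) x ` V \<subseteq> U))"

lemma ped_nhd0_Int:
  assumes "ped_nhd0 A V" "ped_nhd0 A W"
  shows "ped_nhd0 A (V \<inter> W)"
  unfolding ped_nhd0_def
proof (intro conjI allI impI)
  fix D assume D: "cstar_subalgebra D \<and> D \<subseteq> Ped A"
  obtain e1 where "e1 > 0" "\<forall>x\<in>D. norm x < e1 \<longrightarrow> x \<in> V"
    using assms(1) D unfolding ped_nhd0_def by blast
  moreover obtain e2 where "e2 > 0" "\<forall>x\<in>D. norm x < e2 \<longrightarrow> x \<in> W"
    using assms(2) D unfolding ped_nhd0_def by blast
  ultimately show "\<exists>e>0. \<forall>x\<in>D. norm x < e \<longrightarrow> x \<in> V \<inter> W"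
    by (intro exI [of _ "min e1 e2"]) auto
qed (use assms in \<open>auto simp: ped_nhd0_def intro: convex_Int\<close>)

lemma openin_ped_topology:
  "openin (ped_topology A) U \<longleftrightarrow>
     U \<subseteq> Ped A \<and> (\<forall>x\<in>U. \<exists>V. ped_nhd0 A V \<and> (+) x ` V \<subseteq> U)"
proof -
  have "istopology (\<lambda>U. U \<subseteq> Ped A \<and> (\<forall>x\<in>U. \<exists>V. ped_nhd0 A V \<and> (+) x ` V \<subseteq> U))"
    unfolding istopology_def
  proof (intro conjI allI impI)
    fix S T
    assume S: "S \<subseteq> Ped A \<and> (\<forall>x\<in>S. \<exists>V. ped_nhd0 A V \<and> (+) x ` V \<subseteq> S)"
      and T: "T \<subseteq> Ped A \<and> (\<forall>x\<in>T. \<exists>V. ped_nhd0 A V \<and> (+) x ` V \<subseteq> T)"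
    show "S \<inter> T \<subseteq> Ped A" using S by blast
    show "\<forall>x\<in>S \<inter> T. \<exists>V. ped_nhd0 A V \<and> (+) x ` V \<subseteq> S \<inter> T"
    proof
      fix x assume "x \<in> S \<inter> T"
      then obtain V W where "ped_nhd0 A V" "(+) x ` V \<subseteq> S" "ped_nhd0 A W" "(+) x ` W \<subseteq> T"
        using S T by blast
      then show "\<exists>V. ped_nhd0 A V \<and> (+) x ` V \<subseteq> S \<inter> T"
        by (intro exI [of _ "V \<inter> W"]) (auto intro: ped_nhd0_Int)
    qed
  next
    fix \<K>
    assume \<K>: "\<forall>S\<in>\<K>. S \<subseteq> Ped A \<and> (\<forall>x\<in>S. \<exists>V. ped_nhd0 A V \<and> (+) x ` V \<subseteq> S)"
    show "\<Union>\<K> \<subseteq> Ped A" using \<K> by blast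
    show "\<forall>x\<in>\<Union>\<K>. \<exists>V. ped_nhd0 A V \<and> (+) x ` V \<subseteq> \<Union>\<K>"
    proof
      fix x assume "x \<in> \<Union>\<K>"
      then obtain S where S: "S \<in> \<K>" "x \<in> S" by blast
      then obtain V where "ped_nhd0 A V" "(+) x ` V \<subseteq> S" using \<K> by meson
      moreover have "S \<subseteq> \<Union>\<K>" using S by blast
      ultimately show "\<exists>V. ped_nhd0 A V \<and> (+) x ` V \<subseteq> \<Union>\<K>" by (meson subset_trans)
    qed
  qed
  then show ?thesis
    unfolding ped_topology_def by (simp add: topology_inverse')
qed

definition ped_linear :: "'a::cstar_algebra set \<Rightarrow> ('a \<Rightarrow> complex) \<Rightarrow> bool" where
  "ped_linear A \<tau> \<longleftrightarrow>
     (\<forall>x\<in>Ped A. \<forall>y\<in>Ped A. \<tau> (x + y) = \<tau> x + \<tau> y) \<and>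
     (\<forall>c. \<forall>x\<in>Ped A. \<tau> (scaleC c x) = c * \<tau> x)"

lemma continuous_ped_iff_bounded:
  fixes A :: "'a::cstar_algebra set"
  assumes sub: "complex_vector.subspace (Ped A)" and lin: "ped_linear A \<tau>"
  shows "continuous_map (ped_topology A) euclidean \<tau> \<longleftrightarrow>
    (\<forall>D. cstar_subalgebra D \<and> D \<subseteq> Ped A \<longrightarrow> (\<exists>C. \<forall>x\<in>D. cmod (\<tau> x) \<le> C * norm x))"
    (is "?L \<longleftrightarrow> ?R")
proof -
  have add: "\<tau> (x + y) = \<tau> x + \<tau> y" if "x \<in> Ped A" "y \<in> Ped A" for x y
    using lin that by (simp add: ped_linear_def)
  have scale: "\<tau> (scaleC c x) = c * \<tau> x" if "x \<in> Ped A" for c x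
    using lin that by (simp add: ped_linear_def)
  have scaleR: "\<tau> (r *\<^sub>R x) = r *\<^sub>R \<tau> x" "r *\<^sub>R x \<in> Ped A" if "x \<in> Ped A" for r x
    using scale [OF that, of "complex_of_real r"] complex_vector.subspace_scale [OF sub that]
    by (metis scaleC_of_real scaleR_conv_of_real)+
  have 0: "0 \<in> Ped A" "\<tau> 0 = 0"
    using complex_vector.subspace_0 [OF sub] scale [of 0 0] by auto
  have nhd: "ped_nhd0 A (Ped A)"
    using sub unfolding ped_nhd0_def convex_def
    by (auto intro: complex_vector.subspace_scale complex_vector.subspace_add scaleR exI [of _ 1])
  have top: "topspace (ped_topology A) = Ped A"
  proof -
    have "openin (ped_topology A) (Ped A)"
      unfolding openin_ped_topology using nhd complex_vector.subspace_add [OF sub] by blast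
    then show ?thesis
      by (metis openin_ped_topology openin_subset openin_topspace subset_antisym)
  qed
  show ?thesis
  proof
    assume L: ?L
    have "openin (ped_topology A) {x \<in> Ped A. \<tau> x \<in> ball 0 1}"
      using L top unfolding continuous_map_def by (metis open_ball open_openin)
    moreover have "0 \<in> {x \<in> Ped A. \<tau> x \<in> ball 0 1}" using 0 by simp
    ultimately obtain V where V: "ped_nhd0 A V" "(+) 0 ` V \<subseteq> {x \<in> Ped A. \<tau> x \<in> ball 0 1}"
      unfolding openin_ped_topology by blast
    show ?R
    proof (intro allI impI)
      fix D assume D: "cstar_subalgebra D \<and> D \<subseteq> Ped A"
      then obtain e where e: "e > 0" "\<And>x. x \<in> D \<Longrightarrow> norm x < e \<Longrightarrow> x \<in> V"
        using V unfolding ped_nhd0_def by blast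
      have Dsub: "complex_vector.subspace D" using D by (simp add: cstar_subalgebra_def)
      have "cmod (\<tau> x) \<le> 2 / e * norm x" if "x \<in> D" for x
      proof (cases "x = 0")
        case False
        define r where "r = e / (2 * norm x)"
        have r: "r > 0" using False e by (simp add: r_def)
        have "r *\<^sub>R x \<in> D"
          using complex_vector.subspace_scale [OF Dsub that, of "complex_of_real r"]
          by (simp add: scaleC_of_real)
        moreover have "norm (r *\<^sub>R x) < e" using False e by (simp add: r_def)
        ultimately have "r *\<^sub>R x \<in> V" using e by blast
        then have "cmod (\<tau> (r *\<^sub>R x)) < 1" using V by (auto simp: image_subset_iff)
        then have "r * cmod (\<tau> x) < 1" using scaleR(1) [of x r] D that r by auto
        then have "cmod (\<tau> x) < 1 / r" using r by (simp add: field_simps)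
        also have "1 / r = 2 / e * norm x" by (simp add: r_def)
        finally show ?thesis by simp
      qed (use 0 in auto)
      then show "\<exists>C. \<forall>x\<in>D. cmod (\<tau> x) \<le> C * norm x" by blast
    qed
  next
    assume R: ?R
    have nhd_e: "ped_nhd0 A {x \<in> Ped A. cmod (\<tau> x) < e}" if "e > 0" for e
      unfolding ped_nhd0_def
    proof (intro conjI allI impI ballI)
      show "convex {x \<in> Ped A. cmod (\<tau> x) < e}"
      proof (rule convexI)
        fix x y u v
        assume x: "x \<in> {x \<in> Ped A. cmod (\<tau> x) < e}" and y: "y \<in> {x \<in> Ped A. cmod (\<tau> x) < e}"
          and uv: "0 \<le> (u::real)" "0 \<le> v" "u + v = 1"
        have eq: "\<tau> (u *\<^sub>R x + v *\<^sub>R y) = u *\<^sub>R \<tau> x + v *\<^sub>R \<tau> y"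
          using x y by (simp add: add scaleR)
        have "u *\<^sub>R \<tau> x + v *\<^sub>R \<tau> y \<in> ball 0 e"
          using x y uv convex_ball [of 0 e] by (intro convexD) auto
        then show "u *\<^sub>R x + v *\<^sub>R y \<in> {x \<in> Ped A. cmod (\<tau> x) < e}"
          using x y complex_vector.subspace_add [OF sub] by (auto simp: eq scaleR)
      qed
    next
      fix c x assume x: "x \<in> {x \<in> Ped A. cmod (\<tau> x) < e}" and c: "cmod c \<le> 1"
      have "cmod c * cmod (\<tau> x) \<le> 1 * cmod (\<tau> x)" using c by (intro mult_right_mono) auto
      then show "scaleC c x \<in> {x \<in> Ped A. cmod (\<tau> x) < e}"
        using x complex_vector.subspace_scale [OF sub] by (auto simp: scale norm_mult)
    next
      fix D assume D: "cstar_subalgebra D \<and> D \<subseteq> Ped A"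
      then obtain C where C: "\<forall>x\<in>D. cmod (\<tau> x) \<le> C * norm x" using R by blast
      have "x \<in> {x \<in> Ped A. cmod (\<tau> x) < e}" if "x \<in> D" "norm x < e / (\<bar>C\<bar> + 1)" for x
      proof -
        have "cmod (\<tau> x) \<le> C * norm x" using C that by blast
        also have "\<dots> \<le> (\<bar>C\<bar> + 1) * norm x" by (intro mult_right_mono) auto
        also have "\<dots> < e" using that by (simp add: field_simps)
        finally show ?thesis using D that by auto
      qed
      then show "\<exists>d>0. \<forall>x\<in>D. norm x < d \<longrightarrow> x \<in> {x \<in> Ped A. cmod (\<tau> x) < e}"
        using \<open>e > 0\<close> by (intro exI [of _ "e / (\<bar>C\<bar> + 1)"]) auto
    qed auto
    show ?L
      unfolding continuous_map_def top
    proof (intro conjI allI impI)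
      fix W assume "openin euclidean (W :: complex set)"
      then have W: "open W" by simp
      show "openin (ped_topology A) {x \<in> Ped A. \<tau> x \<in> W}"
        unfolding openin_ped_topology
      proof (intro conjI ballI)
        fix x assume x: "x \<in> {x \<in> Ped A. \<tau> x \<in> W}"
        then obtain e where e: "e > 0" "ball (\<tau> x) e \<subseteq> W" using W unfolding open_contains_ball by blast
        have "(+) x ` {y \<in> Ped A. cmod (\<tau> y) < e} \<subseteq> {x \<in> Ped A. \<tau> x \<in> W}"
          using x e complex_vector.subspace_add [OF sub]
          by (auto simp: add subset_iff dist_norm)
        then show "\<exists>V. ped_nhd0 A V \<and> (+) x ` V \<subseteq> {x \<in> Ped A. \<tau> x \<in> W}"
          using nhd_e [OF e(1)] by blast
      qed auto
    qed auto
  qed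
qed

text \<open>The underlying set of an ordered topological vector space is the \<open>topspace\<close> of the topology.\<close>

record 'v ordered_tvs =
  vtopology :: "'v topology"
  vadd :: "'v \<Rightarrow> 'v \<Rightarrow> 'v"
  vscale :: "real \<Rightarrow> 'v \<Rightarrow> 'v"
  vcone :: "'v set"

definition ordered_tvs_iso :: "'v ordered_tvs \<Rightarrow> 'w ordered_tvs \<Rightarrow> ('v \<Rightarrow> 'w) \<Rightarrow> bool" where
  "ordered_tvs_iso V W f \<longleftrightarrow>
     homeomorphic_map (vtopology V) (vtopology W) f \<and>
     (\<forall>x\<in>topspace (vtopology V). \<forall>y\<in>topspace (vtopology V). f (vadd V x y) = vadd W (f x) (f y)) \<and>
     (\<forall>r. \<forall>x\<in>topspace (vtopology V). f (vscale V r x) = vscale W r (f x)) \<and>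
     f ` vcone V = vcone W"

text \<open>
  Functionals on \<open>Ped A\<close> are represented by functions that are \<open>undefined\<close> outside \<open>Ped A\<close>
  (the set \<open>extensional (Ped A)\<close>), so that the product topology over \<open>Ped A\<close> is that of pointwise convergence.
\<close>

definition real_traces :: "'a::cstar_algebra set \<Rightarrow> ('a \<Rightarrow> complex) set" where
  "real_traces A =
     {\<tau> \<in> extensional (Ped A).
        ped_linear A \<tau> \<and> continuous_map (ped_topology A) euclidean \<tau> \<and>
        (\<forall>x\<in>Ped A. \<forall>y\<in>Ped A. \<tau> (x * y) = \<tau> (y * x)) \<and>
        (\<forall>x\<in>Ped A. \<tau> (star x) = cnj (\<tau> x))}"

definition positive_traces :: "'a::cstar_algebra set \<Rightarrow> ('a \<Rightarrow> complex) set" where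
  "positive_traces A =
     {\<tau> \<in> real_traces A. \<forall>a \<in> Ped A \<inter> positive_part A. \<tau> a \<in> \<real>\<^sub>\<ge>\<^sub>0}"

definition trace_topology :: "'a::cstar_algebra set \<Rightarrow> ('a \<Rightarrow> complex) topology" where
  "trace_topology A =
     subtopology (product_topology (\<lambda>_. euclidean) (Ped A)) (real_traces A)"

definition trace_space :: "'a::cstar_algebra set \<Rightarrow> ('a \<Rightarrow> complex) ordered_tvs" where
  "trace_space A =
     \<lparr> vtopology = trace_topology A,
       vadd = (\<lambda>\<sigma> \<tau>. \<lambda>x\<in>Ped A. \<sigma> x + \<tau> x),
       vscale = (\<lambda>r \<tau>. \<lambda>x\<in>Ped A. complex_of_real r * \<tau> x),
       vcone = positive_traces A \<rparr>"

lemma topspace_trace_topology: "topspace (trace_topology A) = real_traces A"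
  by (auto simp: trace_topology_def real_traces_def PiE_def)

definition compact_open_topology :: "'x topology \<Rightarrow> ('x \<Rightarrow> real) set \<Rightarrow> ('x \<Rightarrow> real) topology" where
  "compact_open_topology X F =
     topology_generated_by {{\<phi> \<in> F. \<phi> ` K \<subseteq> W} |K W. compactin X K \<and> open W}"

lemma topspace_compact_open_topology: "topspace (compact_open_topology X F) = F"
proof -
  have "F \<in> {{\<phi> \<in> F. \<phi> ` K \<subseteq> W} |K W. compactin X K \<and> open W}"
    by (rule CollectI, intro exI [of _ "{}"] exI [of _ UNIV]) auto
  then show ?thesis
    unfolding compact_open_topology_def topology_generated_by_topspace by blast
qed

text \<open>On continuous functions this is the topology of uniform convergence on compact sets.\<close>

lemma openin_compact_open_topology_iff:
  assumes cont: "\<And>\<phi>. \<phi> \<in> F \<Longrightarrow> continuous_map X euclideanreal \<phi>"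
  shows "openin (compact_open_topology X F) U \<longleftrightarrow>
    U \<subseteq> F \<and> (\<forall>\<phi>\<in>U. \<exists>K e. compactin X K \<and> e > 0 \<and> {\<psi> \<in> F. \<forall>t\<in>K. \<bar>\<psi> t - \<phi> t\<bar> < e} \<subseteq> U)"
    (is "_ \<longleftrightarrow> ?Q U")
proof
  assume "openin (compact_open_topology X F) U"
  then have "generate_topology_on {{\<phi> \<in> F. \<phi> ` K \<subseteq> W} |K W. compactin X K \<and> open W} U"
    by (simp add: compact_open_topology_def openin_topology_generated_by_iff)
  then show "?Q U"
  proof induction
    case (Int S T)
    show ?case
    proof (intro conjI ballI)
      fix \<phi> assume "\<phi> \<in> S \<inter> T"
      then obtain K d L e where "compactin X K" "d > 0" "{\<psi> \<in> F. \<forall>t\<in>K. \<bar>\<psi> t - \<phi> t\<bar> < d} \<subseteq> S"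
        "compactin X L" "e > 0" "{\<psi> \<in> F. \<forall>t\<in>L. \<bar>\<psi> t - \<phi> t\<bar> < e} \<subseteq> T"
        using Int.IH by blast
      then show "\<exists>K e. compactin X K \<and> e > 0 \<and> {\<psi> \<in> F. \<forall>t\<in>K. \<bar>\<psi> t - \<phi> t\<bar> < e} \<subseteq> S \<inter> T"
        by (intro exI [of _ "K \<union> L"] exI [of _ "min d e"]) (auto simp: compactin_Un)
    qed (use Int.IH in blast)
  next
    case (UN \<K>)
    show ?case
    proof (intro conjI ballI)
      fix \<phi> assume "\<phi> \<in> \<Union>\<K>"
      then obtain S where S: "S \<in> \<K>" "\<phi> \<in> S" by blast
      then obtain K e where "compactin X K" "e > 0" "{\<psi> \<in> F. \<forall>t\<in>K. \<bar>\<psi> t - \<phi> t\<bar> < e} \<subseteq> S"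
        using UN.IH by blast
      then show "\<exists>K e. compactin X K \<and> e > 0 \<and> {\<psi> \<in> F. \<forall>t\<in>K. \<bar>\<psi> t - \<phi> t\<bar> < e} \<subseteq> \<Union>\<K>"
        using S by blast
    qed (use UN.IH in blast)
  next
    case (Basis S)
    then obtain K W where S: "S = {\<phi> \<in> F. \<phi> ` K \<subseteq> W}" "compactin X K" "open W" by blast
    show ?case
    proof (intro conjI ballI)
      fix \<phi> assume \<phi>: "\<phi> \<in> S"
      then have "compactin euclideanreal (\<phi> ` K)"
        using S cont image_compactin by blast
      then have "compact (\<phi> ` K)" by simp
      then obtain e where e: "e > 0" "(\<Union>x\<in>\<phi> ` K. ball x e) \<subseteq> W"
        using compact_subset_open_imp_ball_epsilon_subset [of "\<phi> ` K" W] \<phi> S by blast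
      have "{\<psi> \<in> F. \<forall>t\<in>K. \<bar>\<psi> t - \<phi> t\<bar> < e} \<subseteq> S"
        using e S by (force simp: dist_real_def abs_minus_commute)
      then show "\<exists>K e. compactin X K \<and> e > 0 \<and> {\<psi> \<in> F. \<forall>t\<in>K. \<bar>\<psi> t - \<phi> t\<bar> < e} \<subseteq> S"
        using S e by blast
    qed (use S in blast)
  qed auto
next
  assume Q: "?Q U"
  show "openin (compact_open_topology X F) U"
  proof (subst openin_subopen, intro ballI)
    fix \<phi> assume \<phi>: "\<phi> \<in> U"
    then have \<phi>F: "\<phi> \<in> F" using Q by blast
    obtain K e where K: "compactin X K" "e > 0" and U: "{\<psi> \<in> F. \<forall>t\<in>K. \<bar>\<psi> t - \<phi> t\<bar> < e} \<subseteq> U"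
      using Q \<phi> by blast
    have "compactin euclideanreal (\<phi> ` K)"
      using K \<phi>F cont image_compactin by blast
    then have "compact (\<phi> ` K)" by simp
    then obtain Y where Y: "finite Y" "\<phi> ` K \<subseteq> (\<Union>y\<in>Y. ball y (e/3))"
      using K unfolding compact_eq_totally_bounded
      by (metis divide_pos_pos zero_less_numeral)
    define L where "L y = {s \<in> topspace X. \<phi> s \<in> cball y (e/3)} \<inter> K" for y
    have L: "compactin X (L y)" for y
    proof -
      have "closedin X {s \<in> topspace X. \<phi> s \<in> cball y (e/3)}"
        using cont [OF \<phi>F] by (intro closedin_continuous_map_preimage) auto
      then show ?thesis unfolding L_def using K closed_Int_compactin by blast
    qed
    define N where "N y = {\<psi> \<in> F. \<psi> ` L y \<subseteq> ball y (e/2)}" for y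
    have "openin (compact_open_topology X F) (N y)" for y
      unfolding compact_open_topology_def N_def
      by (intro topology_generated_by_Basis) (use L in blast)
    then have "openin (compact_open_topology X F) (F \<inter> \<Inter>(N ` Y))"
      using Y openin_topspace [of "compact_open_topology X F"]
      by (cases "Y = {}") (auto simp: topspace_compact_open_topology intro!: openin_Int openin_Inter)
    moreover have "\<phi> \<in> F \<inter> \<Inter>(N ` Y)"
      using \<phi>F K by (auto simp: N_def L_def)
    moreover have "F \<inter> \<Inter>(N ` Y) \<subseteq> U"
    proof -
      have "\<bar>\<psi> t - \<phi> t\<bar> < e" if \<psi>: "\<psi> \<in> F \<inter> \<Inter>(N ` Y)" and t: "t \<in> K" for \<psi> t
      proof -
        obtain y where y: "y \<in> Y" "\<phi> t \<in> ball y (e/3)" using Y t by blast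
        then have "t \<in> L y" using t compactin_subset_topspace [OF K(1)] by (auto simp: L_def)
        moreover have "\<psi> ` L y \<subseteq> ball y (e/2)" using \<psi> y(1) by (simp add: N_def)
        ultimately have "\<psi> t \<in> ball y (e/2)" by blast
        then show ?thesis using y(2) K(2) unfolding mem_ball dist_real_def by linarith
      qed
      then show ?thesis using U by blast
    qed
    ultimately show "\<exists>T. openin (compact_open_topology X F) T \<and> \<phi> \<in> T \<and> T \<subseteq> U" by blast
  qed
qed

definition trace_dual :: "'a::cstar_algebra set \<Rightarrow> (('a \<Rightarrow> complex) \<Rightarrow> real) set" where
  "trace_dual A =
     {\<phi> \<in> extensional (real_traces A).
        continuous_map (trace_topology A) euclideanreal \<phi> \<and>
        (\<forall>\<sigma>\<in>real_traces A. \<forall>\<tau>\<in>real_traces A. \<phi> (vadd (trace_space A) \<sigma> \<tau>) = \<phi> \<sigma> + \<phi> \<tau>) \<and>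
        (\<forall>r. \<forall>\<tau>\<in>real_traces A. \<phi> (vscale (trace_space A) r \<tau>) = r * \<phi> \<tau>)}"

definition trace_dual_space :: "'a::cstar_algebra set \<Rightarrow> (('a \<Rightarrow> complex) \<Rightarrow> real) ordered_tvs" where
  "trace_dual_space A =
     \<lparr> vtopology = compact_open_topology (trace_topology A) (trace_dual A),
       vadd = (\<lambda>\<phi> \<psi>. \<lambda>\<tau>\<in>real_traces A. \<phi> \<tau> + \<psi> \<tau>),
       vscale = (\<lambda>r \<phi>. \<lambda>\<tau>\<in>real_traces A. r * \<phi> \<tau>),
       vcone = {\<phi> \<in> trace_dual A. \<forall>\<tau>\<in>positive_traces A. 0 \<le> \<phi> \<tau>} \<rparr>"

end

theory Submission
  imports Defs "HOL-Computational_Algebra.Polynomial"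
begin

text \<open>
  Write \<open>P\<close> for the Pedersen ideal of \<open>A\<close>. Fullness makes the span of the products \<open>x * p * q * y\<close>
  with \<open>p\<close>, \<open>q\<close> in \<open>P\<close> a dense ideal of the ambient algebra, hence equal to its Pedersen ideal, and
  the trace property forces the inverse of the restriction map to send \<open>x * p * q * y\<close> to
  \<open>\<sigma> (q * y * x * p)\<close>; the argument lies in \<open>P\<close> because \<open>A\<close> is hereditary. This is well defined:
  if \<open>u\<close> is a sum of elements \<open>m * star m\<close> with \<open>m\<close> a multiple of an element of \<open>P\<close>, then the sum of
  the numbers \<open>\<sigma> (q * y * u * x * p)\<close> depends only on the sum of the products \<open>x * p * q * y\<close>, and
  such \<open>u\<close> form an approximate unit along which these numbers converge, since \<open>\<sigma> (q * b * p)\<close> is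
  bounded in \<open>b\<close>. The same approximate unit gives positivity of the extension; its continuity follows
  from uniform boundedness. The extension depends on \<open>\<sigma>\<close> through finitely many evaluations at each
  point, so restriction is a homeomorphism, and the statement about dual spaces is formal.
\<close>

section \<open>Elementary C*-algebra identities\<close>

text \<open>No unit is adjoined. Functions of a self-adjoint \<open>a\<close> are operators y
  \<mapsto> f(a) y, so that expressions like 1 - s still make sense, and elements are compared
  through their left multiplications. The calculus lives on [-1, 1] instead of the spectrum and
  cannot see that \<open>star x * x\<close> is positive. This is proved separately, because the
  approximate unit needs square roots of functions of \<open>m * star m\<close>. The obstacle to
  extending \<sigma> is that it only sees elements enclosed between two factors from the Pedersen
  ideal of \<open>A\<close>. A square \<open>m * star m\<close> inserted between \<open>y\<close>
  and \<open>x\<close> cuts the argument into two factors that both lie in that ideal; then the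
  trace property can rotate them and bring the product \<open>x * p * q * y\<close> back together.
  Continuity is a second obstacle: a C*-subalgebra D of the larger Pedersen ideal need not be
  related to \<open>A\<close>. What is available is a bound on b \<mapsto>
  \<open>extend \<sigma> (z * b)\<close> for each single z, which Baire's theorem makes uniform over
  D.\<close>

lemma star_zero [simp]: "star (0::'a::cstar_algebra) = 0"
  using star_add [of 0 0] by (metis add_cancel_left_left add_0)

lemma star_scaleR: "star (r *\<^sub>R x) = r *\<^sub>R star (x::'a::cstar_algebra)"
  by (metis scaleC_of_real star_scaleC complex_cnj_complex_of_real)

lemma star_minus: "star (- x) = - star (x::'a::cstar_algebra)"
  by (metis star_scaleR scaleR_minus1_left)

lemma star_diff: "star (x - y) = star x - star (y::'a::cstar_algebra)"
  by (metis star_add star_minus diff_conv_add_uminus)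

lemmas star_simps = star_add star_diff star_minus star_mult star_star star_scaleR star_scaleC

lemma scaleR_scaleC: "r *\<^sub>R scaleC c x = scaleC c (r *\<^sub>R (x::'a::cstar_algebra))"
  by (metis scaleC_of_real scaleC_scaleC mult.commute)

lemma norm_star [simp]: "norm (star x) = norm (x::'a::cstar_algebra)"
proof -
  have le: "norm y \<le> norm (star y)" for y :: 'a
  proof (cases "y = 0")
    case False
    have "norm y * norm y \<le> norm (star y) * norm y"
      by (metis cstar_identity norm_mult_ineq power2_eq_square)
    then show ?thesis using False by simp
  qed simp
  show ?thesis using le [of x] le [of "star x"] by (simp add: star_star)
qed

lemma bounded_linear_star: "bounded_linear (star :: 'a::cstar_algebra \<Rightarrow> 'a)"
  by (rule bounded_linear_intro [of _ 1]) (auto simp: star_simps)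

lemma norm_mult_star: "norm (x * star x) = (norm (x::'a::cstar_algebra))\<^sup>2"
  using cstar_identity [of "star x"] by (simp add: star_star)

text \<open>Testing with \<open>y = star x\<close> suffices, by the C*-identity. This makes the left
  regular representation isometric, so operators given by left multiplication determine the element
  and its norm.\<close>

lemma norm_le_of_left_mult:
  assumes "\<And>y. norm (x * y) \<le> M * norm y" "0 \<le> M"
  shows "norm (x::'a::cstar_algebra) \<le> M"
proof (cases "x = 0")
  case False
  have "norm x * norm x \<le> M * norm x"
    using assms(1) [of "star x"] by (simp add: norm_mult_star power2_eq_square)
  then show ?thesis using False by simp
qed (use assms in simp)

lemma eq_of_left_mult:
  assumes "\<And>z. x * z = y * z"
  shows "x = (y::'a::cstar_algebra)"
  using norm_le_of_left_mult [of "x - y" 0] assms by (simp add: left_diff_distrib)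

text \<open>Cauchy-Schwarz for the algebra-valued inner product \<open>star y * z\<close>, with
  respect to which \<open>T\<close> is self-adjoint.\<close>

lemma norm_power2_le_of_self_adjoint:
  fixes T :: "'a::cstar_algebra \<Rightarrow> 'a"
  assumes "\<And>y z. star (T y) * z = star y * T z"
  shows "(norm (T y))\<^sup>2 \<le> norm y * norm (T (T y))"
proof -
  have "star (T y) * T y = star y * T (T y)" by (rule assms)
  then have "(norm (T y))\<^sup>2 = norm (star y * T (T y))" by (metis cstar_identity)
  also have "\<dots> \<le> norm y * norm (T (T y))" using norm_mult_ineq [of "star y"] by simp
  finally show ?thesis .
qed

text \<open>Here \<open>s\<close> plays the role of 1 - sqrt (1 - x): the equation (1 - s)(1 - s) =
  1 - x, written without a unit, says that \<open>s\<close> is a fixed point of s \<mapsto> (x + s *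
  s) / 2.\<close>

lemma square_root_one_minus_exists:
  fixes x :: "'a::cstar_algebra"
  assumes sa: "star x = x" and x: "norm x < 1"
  obtains s where "star s = s" "2 *\<^sub>R s - s * s = x" "\<And>z. z * x = x * z \<Longrightarrow> z * s = s * z"
proof -
  define f where "f s = (1/2) *\<^sub>R (x + s * s)" for s
  \<comment> \<open>The smaller root of norm x + r * r = 2 * r: with this radius the ball is mapped
    into itself, and \<open>r\<close> is also the Lipschitz constant there.\<close>
  define r where "r = 1 - sqrt (1 - norm x)"
  have r: "0 \<le> r" "r < 1" using x by (auto simp: r_def)
  have "(sqrt (1 - norm x))\<^sup>2 = 1 - norm x" using x by simp
  then have rr: "norm x + r * r = 2 * r" by (simp add: r_def power2_eq_square algebra_simps)
  \<comment> \<open>Self-adjointness and commutation are closed conditions preserved by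
    \<open>f\<close>, so imposing them on the domain gives them for the fixed point.\<close>
  define S where "S = {s. norm s \<le> r \<and> star s = s \<and> (\<forall>z. z * x = x * z \<longrightarrow> z * s = s * z)}"
  have cl_star: "closed {s::'a. star s = s}"
  proof -
    have "bounded_linear (star :: 'a \<Rightarrow> 'a)"
      by (rule bounded_linear_intro [of _ 1]) (auto simp: star_simps)
    then have "continuous_on UNIV (star :: 'a \<Rightarrow> 'a)" by (rule linear_continuous_on)
    then show ?thesis by (intro closed_Collect_eq) (auto intro: continuous_intros)
  qed
  have "S = cball 0 r \<inter> {s. star s = s} \<inter> (\<Inter>z\<in>{z. z * x = x * z}. {s. z * s = s * z})"
    unfolding S_def by auto
  moreover have "closed \<dots>"
    by (intro closed_Int closed_INT ballI closed_Collect_eq closed_cball cl_star continuous_intros)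
  ultimately have "complete S" by (simp add: complete_eq_closed)
  moreover have "0 \<in> S" using r by (simp add: S_def)
  moreover have "f ` S \<subseteq> S"
  proof
    fix t assume "t \<in> f ` S"
    then obtain s where s: "s \<in> S" and t: "t = f s" by blast
    have "norm (x + s * s) \<le> norm x + norm s * norm s"
      by (meson norm_triangle_ineq norm_mult_ineq order_trans add_left_mono)
    also have "norm s * norm s \<le> r * r" using s r unfolding S_def by (intro mult_mono) auto
    finally have "norm t \<le> r" using rr by (simp add: t f_def)
    moreover have "z * t = t * z" if "z * x = x * z" for z
    proof -
      have "z * s = s * z" using s that by (simp add: S_def)
      then have "z * (s * s) = (s * s) * z" by (metis mult.assoc)
      then show ?thesis
        unfolding t f_def mult_scaleR_left mult_scaleR_right distrib_left distrib_right that by simp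
    qed
    moreover have "star t = t"
    proof -
      have "star s = s" using s by (simp add: S_def)
      then show ?thesis unfolding t f_def star_simps sa by simp
    qed
    ultimately show "t \<in> S" by (simp add: S_def)
  qed
  moreover have "dist (f s) (f t) \<le> r * dist s t" if "s \<in> S" "t \<in> S" for s t
  proof -
    have "s * (s - t) + (s - t) * t = (x + s * s) - (x + t * t)"
      by (simp add: right_diff_distrib left_diff_distrib)
    then have "f s - f t = (1/2) *\<^sub>R (s * (s - t) + (s - t) * t)"
      unfolding f_def by (metis scaleR_diff_right)
    then have "dist (f s) (f t) = (1/2) * norm (s * (s - t) + (s - t) * t)"
      by (simp add: dist_norm)
    also have "norm (s * (s - t) + (s - t) * t) \<le> norm s * norm (s - t) + norm (s - t) * norm t"
      by (meson norm_triangle_le add_mono norm_mult_ineq)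
    also have "\<dots> \<le> r * norm (s - t) + norm (s - t) * r"
      using that r unfolding S_def by (intro add_mono mult_mono) auto
    finally show ?thesis by (simp add: dist_norm algebra_simps)
  qed
  ultimately have "\<exists>!s\<in>S. f s = s"
    using r by (intro Banach_fix [of S r f]) auto
  then obtain s where s: "s \<in> S" "f s = s" by blast
  have "2 *\<^sub>R s = 2 *\<^sub>R f s" using s by simp
  then have "2 *\<^sub>R s - s * s = x" by (simp add: f_def)
  moreover have "star s = s" "\<And>z. z * x = x * z \<Longrightarrow> z * s = s * z"
    using s(1) unfolding S_def by blast+
  ultimately show ?thesis using that by blast
qed

section \<open>The action of polynomials\<close>

text \<open>Horner's scheme applied to a vector, so the constant coefficient acts as a scalar and no
  unit is involved. The scalar action is a parameter because both real polynomials in an element and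
  complex polynomials in a unitary operator occur.\<close>

definition poly_act :: "('k::zero \<Rightarrow> 'v \<Rightarrow> 'v::ab_group_add) \<Rightarrow> 'k poly \<Rightarrow> ('v \<Rightarrow> 'v) \<Rightarrow> 'v \<Rightarrow> 'v" where
  "poly_act sc p T y = fold_coeffs (\<lambda>c v. sc c y + T v) p 0"

lemma poly_act_0 [simp]: "poly_act sc 0 T y = 0"
  by (simp add: poly_act_def)

lemma poly_act_pCons:
  assumes "T 0 = 0" "sc 0 y = 0"
  shows "poly_act sc (pCons c p) T y = sc c y + T (poly_act sc p T y)"
  using assms by (cases "c = 0 \<and> p = 0") (auto simp: poly_act_def)

abbreviation pa :: "real poly \<Rightarrow> 'a::real_algebra \<Rightarrow> 'a \<Rightarrow> 'a" where
  "pa p a \<equiv> poly_act scaleR p ((*) a)"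

lemma pa_pCons [simp]: "pa (pCons c p) a y = c *\<^sub>R y + a * pa p a y"
  by (rule poly_act_pCons) simp_all

lemma pa_add: "pa (p + q) a y = pa p a y + pa q a y"
proof (induction p arbitrary: q)
  case (pCons c p)
  then show ?case by (cases q) (simp add: algebra_simps)
qed simp

lemma pa_smult: "pa (smult c p) a y = c *\<^sub>R pa p a y"
  by (induction p) (auto simp: algebra_simps)

lemma pa_diff: "pa (p - q) a y = pa p a y - pa q a y"
  using pa_add [of "p - q" q a y] by simp

lemma pa_mult: "pa (p * q) a y = pa p a (pa q a y)"
  by (induction p) (auto simp: pa_add pa_smult)

lemma pa_mult_right: "pa p a (y * z) = pa p a y * z"
  by (induction p) (auto simp: algebra_simps)

lemma pa_add_right: "pa p a (y + z) = pa p a y + pa p a z"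
  by (induction p) (auto simp: algebra_simps)

lemma pa_power: "pa (p ^ n) a y = (pa p a ^^ n) y"
  by (induction n) (auto simp: pa_mult one_pCons)

lemma pa_commute:
  assumes "b * x = x * a"
  shows "x * pa p a y = pa p b (x * y)"
proof (induction p)
  case (pCons c p)
  then show ?case using assms by (simp add: algebra_simps) (metis mult.assoc)
qed simp

lemma pa_star:
  assumes "star a = (a::'a::cstar_algebra)"
  shows "star (pa p a y) * z = star y * pa p a z"
proof (induction p arbitrary: y z)
  case (pCons c p)
  have "star (a * pa p a y) * z = star y * (a * pa p a z)"
    using pCons.IH [of y "a * z"] pa_commute [of a a a p z] assms by (simp add: star_simps mult.assoc)
  then show ?case by (simp add: star_simps algebra_simps)
qed simp

lemma pa_in:
  assumes "real_vector.subspace S" "\<And>v. v \<in> S \<Longrightarrow> a * v \<in> S" "y \<in> S"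
  shows "pa p a y \<in> S"
  using assms by (induction p) (auto simp: real_vector.subspace_0 intro!: real_vector.subspace_add real_vector.subspace_scale)

subsection \<open>Coefficients of a polynomial bounded on the unit circle\<close>

text \<open>Coefficients are Fourier coefficients, and a finite Fourier transform recovers them as
  averages over roots of unity.\<close>

lemma norm_coeff_le_of_unit_circle:
  fixes q :: "complex poly"
  assumes M: "\<And>z. cmod z = 1 \<Longrightarrow> cmod (poly q z) \<le> M"
  shows "cmod (coeff q k) \<le> M"
proof (cases "k \<le> degree q")
  case False
  then show ?thesis using M [of 1] by (simp add: coeff_eq_0 order_trans [OF norm_ge_zero])
next
  case True
  \<comment> \<open>One more than the degree, so distinct exponents up to the degree stay distinct
    modulo \<open>N\<close> and the roots of unity separate them.\<close>
  define N where "N = Suc (degree q)"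
  have "0 < N" by (simp add: N_def)
  define w where "w j = cis (2 * pi * real j / real N)" for j :: nat
  have orth: "(\<Sum>j<N. w j ^ i * cnj (w j) ^ k) = (if i = k then of_nat N else 0)" if i: "i \<le> degree q" for i
  proof (cases "i = k")
    case True
    have "w j ^ i * cnj (w j) ^ k = 1" for j
      by (simp add: True w_def power_mult_distrib [symmetric] cis_cnj cis_mult)
    then show ?thesis using True by simp
  next
    case False
    define z where "z = cis (2 * pi * (real i - real k) / real N)"
    have "w j ^ i * cnj (w j) ^ k = z ^ j" for j
      by (simp add: w_def z_def Complex.DeMoivre cis_cnj cis_mult diff_divide_distrib algebra_simps)
    moreover have "z \<noteq> 1"
    proof
      assume "z = 1"
      then obtain n :: int where "2 * pi * (real i - real k) / real N = 2 * pi * of_int n"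
        unfolding z_def cis_conv_exp exp_eq_1 by auto
      then have "2 * pi * (real i - real k) = 2 * pi * (of_int n * real N)"
        by (simp add: N_def nonzero_divide_eq_eq)
      then have "real i - real k = of_int n * real N" by simp
      then have eq: "int i - int k = n * int N"
        by (metis (mono_tags) of_int_diff of_int_eq_iff of_int_mult of_int_of_nat_eq)
      have "\<bar>int i - int k\<bar> < int N" using i True by (simp add: N_def)
      then have "\<bar>n\<bar> * int N < 1 * int N" by (simp add: eq abs_mult)
      then have "\<bar>n\<bar> < 1" using mult_less_cancel_right_disj [of "\<bar>n\<bar>" "int N" 1] by auto
      then have "n = 0" by simp
      then show False using eq False by simp
    qed
    moreover have "z ^ N = 1"
    proof -
      have "z ^ N = cis (2 * pi * of_int (int i - int k))"
        using \<open>0 < N\<close> by (simp add: z_def Complex.DeMoivre)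
      then show ?thesis by (metis cis_multiple_2pi Ints_of_int)
    qed
    ultimately show ?thesis using False by (simp add: geometric_sum)
  qed
  have "(\<Sum>j<N. poly q (w j) * cnj (w j) ^ k) = (\<Sum>j<N. \<Sum>i\<le>degree q. coeff q i * (w j ^ i * cnj (w j) ^ k))"
    by (simp add: poly_altdef sum_distrib_right mult.assoc)
  also have "\<dots> = (\<Sum>i\<le>degree q. coeff q i * (\<Sum>j<N. w j ^ i * cnj (w j) ^ k))"
    by (subst sum.swap) (simp add: sum_distrib_left)
  also have "\<dots> = (\<Sum>i\<le>degree q. if i = k then of_nat N * coeff q k else 0)"
    by (intro sum.cong) (auto simp: orth)
  also have "\<dots> = of_nat N * coeff q k" using True by simp
  finally have "of_nat N * cmod (coeff q k) = cmod (\<Sum>j<N. poly q (w j) * cnj (w j) ^ k)"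
    by (metis norm_mult norm_of_nat)
  also have "\<dots> \<le> (\<Sum>j<N. M)"
    using M by (intro sum_norm_le) (simp add: norm_mult norm_power w_def)
  finally show ?thesis by (simp add: N_def)
qed

section \<open>Norm bounds for polynomials in a self-adjoint contraction\<close>

lemma sum_list_le_length:
  fixes xs :: "real list"
  assumes "\<And>x. x \<in> set xs \<Longrightarrow> x \<le> M"
  shows "sum_list xs \<le> real (length xs) * M"
  using assms by (induction xs) (auto simp: algebra_simps intro!: add_mono)

text \<open>On the unit circle Re z = (z + 1/z) / 2, and \<open>a\<close> is the same expression in
  \<open>U\<close>. Multiplying by the d-th power clears the negative exponents, so one polynomial
  \<open>q\<close> describes both the scalar function and the operator.\<close>

lemma joukowski_poly:
  fixes U :: "'a::cstar_algebra \<Rightarrow> 'a" and U' :: "'a \<Rightarrow> 'a"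
  assumes add: "\<And>x y. U (x + y) = U x + U y" and scale: "\<And>c x. U (scaleC c x) = scaleC c (U x)"
    and inv: "\<And>x. U (U' x) = x" and a: "\<And>x. 2 *\<^sub>R (a * x) = U x + U' x"
    and "degree p \<le> d"
  shows "\<exists>q. degree q \<le> 2 * d \<and>
    (\<forall>z. cmod z = 1 \<longrightarrow> poly q z = z ^ d * of_real (poly p (Re z))) \<and>
    (\<forall>y. poly_act scaleC q U y = (U ^^ d) (pa p a y))"
  using \<open>degree p \<le> d\<close>
proof (induction d arbitrary: p)
  have [simp]: "U 0 = 0" using scale [of 0 0] by simp
  have pc: "poly_act scaleC (pCons c q) U y = scaleC c y + U (poly_act scaleC q U y)" for c q y
    by (rule poly_act_pCons) auto
  have pc_add: "poly_act scaleC (q + r) U y = poly_act scaleC q U y + poly_act scaleC r U y" for q r y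
  proof (induction q arbitrary: r)
    case (pCons c q)
    then show ?case by (cases r) (simp add: pc add scaleC_add_left)
  qed simp
  have pc_smult: "poly_act scaleC (smult c q) U y = scaleC c (poly_act scaleC q U y)" for c q y
    by (induction q) (auto simp: pc add scale scaleC_add_right scaleC_scaleC)
  have pc_monom: "poly_act scaleC (monom c n) U y = scaleC c ((U ^^ n) y)" for c n y
    by (induction n) (auto simp: pc scale monom_Suc monom_0)
  have pow_add: "(U ^^ n) (x + y) = (U ^^ n) x + (U ^^ n) y" for n x y
    by (induction n) (auto simp: add)
  have pow_scale: "(U ^^ n) (scaleC c x) = scaleC c ((U ^^ n) x)" for n c x
    by (induction n) (auto simp: scale)
  {
    case 0
    then obtain c where p: "p = [:c:]" by (metis degree_eq_zeroE le_zero_eq)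
    show ?case
      by (rule exI [of _ "[:of_real c:]"]) (simp add: p pc scaleC_of_real)
  next
    case (Suc d)
    obtain c p' where p: "p = pCons c p'" by (cases p)
    have "degree p' \<le> d" using Suc.prems by (simp add: p split: if_splits)
    then obtain q where q: "degree q \<le> 2 * d"
      "\<And>z. cmod z = 1 \<Longrightarrow> poly q z = z ^ d * of_real (poly p' (Re z))"
      "\<And>y. poly_act scaleC q U y = (U ^^ d) (pa p' a y)"
      using Suc.IH by blast
    \<comment> \<open>For p = c + t * p', multiplication of z ^ Suc d by Re z gives z ^ d times (1 +
      z * z) / 2; this is the second summand.\<close>
    define r where "r = monom (of_real c) (Suc d) + smult (1/2) (q + pCons 0 (pCons 0 q))"
    have "degree (q + pCons 0 (pCons 0 q)) \<le> 2 * Suc d"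
      using q(1) by (intro degree_add_le) (auto intro!: order_trans [OF degree_pCons_le])
    moreover have "degree (monom (complex_of_real c) (Suc d)) \<le> 2 * Suc d"
      by (rule order_trans [OF degree_monom_le]) simp
    ultimately have "degree r \<le> 2 * Suc d"
      unfolding r_def by (blast intro: degree_add_le order_trans [OF degree_smult_le])
    moreover have "poly r z = z ^ Suc d * of_real (poly p (Re z))" if z: "cmod z = 1" for z
    proof -
      have "z * cnj z = 1" using z by (simp add: complex_norm_square [symmetric])
      then have "1 + z * z = z * (cnj z + z)" by (simp add: algebra_simps)
      also have "cnj z + z = 2 * of_real (Re z)" using complex_add_cnj [of z] by (simp add: add.commute)
      finally have e: "(1 + z * z) / 2 = z * of_real (Re z)" by simp
      have "poly r z = of_real c * z ^ Suc d + (1 + z * z) / 2 * poly q z"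
        by (simp add: r_def poly_monom algebra_simps)
      then show ?thesis unfolding e by (simp add: q(2) z p algebra_simps)
    qed
    moreover have "poly_act scaleC r U y = (U ^^ Suc d) (pa p a y)" for y
    proof -
      define v where "v = pa p' a y"
      have U2: "U (U (U' v)) = U v" using inv by simp
      have "a * v = scaleC (1/2) (U v + U' v)"
        using a [of v, symmetric] by (simp flip: scaleC_of_real add: scaleC_scaleC)
      then have *: "(U ^^ Suc d) (a * v) = scaleC (1/2) ((U ^^ d) (U (U v)) + (U ^^ d) v)"
        by (simp only: funpow_Suc_right o_def scale add inv pow_scale pow_add)
      have "poly_act scaleC r U y =
          scaleC (of_real c) ((U ^^ Suc d) y) + scaleC (1/2) ((U ^^ d) v + U (U ((U ^^ d) v)))"
        by (simp add: r_def pc_add pc_smult pc_monom pc q(3) v_def)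
      also have "U (U ((U ^^ d) v)) = (U ^^ d) (U (U v))"
        by (simp add: funpow_swap1)
      also have "scaleC (of_real c) ((U ^^ Suc d) y) + scaleC (1/2) ((U ^^ d) v + (U ^^ d) (U (U v)))
          = (U ^^ Suc d) (pa p a y)"
        unfolding p pa_pCons pow_add v_def [symmetric] * scaleC_of_real [symmetric] pow_scale
        by (simp add: add.commute)
      finally show ?thesis .
    qed
    ultimately show ?case by blast
  }
qed

text \<open>With \<open>(1 - s)\<^sup>2 = 1 - a\<^sup>2\<close>, the operator \<open>U = a + \<i> (1 - s)\<close> is a unitary with real part \<open>a\<close>.\<close>

lemma norm_pa_le_degree:
  fixes a :: "'a::cstar_algebra"
  assumes sa: "star a = a" and a: "norm a < 1"
    and M: "\<And>t. \<bar>t\<bar> \<le> 1 \<Longrightarrow> \<bar>poly p t\<bar> \<le> M"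
  shows "norm (pa p a y) \<le> real (2 * degree p + 1) * M * norm y"
proof -
  have "norm (a * a) < 1"
    using cstar_identity [of a] sa a by (simp add: power_less_one_iff)
  then obtain s where s: "star s = s" "2 *\<^sub>R s - s * s = a * a" "\<And>z. z * (a * a) = (a * a) * z \<Longrightarrow> z * s = s * z"
    using square_root_one_minus_exists [of "a * a"] sa by (metis star_mult)
  have as: "a * s = s * a" using s(3) [of a] by (simp add: mult.assoc)
  define U where "U y = a * y + scaleC \<i> (y - s * y)" for y
  define U' where "U' y = a * y - scaleC \<i> (y - s * y)" for y
  have s_left: "s * (s * x) = 2 *\<^sub>R (s * x) - a * (a * x)" for x
  proof -
    have "s * s = 2 *\<^sub>R s - a * a" using s(2) by (simp add: algebra_simps)
    then show ?thesis by (metis left_diff_distrib mult.assoc mult_scaleR_left)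
  qed
  have as_left: "s * (a * x) = a * (s * x)" for x by (metis as mult.assoc)
  have ii: "scaleC \<i> (scaleC \<i> x) = - x" for x :: 'a
    using scaleC_of_real [of "-1" x] by (simp add: scaleC_scaleC)
  have sdiff: "scaleC c (x - y) = scaleC c x - scaleC c y" for c and x y :: 'a
    by (rule complex_vector.scale_right_diff_distrib)
  have inv: "U (U' x) = x" for x
    by (simp add: U_def U'_def algebra_simps sdiff scaleC_add_right ii mult_scaleC_left mult_scaleC_right
        scaleR_2 as_left s_left)
  have star_U: "star (U x) * z = star x * U' z" for x z
    by (simp add: U_def U'_def star_simps sa s(1) algebra_simps mult_scaleC_left mult_scaleC_right sdiff)
  have inv': "U' (U x) = x" for x
    by (simp add: U_def U'_def algebra_simps sdiff scaleC_add_right ii mult_scaleC_left mult_scaleC_right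
        scaleR_2 as_left s_left)
  have norm_U: "norm (U x) = norm x" for x
  proof -
    have "star (U x) * U x = star x * x" by (simp add: star_U inv')
    then show ?thesis by (metis cstar_identity norm_ge_zero power2_eq_iff_nonneg)
  qed
  have U0: "U 0 = 0" by (simp add: U_def)
  have "\<exists>q. degree q \<le> 2 * degree p \<and>
    (\<forall>z. cmod z = 1 \<longrightarrow> poly q z = z ^ degree p * of_real (poly p (Re z))) \<and>
    (\<forall>y. poly_act scaleC q U y = (U ^^ degree p) (pa p a y))"
  proof (rule joukowski_poly [where U' = U'])
    show "2 *\<^sub>R (a * x) = U x + U' x" for x by (simp add: U_def U'_def scaleR_2)
    show "U (x + y) = U x + U y" for x y by (simp add: U_def algebra_simps scaleC_add_right sdiff)
    show "U (scaleC c x) = scaleC c (U x)" for c x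
      by (simp add: U_def scaleC_add_right mult_scaleC_right scaleC_scaleC sdiff mult.commute)
  qed (rule inv, rule order_refl)
  then obtain q where q: "degree q \<le> 2 * degree p"
      "\<And>z. cmod z = 1 \<Longrightarrow> poly q z = z ^ degree p * of_real (poly p (Re z))"
      "\<And>y. poly_act scaleC q U y = (U ^^ degree p) (pa p a y)"
    by blast
  have M0: "0 \<le> M" using M [of 0] by simp
  \<comment> \<open>On the unit circle the factor z ^ degree p has modulus 1, so the bound on the
    interval passes to \<open>q\<close> and from there to each of its at most 2 * degree p + 1
    coefficients.\<close>
  have "cmod (poly q z) \<le> M" if "cmod z = 1" for z
    using M [of "Re z"] abs_Re_le_cmod [of z] that by (simp add: q(2) norm_mult norm_power)
  then have coeff: "cmod (coeff q k) \<le> M" for k by (rule norm_coeff_le_of_unit_circle)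
  have "norm (poly_act scaleC q U y) \<le> sum_list (map cmod (coeffs q)) * norm y" for q
  proof (induction q)
    case (pCons c q)
    have "norm (poly_act scaleC (pCons c q) U y) \<le> cmod c * norm y + norm (poly_act scaleC q U y)"
      by (subst poly_act_pCons) (auto simp: U0 norm_scaleC norm_U intro!: norm_triangle_le)
    also have "\<dots> \<le> sum_list (map cmod (coeffs (pCons c q))) * norm y"
      using pCons by (auto simp: cCons_def algebra_simps)
    finally show ?case .
  qed simp
  also have "sum_list (map cmod (coeffs q)) \<le> real (length (map cmod (coeffs q))) * M"
    using coeff by (intro sum_list_le_length) (auto simp: coeffs_def split: if_splits)
  also have "\<dots> \<le> real (2 * degree p + 1) * M"
    using q(1) M0 by (intro mult_right_mono) (auto simp: coeffs_def)
  finally have "norm (poly_act scaleC q U y) \<le> real (2 * degree p + 1) * M * norm y"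
    by (simp add: mult_right_mono)
  moreover have "norm ((U ^^ n) x) = norm x" for n x by (induction n) (auto simp: norm_U)
  ultimately show ?thesis by (simp add: q(3))
qed

text \<open>Powers of a number above 1 outgrow any linear function of the exponent. Bernoulli's
  inequality alone is only linear, so it is applied to sqrt r and squared, which gives quadratic
  growth.\<close>

lemma le_of_power_le_linear:
  fixes r :: real
  assumes "\<And>k::nat. r ^ (2 ^ k) \<le> C * 2 ^ k + 1" "0 \<le> C"
  shows "r \<le> 1"
proof (rule ccontr)
  assume "\<not> r \<le> 1"
  then have r: "sqrt r > 1" by simp
  define e where "e = sqrt r - 1"
  have e: "e > 0" using r by (simp add: e_def)
  obtain k :: nat where k: "2 ^ k > (C + 1) / e\<^sup>2"
    using real_arch_pow [of 2 "(C + 1) / e\<^sup>2"] by auto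
  have "1 + real (2 ^ k) * e \<le> (1 + e) ^ (2 ^ k)"
    using e by (intro Bernoulli_inequality) auto
  then have "(real (2 ^ k) * e)\<^sup>2 \<le> ((1 + e) ^ (2 ^ k))\<^sup>2"
    using e by (intro power_mono) auto
  also have "\<dots> = r ^ (2 ^ k)"
    using r by (simp add: e_def power_mult [symmetric] mult.commute [of _ 2]) (simp add: power_mult)
  also have "\<dots> \<le> C * 2 ^ k + 1" by (rule assms)
  also have "\<dots> \<le> (C + 1) * 2 ^ k" by (simp add: algebra_simps)
  finally have "2 ^ k * (2 ^ k * e\<^sup>2) \<le> 2 ^ k * (C + 1)" by (simp add: power2_eq_square algebra_simps)
  then have "2 ^ k * e\<^sup>2 \<le> C + 1" by simp
  with k e show False by (simp add: field_simps)
qed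

text \<open>
  Applying the crude bound to \<open>p ^ (2 ^ k)\<close> and using the C*-identity removes the factor depending
  on the degree.
\<close>

lemma norm_pa_le:
  fixes a :: "'a::cstar_algebra"
  assumes sa: "star a = a" and a: "norm a < 1"
    and M: "\<And>t. \<bar>t\<bar> \<le> 1 \<Longrightarrow> \<bar>poly p t\<bar> \<le> M"
  shows "norm (pa p a y) \<le> M * norm y"
proof -
  \<comment> \<open>Strict positivity permits the division by \<open>M * norm y\<close>; the general
    case follows by letting the bound decrease to \<open>M\<close>.\<close>
  have *: "norm (pa p a y) \<le> M * norm y" if M: "\<And>t. \<bar>t\<bar> \<le> 1 \<Longrightarrow> \<bar>poly p t\<bar> \<le> M" and M0: "M > 0" for M
  proof (cases "y = 0")
    case True
    then show ?thesis using pa_mult_right [of p a 0 0] by simp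
  next
    case False
    define T where "T = pa p a"
    have T_star: "star ((T ^^ n) u) * v = star u * (T ^^ n) v" for n u v
      using pa_star [OF sa, of "p ^ n"] by (simp add: pa_power T_def)
    \<comment> \<open>Each doubling squares the previous inequality and applies Cauchy-Schwarz to
      the self-adjoint operator \<open>T ^^ (2 ^ k)\<close>.\<close>
    have "norm (T y) ^ (2 ^ k) * norm y \<le> norm y ^ (2 ^ k) * norm ((T ^^ (2 ^ k)) y)" for k
    proof (induction k)
      case (Suc k)
      let ?N = "2 ^ k :: nat"
      have "(norm (T y) ^ ?N * norm y)\<^sup>2 \<le> (norm y ^ ?N * norm ((T ^^ ?N) y))\<^sup>2"
        using Suc by (intro power_mono) auto
      also have "\<dots> \<le> (norm y ^ ?N)\<^sup>2 * (norm y * norm ((T ^^ ?N) ((T ^^ ?N) y)))"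
        unfolding power_mult_distrib
        by (intro mult_left_mono norm_power2_le_of_self_adjoint T_star) auto
      also have "(T ^^ ?N) ((T ^^ ?N) y) = (T ^^ (2 ^ Suc k)) y"
        by (simp add: mult_2 funpow_add)
      finally have "norm y * (norm (T y) ^ (2 ^ Suc k) * norm y) \<le> norm y * (norm y ^ (2 ^ Suc k) * norm ((T ^^ (2 ^ Suc k)) y))"
        by (simp add: power2_eq_square power_add mult_2 algebra_simps)
      then show ?case using False by simp
    qed simp
    moreover have "norm ((T ^^ (2 ^ k)) y) \<le> (real (2 * degree p) * 2 ^ k + 1) * M ^ (2 ^ k) * norm y" for k
    proof -
      have "norm (pa (p ^ (2 ^ k)) a y) \<le> real (2 * degree (p ^ (2 ^ k)) + 1) * M ^ (2 ^ k) * norm y"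
        using M by (intro norm_pa_le_degree sa a) (auto simp: poly_power power_abs intro!: power_mono)
      also have "\<dots> \<le> (real (2 * degree p) * 2 ^ k + 1) * M ^ (2 ^ k) * norm y"
      proof -
        have "real (degree (p ^ (2 ^ k))) \<le> real (degree p * 2 ^ k)"
          using degree_power_le of_nat_le_iff by blast
        then show ?thesis using M0 by (intro mult_right_mono) auto
      qed
      finally show ?thesis by (simp add: T_def pa_power)
    qed
    ultimately have "norm (T y) ^ (2 ^ k) * norm y \<le>
        norm y ^ (2 ^ k) * ((real (2 * degree p) * 2 ^ k + 1) * M ^ (2 ^ k) * norm y)" for k
      by (meson order_trans mult_left_mono zero_le_power norm_ge_zero)
    then have "norm (T y) ^ (2 ^ k) \<le> (real (2 * degree p) * 2 ^ k + 1) * (M * norm y) ^ (2 ^ k)" for k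
      using False by (simp add: power_mult_distrib mult.assoc [symmetric]) (simp add: algebra_simps)
    then have "(norm (T y) / (M * norm y)) ^ (2 ^ k) \<le> real (2 * degree p) * 2 ^ k + 1" for k
      using False M0 by (simp add: power_divide divide_le_eq)
    then have "norm (T y) / (M * norm y) \<le> 1"
      by (rule le_of_power_le_linear) simp
    then show ?thesis using False M0 by (simp add: T_def divide_le_eq)
  qed
  show ?thesis
  proof (rule field_le_epsilon)
    fix e :: real assume e: "e > 0"
    have "0 \<le> M" using M [of 0] by simp
    have "norm y + 1 > 0" by (simp add: add_nonneg_pos)
    define d where "d = e / (norm y + 1)"
    have d: "d > 0" using e \<open>norm y + 1 > 0\<close> by (simp add: d_def)
    have "norm (pa p a y) \<le> (M + d) * norm y"
      using d \<open>0 \<le> M\<close> by (intro *) (auto intro: order_trans [OF M])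
    also have "\<dots> = M * norm y + d * norm y" by (simp add: algebra_simps)
    also have "d * norm y \<le> e"
      using e \<open>norm y + 1 > 0\<close> by (simp add: d_def pos_divide_le_eq algebra_simps)
    finally show "norm (pa p a y) \<le> M * norm y + e" by simp
  qed
qed

section \<open>Continuous functional calculus\<close>

lemma uniform_limit_polynomials_exists:
  fixes f :: "real \<Rightarrow> real"
  assumes "continuous_on {-1..1} f"
  shows "\<exists>p. uniform_limit {-1..1} (\<lambda>n. poly (p n)) f sequentially"
proof -
  have "\<exists>p. \<forall>t\<in>{-1..1}. \<bar>f t - poly p t\<bar> < inverse (real (Suc n))" for n
  proof -
    obtain g where g: "real_polynomial_function g" "\<And>t. t \<in> {-1..1} \<Longrightarrow> \<bar>f t - g t\<bar> < inverse (real (Suc n))"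
      using Stone_Weierstrass_real_polynomial_function [OF compact_Icc assms, of "inverse (real (Suc n))"] by auto
    then obtain c N where "g = (\<lambda>t. \<Sum>i\<le>N. c i * t ^ i)"
      using real_polynomial_function_iff_sum by blast
    then have "g t = poly (\<Sum>i\<le>N. monom (c i) i) t" for t
      by (simp add: poly_sum poly_monom)
    then show ?thesis using g(2) by (metis (no_types))
  qed
  then obtain p where p: "\<And>n t. t \<in> {-1..1} \<Longrightarrow> \<bar>f t - poly (p n) t\<bar> < inverse (real (Suc n))"
    by metis
  have "uniform_limit {-1..1} (\<lambda>n. poly (p n)) f sequentially"
  proof (rule uniform_limitI)
    fix e :: real assume "e > 0"
    then obtain N where N: "inverse (real (Suc N)) < e" using reals_Archimedean by blast
    have "dist (poly (p n) t) (f t) < e" if "n \<ge> N" "t \<in> {-1..1}" for n t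
    proof -
      have "inverse (real (Suc n)) \<le> inverse (real (Suc N))" using that by (intro le_imp_inverse_le) auto
      then show ?thesis using p [OF that(2), of n] N unfolding dist_real_def by linarith
    qed
    then show "\<forall>\<^sub>F n in sequentially. \<forall>t\<in>{-1..1}. dist (poly (p n) t) (f t) < e"
      using eventually_sequentially by blast
  qed
  then show ?thesis by blast
qed

text \<open>The value f(a) y instead of an element f(a): in a non-unital algebra f(a) is in general
  only a multiplier. The approximating polynomials are an arbitrary choice; \<open>fc_LIMSEQ\<close>
  shows that for self-adjoint \<open>a\<close> of norm below 1 any uniform approximation of f on
  [-1, 1] gives the same limit.\<close>

definition fc :: "'a::cstar_algebra \<Rightarrow> (real \<Rightarrow> real) \<Rightarrow> 'a \<Rightarrow> 'a" where
  "fc a f y = lim (\<lambda>n. pa ((SOME p. uniform_limit {-1..1} (\<lambda>n. poly (p n)) f sequentially) n) a y)"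

lemma fc_cong: "(\<And>t. \<bar>t\<bar> \<le> 1 \<Longrightarrow> f t = g t) \<Longrightarrow> fc a f y = fc a g y"
proof -
  assume "\<And>t. \<bar>t\<bar> \<le> 1 \<Longrightarrow> f t = g t"
  then have "uniform_limit {-1..1} (\<lambda>n. poly (p n)) f sequentially =
    uniform_limit {-1..1} (\<lambda>n. poly (p n)) g sequentially" for p
    by (intro uniform_limit_cong) auto
  then show ?thesis by (simp add: fc_def)
qed

definition sa_contraction :: "'a::cstar_algebra \<Rightarrow> bool" where
  "sa_contraction a \<longleftrightarrow> star a = a \<and> norm a < 1"

text \<open>Two polynomials close on [-1, 1] act almost equally by \<open>norm_pa_le\<close>. This
  gives at once the Cauchy property of the chosen sequence and its agreement with any other
  one.\<close>

lemma fc_LIMSEQ: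
  assumes a: "sa_contraction a" and lim: "uniform_limit {-1..1} (\<lambda>n. poly (p n)) f sequentially"
  shows "(\<lambda>n. pa (p n) a y) \<longlonglongrightarrow> fc a f y"
proof -
  define q where "q = (SOME p. uniform_limit {-1..1} (\<lambda>n. poly (p n)) f sequentially)"
  have q: "uniform_limit {-1..1} (\<lambda>n. poly (q n)) f sequentially"
    unfolding q_def by (rule someI [of _ p]) (rule lim)
  have close: "\<exists>N. \<forall>m\<ge>N. \<forall>n\<ge>N. norm (pa (r m) a y - pa (s n) a y) < e"
    if r: "uniform_limit {-1..1} (\<lambda>n. poly (r n)) f sequentially"
      and s: "uniform_limit {-1..1} (\<lambda>n. poly (s n)) f sequentially" and e: "e > 0" for r s e
  proof -
    have pos: "norm y + 1 > 0" by (simp add: add_nonneg_pos)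
    define d where "d = e / 2 / (norm y + 1)"
    have d: "d > 0" using e pos by (simp add: d_def)
    obtain N1 where N1: "\<And>n t. n \<ge> N1 \<Longrightarrow> t \<in> {-1..1} \<Longrightarrow> dist (poly (r n) t) (f t) < d"
      using uniform_limitD [OF r d] unfolding eventually_sequentially by blast
    obtain N2 where N2: "\<And>n t. n \<ge> N2 \<Longrightarrow> t \<in> {-1..1} \<Longrightarrow> dist (poly (s n) t) (f t) < d"
      using uniform_limitD [OF s d] unfolding eventually_sequentially by blast
    have "norm (pa (r m) a y - pa (s n) a y) < e" if "m \<ge> max N1 N2" "n \<ge> max N1 N2" for m n
    proof -
      have "\<bar>poly (r m - s n) t\<bar> \<le> 2 * d" if "\<bar>t\<bar> \<le> 1" for t
      proof -
        have "dist (poly (r m) t) (f t) < d" "dist (poly (s n) t) (f t) < d"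
          using that \<open>m \<ge> max N1 N2\<close> \<open>n \<ge> max N1 N2\<close> by (auto intro!: N1 N2)
        then show ?thesis unfolding dist_real_def poly_diff by linarith
      qed
      then have "norm (pa (r m - s n) a y) \<le> 2 * d * norm y"
        using a by (intro norm_pa_le) (auto simp: sa_contraction_def)
      also have "\<dots> < 2 * d * (norm y + 1)" using d by simp
      also have "\<dots> = e"
      proof -
        have "d * (norm y + 1) = e / 2" using pos unfolding d_def by (intro nonzero_eq_divide_eq [THEN iffD1]) auto
        then show ?thesis by (simp only: mult.assoc)
      qed
      finally show ?thesis by (simp add: pa_diff)
    qed
    then show ?thesis by blast
  qed
  have "Cauchy (\<lambda>n. pa (q n) a y)"
    unfolding Cauchy_iff using close [OF q q] by blast
  then have "(\<lambda>n. pa (q n) a y) \<longlonglongrightarrow> fc a f y"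
    unfolding fc_def q_def [symmetric] by (simp add: Cauchy_convergent_iff convergent_LIMSEQ_iff)
  moreover have "(\<lambda>n. pa (p n) a y - pa (q n) a y) \<longlonglongrightarrow> 0"
    unfolding LIMSEQ_iff using close [OF lim q] by (metis diff_zero)
  ultimately have "(\<lambda>n. (pa (p n) a y - pa (q n) a y) + pa (q n) a y) \<longlonglongrightarrow> 0 + fc a f y"
    by (intro tendsto_add)
  then show ?thesis by simp
qed

lemma fc_poly:
  assumes "sa_contraction a"
  shows "fc a (poly p) y = pa p a y"
  using fc_LIMSEQ [OF assms, of "\<lambda>_. p" "poly p" y] by (simp add: uniform_limit_const LIMSEQ_const_iff)

lemma fc_const: "sa_contraction a \<Longrightarrow> fc a (\<lambda>t. c) y = c *\<^sub>R y"
  using fc_poly [of a "[:c:]" y] fc_cong [of "\<lambda>t. c" "poly [:c:]" a y] by simp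

lemma fc_id: "sa_contraction a \<Longrightarrow> fc a (\<lambda>t. t) y = a * y"
  using fc_poly [of a "[:0, 1:]" y] fc_cong [of "\<lambda>t. t" "poly [:0, 1:]" a y] by simp

context
  fixes a :: "'a::cstar_algebra"
  assumes a: "sa_contraction a"
begin

lemma fc_in_closed:
  assumes f: "continuous_on {-1..1} f" and S: "real_vector.subspace S" "closed S"
    and "\<And>v. v \<in> S \<Longrightarrow> a * v \<in> S" "y \<in> S"
  shows "fc a f y \<in> S"
proof -
  obtain p where "uniform_limit {-1..1} (\<lambda>n. poly (p n)) f sequentially"
    using uniform_limit_polynomials_exists [OF f] by blast
  then have lim: "(\<lambda>n. pa (p n) a y) \<longlonglongrightarrow> fc a f y" by (rule fc_LIMSEQ [OF a])
  have "pa (p n) a y \<in> S" for n using S(1) assms(4,5) by (rule pa_in)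
  then show ?thesis by (rule closed_sequentially [OF S(2) _ lim])
qed

lemma norm_fc_le:
  assumes f: "continuous_on {-1..1} f" and M: "\<And>t. \<bar>t\<bar> \<le> 1 \<Longrightarrow> \<bar>f t\<bar> \<le> M"
  shows "norm (fc a f y) \<le> M * norm y"
proof (rule field_le_epsilon)
  fix e :: real assume e: "e > 0"
  have pos: "norm y + 1 > 0" by (simp add: add_nonneg_pos)
  define d where "d = e / (norm y + 1)"
  have d: "d > 0" using e pos by (simp add: d_def)
  obtain p where p: "uniform_limit {-1..1} (\<lambda>n. poly (p n)) f sequentially"
    using uniform_limit_polynomials_exists [OF f] by blast
  have "\<forall>\<^sub>F n in sequentially. norm (pa (p n) a y) \<le> (M + d) * norm y"
    using uniform_limitD [OF p d]
  proof eventually_elim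
    case (elim n)
    have "\<bar>poly (p n) t\<bar> \<le> M + d" if "\<bar>t\<bar> \<le> 1" for t
    proof -
      have "\<bar>poly (p n) t - f t\<bar> < d" using elim that by (simp add: dist_real_def abs_le_iff)
      then show ?thesis using M [OF that] by linarith
    qed
    then show ?case using a by (intro norm_pa_le) (auto simp: sa_contraction_def)
  qed
  then have "norm (fc a f y) \<le> (M + d) * norm y"
    using tendsto_upperbound [OF tendsto_norm [OF fc_LIMSEQ [OF a p, of y]]] by auto
  also have "\<dots> = M * norm y + d * norm y" by (simp add: algebra_simps)
  also have "d * norm y \<le> e" using e pos by (simp add: d_def pos_divide_le_eq algebra_simps)
  finally show "norm (fc a f y) \<le> M * norm y + e" by simp
qed

lemma fc_add:
  assumes f: "continuous_on {-1..1} f" and g: "continuous_on {-1..1} g"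
  shows "fc a (\<lambda>t. f t + g t) y = fc a f y + fc a g y"
proof -
  obtain p q where p: "uniform_limit {-1..1} (\<lambda>n. poly (p n)) f sequentially"
    and q: "uniform_limit {-1..1} (\<lambda>n. poly (q n)) g sequentially"
    using uniform_limit_polynomials_exists f g by meson
  have "uniform_limit {-1..1} (\<lambda>n. poly (p n + q n)) (\<lambda>t. f t + g t) sequentially"
    using uniform_limit_add [OF p q] by (simp add: poly_add [abs_def])
  from fc_LIMSEQ [OF a this, of y]
  have "(\<lambda>n. pa (p n) a y + pa (q n) a y) \<longlonglongrightarrow> fc a (\<lambda>t. f t + g t) y" by (simp add: pa_add)
  moreover have "(\<lambda>n. pa (p n) a y + pa (q n) a y) \<longlonglongrightarrow> fc a f y + fc a g y"
    by (intro tendsto_add fc_LIMSEQ a p q)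
  ultimately show ?thesis by (rule LIMSEQ_unique)
qed

lemma fc_mult_right:
  assumes f: "continuous_on {-1..1} f"
  shows "fc a f (y * z) = fc a f y * z"
proof -
  obtain p where p: "uniform_limit {-1..1} (\<lambda>n. poly (p n)) f sequentially"
    using uniform_limit_polynomials_exists f by meson
  have "(\<lambda>n. pa (p n) a y * z) \<longlonglongrightarrow> fc a f y * z"
    by (intro tendsto_mult tendsto_const fc_LIMSEQ a p)
  with fc_LIMSEQ [OF a p, of "y * z"] show ?thesis
    by (simp add: pa_mult_right LIMSEQ_unique)
qed

lemma fc_commute:
  assumes f: "continuous_on {-1..1} f" and b: "sa_contraction b" and eq: "b * x = x * a"
  shows "x * fc a f y = fc b f (x * y)"
proof -
  obtain p where p: "uniform_limit {-1..1} (\<lambda>n. poly (p n)) f sequentially"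
    using uniform_limit_polynomials_exists f by meson
  have "(\<lambda>n. x * pa (p n) a y) \<longlonglongrightarrow> x * fc a f y"
    by (intro tendsto_mult tendsto_const fc_LIMSEQ a p)
  with fc_LIMSEQ [OF b p, of "x * y"] show ?thesis
    by (simp add: pa_commute [OF eq] LIMSEQ_unique)
qed

lemma fc_mult:
  assumes f: "continuous_on {-1..1} f" and g: "continuous_on {-1..1} g"
  shows "fc a (\<lambda>t. f t * g t) y = fc a f (fc a g y)"
proof -
  obtain p q where p: "uniform_limit {-1..1} (\<lambda>n. poly (p n)) f sequentially"
    and q: "uniform_limit {-1..1} (\<lambda>n. poly (q n)) g sequentially"
    using uniform_limit_polynomials_exists f g by meson
  have bf: "bounded (f ` {-1..1})" and bg: "bounded (g ` {-1..1})"
    using f g by (auto intro!: compact_imp_bounded compact_continuous_image)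
  have "uniform_limit {-1..1} (\<lambda>n. poly (p n * q n)) (\<lambda>t. f t * g t) sequentially"
    using uniform_lim_mult [OF p q bf bg] by (simp add: poly_mult [abs_def])
  from fc_LIMSEQ [OF a this, of y]
  have 1: "(\<lambda>n. pa (p n) a (pa (q n) a y)) \<longlonglongrightarrow> fc a (\<lambda>t. f t * g t) y" by (simp add: pa_mult)
  obtain C where C: "\<And>t. t \<in> {-1..1} \<Longrightarrow> \<bar>f t\<bar> \<le> C"
    using bf unfolding bounded_iff by (metis imageI real_norm_def)
  define v where "v n = pa (q n) a y - fc a g y" for n
  have "v \<longlonglongrightarrow> 0"
    unfolding v_def using fc_LIMSEQ [OF a q, of y] by (simp add: LIM_zero)
  \<comment> \<open>The polynomials approximating \<open>f\<close> eventually stay below C + 1, so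
    they act on the error \<open>v n\<close> in a uniformly bounded way.\<close>
  have ev: "\<forall>\<^sub>F n in sequentially. norm (pa (p n) a (v n)) \<le> (C + 1) * norm (v n)"
    using uniform_limitD [OF p zero_less_one]
  proof eventually_elim
    case (elim n)
    have "\<bar>poly (p n) t\<bar> \<le> C + 1" if "\<bar>t\<bar> \<le> 1" for t
    proof -
      have "t \<in> {-1..1}" using that by auto
      then have "\<bar>poly (p n) t - f t\<bar> < 1" using elim by (simp add: dist_real_def)
      then show ?thesis using C [OF \<open>t \<in> {-1..1}\<close>] by linarith
    qed
    then show ?case using a by (intro norm_pa_le) (auto simp: sa_contraction_def)
  qed
  have "(\<lambda>n. (C + 1) * norm (v n)) \<longlonglongrightarrow> 0"
    using tendsto_mult_left [OF tendsto_norm [OF \<open>v \<longlonglongrightarrow> 0\<close>], of "C + 1"] by simp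
  from Lim_null_comparison [OF ev this] have "(\<lambda>n. pa (p n) a (v n)) \<longlonglongrightarrow> 0" .
  then have "(\<lambda>n. pa (p n) a (fc a g y) + pa (p n) a (v n)) \<longlonglongrightarrow> fc a f (fc a g y) + 0"
    by (intro tendsto_add fc_LIMSEQ a p)
  then have "(\<lambda>n. pa (p n) a (pa (q n) a y)) \<longlonglongrightarrow> fc a f (fc a g y)"
    by (simp add: pa_add_right [symmetric] v_def)
  with 1 show ?thesis by (rule LIMSEQ_unique)
qed

lemma fc_cmult:
  assumes f: "continuous_on {-1..1} f"
  shows "fc a (\<lambda>t. c * f t) y = c *\<^sub>R fc a f y"
  using fc_mult [OF continuous_on_const f, of c y] a by (simp add: fc_const)

lemma fc_diff:
  assumes f: "continuous_on {-1..1} f" and g: "continuous_on {-1..1} g"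
  shows "fc a (\<lambda>t. f t - g t) y = fc a f y - fc a g y"
  using fc_add [OF continuous_on_diff [OF f g] g, of y] by simp

lemma fc_star:
  assumes f: "continuous_on {-1..1} f"
  shows "star (fc a f y) * z = star y * fc a f z"
proof -
  obtain p where p: "uniform_limit {-1..1} (\<lambda>n. poly (p n)) f sequentially"
    using uniform_limit_polynomials_exists f by meson
  have "(\<lambda>n. star (pa (p n) a y) * z) \<longlonglongrightarrow> star (fc a f y) * z"
    by (intro tendsto_mult tendsto_const fc_LIMSEQ a p bounded_linear.tendsto [OF bounded_linear_star])
  moreover have "(\<lambda>n. star y * pa (p n) a z) \<longlonglongrightarrow> star y * fc a f z"
    by (intro tendsto_mult tendsto_const fc_LIMSEQ a p)
  moreover have "star (pa (p n) a y) * z = star y * pa (p n) a z" for n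
    using a by (intro pa_star) (simp add: sa_contraction_def)
  ultimately show ?thesis by (simp add: LIMSEQ_unique)
qed

text \<open>The main source of genuine elements: \<open>fc a f a\<close> implements the function
  f(t) * t.\<close>

lemma fc_self_mult:
  assumes f: "continuous_on {-1..1} f"
  shows "fc a f a * z = fc a (\<lambda>t. f t * t) z"
  by (simp add: fc_mult [OF f continuous_on_id] fc_id a fc_mult_right [OF f])

lemma star_fc_self:
  assumes f: "continuous_on {-1..1} f"
  shows "star (fc a f a) = fc a f a"
proof (rule eq_of_left_mult)
  fix z
  have "star (fc a f a) * z = a * fc a f z"
    using a by (simp add: fc_star [OF f] sa_contraction_def)
  then show "star (fc a f a) * z = fc a f a * z"
    by (simp add: fc_commute [OF f a] fc_mult_right [OF f])
qed

lemma norm_fc_self_le: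
  assumes f: "continuous_on {-1..1} f" and M: "\<And>t. \<bar>t\<bar> \<le> 1 \<Longrightarrow> \<bar>f t * t\<bar> \<le> M"
  shows "norm (fc a f a) \<le> M"
proof (rule norm_le_of_left_mult)
  show "0 \<le> M" using M [of 0] by simp
  show "norm (fc a f a * y) \<le> M * norm y" for y
    unfolding fc_self_mult [OF f] by (rule norm_fc_le) (auto intro!: continuous_intros f M)
qed

text \<open>Vanishing at 0 is enough for f(a) to be an element, even where f(t) / t is unbounded.
  Square roots are needed later, and \<open>fc_self_mult\<close> does not reach them.\<close>

lemma fc_element_exists:
  assumes f: "continuous_on {-1..1} f" and f0: "f 0 = 0"
    and A: "real_vector.subspace A" "closed A" "\<And>v. v \<in> A \<Longrightarrow> a * v \<in> A" "a \<in> A"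
  shows "\<exists>e\<in>A. \<forall>y. fc a f y = e * y"
proof -
  obtain p where p: "uniform_limit {-1..1} (\<lambda>n. poly (p n)) f sequentially"
    using uniform_limit_polynomials_exists f by meson
  \<comment> \<open>The constant terms tend to f 0 = 0; without them each polynomial is divisible by
    t and therefore acts as an element.\<close>
  define q where "q n = p n - [:poly (p n) 0:]" for n
  have "(\<lambda>n. poly (p n) 0) \<longlonglongrightarrow> 0"
    using tendsto_uniform_limitI [OF p, of 0] f0 by simp
  then have "uniform_limit {-1..1} (\<lambda>n t::real. poly (p n) 0) (\<lambda>t. 0) sequentially"
    by (simp add: uniform_limit_iff tendsto_iff)
  from uniform_limit_minus [OF p this]
  have q: "uniform_limit {-1..1} (\<lambda>n. poly (q n)) f sequentially"
    by (simp add: q_def poly_diff [abs_def])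
  note lim = fc_LIMSEQ [OF a q]
  have "\<exists>r. q n = pCons 0 r" for n
  proof (cases "q n")
    case (pCons c r)
    moreover have "poly (q n) 0 = 0" by (simp add: q_def)
    ultimately show ?thesis by auto
  qed
  then obtain r where r: "\<And>n. q n = pCons 0 (r n)" by metis
  define e where "e n = pa (r n) a a" for n
  have ey: "e n * y = pa (q n) a y" for n y
    by (simp only: e_def r pa_mult_right [symmetric] pa_pCons scaleR_zero_left add_0 pa_commute [OF refl])
  have "Cauchy e"
    unfolding Cauchy_iff
  proof (intro allI impI)
    fix d :: real assume d: "d > 0"
    obtain N where N: "\<And>n t. n \<ge> N \<Longrightarrow> t \<in> {-1..1} \<Longrightarrow> dist (poly (q n) t) (f t) < d / 3"
      using uniform_limitD [OF q, of "d / 3"] d unfolding eventually_sequentially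
      by (metis divide_pos_pos zero_less_numeral)
    have "norm (e m - e n) < d" if "m \<ge> N" "n \<ge> N" for m n
    proof -
      have "\<bar>poly (q m - q n) t\<bar> \<le> 2 * d / 3" if "\<bar>t\<bar> \<le> 1" for t
      proof -
        have "dist (poly (q m) t) (f t) < d / 3" "dist (poly (q n) t) (f t) < d / 3"
          using that \<open>m \<ge> N\<close> \<open>n \<ge> N\<close> N [of _ t] by (simp_all add: abs_le_iff)
        then show ?thesis unfolding dist_real_def poly_diff by linarith
      qed
      then have "norm ((e m - e n) * y) \<le> 2 * d / 3 * norm y" for y
        using a unfolding left_diff_distrib ey pa_diff [symmetric]
        by (intro norm_pa_le) (auto simp: sa_contraction_def)
      then have "norm (e m - e n) \<le> 2 * d / 3"
        by (rule norm_le_of_left_mult) (use d in simp)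
      then show ?thesis using d by simp
    qed
    then show "\<exists>M. \<forall>m\<ge>M. \<forall>n\<ge>M. norm (e m - e n) < d" by blast
  qed
  then obtain l where l: "e \<longlonglongrightarrow> l" using Cauchy_convergent_iff convergent_def by blast
  have "fc a f y = l * y" for y
  proof (rule LIMSEQ_unique [OF lim])
    show "(\<lambda>n. pa (q n) a y) \<longlonglongrightarrow> l * y"
      unfolding ey [symmetric] by (intro tendsto_mult l tendsto_const)
  qed
  moreover have "e n \<in> A" for n unfolding e_def using A by (intro pa_in)
  ultimately show ?thesis using closed_sequentially [OF A(2) _ l] by blast
qed

end

section \<open>The Pedersen ideal\<close>

lemma real_subspace_of_complex:
  "complex_vector.subspace S \<Longrightarrow> real_vector.subspace (S :: 'a::cstar_algebra set)"
  unfolding real_vector.subspace_def complex_vector.subspace_def by (metis scaleC_of_real)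

lemma cstar_subalgebra_UNIV: "cstar_subalgebra UNIV"
  by (simp add: cstar_subalgebra_def)

context
  fixes A :: "'a::cstar_algebra set"
  assumes A: "cstar_subalgebra A"
begin

lemma subalg_subspace: "complex_vector.subspace A" and subalg_closed: "closed A"
  and subalg_mult: "x \<in> A \<Longrightarrow> y \<in> A \<Longrightarrow> x * y \<in> A" and subalg_star: "x \<in> A \<Longrightarrow> star x \<in> A"
  using A by (auto simp: cstar_subalgebra_def)

lemma subalg_real_subspace: "real_vector.subspace A"
  using subalg_subspace by (rule real_subspace_of_complex)

lemma subalg_scaleR: "x \<in> A \<Longrightarrow> r *\<^sub>R x \<in> A"
  using subalg_real_subspace by (simp add: real_vector.subspace_scale)

lemma subalg_scaleC: "x \<in> A \<Longrightarrow> scaleC c x \<in> A"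
  using subalg_subspace by (simp add: complex_vector.subspace_scale)

lemma subalg_add: "x \<in> A \<Longrightarrow> y \<in> A \<Longrightarrow> x + y \<in> A"
  using subalg_subspace by (simp add: complex_vector.subspace_add)

lemma subalg_diff: "x \<in> A \<Longrightarrow> y \<in> A \<Longrightarrow> x - y \<in> A"
  using subalg_subspace by (simp add: complex_vector.subspace_diff)

lemma fc_in_subalg:
  assumes "sa_contraction a" "a \<in> A" "y \<in> A" "continuous_on {-1..1} f"
  shows "fc a f y \<in> A"
  using assms by (intro fc_in_closed subalg_real_subspace subalg_closed subalg_mult)

text \<open>The element \<open>z\<close> stands for 1 / (1 - d) - 1, again obtained as a fixed
  point.\<close>

lemma quasi_inverse_exists:
  assumes d: "d \<in> A" "norm d < 1"
  shows "\<exists>z\<in>A. z = d + z * d"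
proof -
  have "dist (d + x * d) (d + y * d) \<le> norm d * dist x y" for x y
    using norm_mult_ineq [of "x - y" d] by (simp add: dist_norm left_diff_distrib mult.commute)
  then have "\<exists>!z\<in>A. d + z * d = z"
    using d subalg_closed complex_vector.subspace_0 [OF subalg_subspace]
    by (intro Banach_fix [of A "norm d"]) (auto simp: complete_eq_closed intro: subalg_add subalg_mult)
  then show ?thesis by metis
qed

text \<open>
  If \<open>x\<close> in the ideal is within distance \<open>1\<close> of \<open>e\<close> and \<open>e * f = f\<close>, then
  \<open>x * f = (1 - (e - x)) * f\<close> with \<open>1 - (e - x)\<close> invertible.
\<close>

lemma dense_ideal_absorbs:
  assumes J: "dense_ideal A J" and e: "e \<in> A" and f: "f \<in> A" "e * f = f"
  shows "f \<in> J"
proof -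
  have I: "two_sided_ideal A J" and "e \<in> closure J" using J e by (auto simp: dense_ideal_def)
  then obtain x where x: "x \<in> J" "dist x e < 1"
    unfolding closure_approachable by (metis zero_less_one)
  define d where "d = e - x"
  have "x \<in> A" using I x by (auto simp: two_sided_ideal_def)
  then have "d \<in> A" "norm d < 1"
    using e x by (auto simp: d_def subalg_diff dist_norm norm_minus_commute)
  then obtain z where z: "z \<in> A" "z = d + z * d" using quasi_inverse_exists by blast
  have xf: "x * f = f - d * f" using f(2) by (simp add: d_def algebra_simps)
  have "z * f = d * f + z * (d * f)" by (metis z(2) distrib_right mult.assoc)
  then have "x * f + z * (x * f) = f" by (simp add: xf right_diff_distrib)
  moreover have "x * f \<in> J" "z * (x * f) \<in> J"
    using I x f z by (auto simp: two_sided_ideal_def)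
  ultimately show ?thesis
    using I unfolding two_sided_ideal_def by (metis complex_vector.subspace_add)
qed

end

section \<open>An explicit description of the least dense ideal\<close>

lemma subspace_mult_in_span:
  fixes a :: "'a::cstar_algebra"
  shows "complex_vector.subspace {v. a * v \<in> complex_vector.span S}"
    and "complex_vector.subspace {v. v * a \<in> complex_vector.span S}"
  unfolding complex_vector.subspace_def
  by (auto simp: distrib_left distrib_right mult_scaleC_left mult_scaleC_right complex_vector.span_zero
      intro: complex_vector.span_add complex_vector.span_scale)

text \<open>The first layer \<open>e\<close> forces \<open>f\<close> into every dense ideal. The
  second layer \<open>e'\<close> does the same for \<open>e\<close>, so that
  \<open>e * f = f\<close> is a factorization inside the ideal; it also produces a C*-subalgebra
  inside the ideal, on which traces are bounded.\<close>

definition locally_fixed :: "'a::cstar_algebra set \<Rightarrow> 'a \<Rightarrow> bool" where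
  "locally_fixed A f \<longleftrightarrow> f \<in> A \<and> (\<exists>e\<in>A. \<exists>e'\<in>A. star e = e \<and> e * f = f \<and> e' * e = e)"

definition pedersen_ideal :: "'a::cstar_algebra set \<Rightarrow> 'a set" where
  "pedersen_ideal A = complex_vector.span {x * f |x f. x \<in> A \<and> locally_fixed A f}"

definition cutoff :: "real \<Rightarrow> real \<Rightarrow> real" where
  "cutoff d t = min 1 (max 0 (\<bar>t\<bar> / d - 1))"

text \<open>A continuous version of cutoff d t / t: the denominator is t * t wherever the cutoff is
  nonzero.\<close>

definition cutoff_quotient :: "real \<Rightarrow> real \<Rightarrow> real" where
  "cutoff_quotient d t = cutoff d t * t / max (t\<^sup>2) (d\<^sup>2)"

lemma continuous_cutoff: "continuous_on S (cutoff d)"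
  unfolding cutoff_def divide_inverse
  by (intro continuous_on_min continuous_on_max continuous_on_diff continuous_on_mult continuous_on_rabs
      continuous_on_id continuous_on_const)

lemma continuous_cutoff_quotient:
  assumes "d > 0"
  shows "continuous_on S (cutoff_quotient d)"
proof -
  have "max (t\<^sup>2) (d\<^sup>2) \<noteq> 0" for t :: real
    using assms zero_less_power [of d 2] by (metis less_le_not_le max.cobounded2)
  then show ?thesis
    unfolding cutoff_quotient_def by (intro continuous_intros continuous_cutoff ballI)
qed

lemma cutoff_quotient_mult:
  assumes "d > 0"
  shows "cutoff_quotient d t * t = cutoff d t"
proof (cases "\<bar>t\<bar> \<le> d")
  case True
  then show ?thesis using assms by (simp add: cutoff_quotient_def cutoff_def field_simps)
next
  case False
  then have "t \<noteq> 0" using assms by auto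
  moreover have "d\<^sup>2 \<le> t\<^sup>2" using False assms by (subst abs_le_square_iff [symmetric]) simp
  ultimately show ?thesis by (simp add: cutoff_quotient_def max_absorb1 power2_eq_square)
qed

lemma cutoff_cutoff:
  assumes "d > 0"
  shows "cutoff (d / 2) t * cutoff d t = cutoff d t"
  using assms by (cases "\<bar>t\<bar> \<le> d") (auto simp: cutoff_def field_simps min_def max_def)

context
  fixes A :: "'a::cstar_algebra set"
  assumes A: "cstar_subalgebra A"
begin

lemma pedersen_ideal_subset: "pedersen_ideal A \<subseteq> A"
  unfolding pedersen_ideal_def
  by (rule complex_vector.span_minimal)
    (auto simp: locally_fixed_def subalg_mult [OF A] subalg_subspace [OF A])

lemma pedersen_ideal_two_sided: "two_sided_ideal A (pedersen_ideal A)"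
  unfolding two_sided_ideal_def
proof (intro conjI ballI)
  let ?G = "{x * f |x f. x \<in> A \<and> locally_fixed A f}"
  show "pedersen_ideal A \<subseteq> A" by (rule pedersen_ideal_subset)
  show "complex_vector.subspace (pedersen_ideal A)"
    by (simp add: pedersen_ideal_def complex_vector.subspace_span)
  fix a x assume a: "a \<in> A" and x: "x \<in> pedersen_ideal A"
  have "complex_vector.span ?G \<subseteq> {y. a * y \<in> complex_vector.span ?G}"
  proof (rule complex_vector.span_minimal)
    show "?G \<subseteq> {y. a * y \<in> complex_vector.span ?G}"
      using a by (auto intro!: complex_vector.span_base) (metis mult.assoc subalg_mult [OF A])
    show "complex_vector.subspace {y. a * y \<in> complex_vector.span ?G}"
      by (rule subspace_mult_in_span)
  qed
  then show "a * x \<in> pedersen_ideal A" using x by (auto simp: pedersen_ideal_def)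
  have "complex_vector.span ?G \<subseteq> {y. y * a \<in> complex_vector.span ?G}"
  proof (rule complex_vector.span_minimal)
    have "locally_fixed A (f * a)" if "locally_fixed A f" for f
      using that a subalg_mult [OF A] unfolding locally_fixed_def by (metis mult.assoc)
    then show "?G \<subseteq> {y. y * a \<in> complex_vector.span ?G}"
      by (auto intro!: complex_vector.span_base) (metis mult.assoc)
    show "complex_vector.subspace {y. y * a \<in> complex_vector.span ?G}"
      by (rule subspace_mult_in_span)
  qed
  then show "x * a \<in> pedersen_ideal A" using x by (auto simp: pedersen_ideal_def)
qed

lemma pedersen_ideal_least:
  assumes J: "dense_ideal A J"
  shows "pedersen_ideal A \<subseteq> J"
  unfolding pedersen_ideal_def
proof (rule complex_vector.span_minimal)
  have I: "two_sided_ideal A J" using J by (simp add: dense_ideal_def)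
  then show "complex_vector.subspace J" by (simp add: two_sided_ideal_def)
  show "{x * f |x f. x \<in> A \<and> locally_fixed A f} \<subseteq> J"
    using I dense_ideal_absorbs [OF A J] unfolding locally_fixed_def two_sided_ideal_def by blast
qed

text \<open>Cut off \<open>h = star y * y\<close> near 0. The error is governed by the norm of (1 -
  cutoff)(1 - cutoff) applied to \<open>h\<close>, and 1 - cutoff vanishes where |t| exceeds 2 *
  d.\<close>

lemma locally_fixed_approx:
  assumes y: "y \<in> A" "norm y < 1" and d: "d > 0"
  obtains f where "locally_fixed A f" "(norm (y - y * f))\<^sup>2 \<le> 2 * d"
proof -
  define h where "h = star y * y"
  have hA: "h \<in> A" using y by (simp add: h_def subalg_mult [OF A] subalg_star [OF A])
  have h: "sa_contraction h"
    using y(2) by (simp add: sa_contraction_def h_def star_simps cstar_identity power_less_one_iff)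
  define g where "g c = fc h (cutoff_quotient c) h" for c
  have gA: "g c \<in> A" and g_star: "star (g c) = g c" and g_mult: "g c * z = fc h (cutoff c) z"
    if "c > 0" for c z
  proof -
    note cq = continuous_cutoff_quotient [OF that]
    show "g c \<in> A" using hA by (simp add: g_def fc_in_subalg [OF A h] cq)
    show "star (g c) = g c" by (simp add: g_def star_fc_self [OF h cq])
    show "g c * z = fc h (cutoff c) z"
      unfolding g_def fc_self_mult [OF h cq] by (simp add: cutoff_quotient_mult [OF that])
  qed
  have gg: "g (c / 2) * g c = g c" if c: "c > 0" for c
  proof -
    have "g (c / 2) * g c = fc h (cutoff (c / 2)) (fc h (cutoff_quotient c) h)"
      using c g_mult [of "c / 2" "g c"] by (simp add: g_def)
    also have "\<dots> = fc h (\<lambda>t. cutoff (c / 2) t * cutoff_quotient c t) h"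
      by (simp add: fc_mult [OF h continuous_cutoff continuous_cutoff_quotient [OF c]])
    also have "(\<lambda>t. cutoff (c / 2) t * cutoff_quotient c t) = cutoff_quotient c"
      unfolding cutoff_quotient_def times_divide_eq_right mult.assoc [symmetric] cutoff_cutoff [OF c] ..
    finally show ?thesis by (simp add: g_def)
  qed
  \<comment> \<open>The elements \<open>g d\<close>, \<open>g (d / 2)\<close> and
    \<open>g (d / 2 / 2)\<close> serve as \<open>f\<close>, \<open>e\<close> and \<open>e'\<close>:
    each cutoff is 1 on the support of the preceding one.\<close>
  have fixed: "locally_fixed A (g d)"
    unfolding locally_fixed_def using gA gg [of d] gg [of "d / 2"] g_star d
    by (metis half_gt_zero)
  define u where "u t = 1 - cutoff d t" for t
  have u: "continuous_on {-1..1} u" unfolding u_def by (intro continuous_intros continuous_cutoff)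
  have fu: "fc h u z = z - g d * z" for z
    unfolding u_def using fc_diff [OF h continuous_on_const continuous_cutoff, of 1 d z]
    by (simp add: fc_const [OF h] g_mult [OF d])
  have gh: "g d * h = h * g d"
  proof -
    have "h * g d = fc h (cutoff_quotient d) (h * h)"
      unfolding g_def by (rule fc_commute [OF h continuous_cutoff_quotient [OF d] h refl])
    then show ?thesis by (simp add: g_def fc_mult_right [OF h continuous_cutoff_quotient [OF d]])
  qed
  have "star (y - y * g d) * (y - y * g d) = h - g d * h - g d * (h - g d * h)"
    by (simp add: star_simps g_star [OF d] h_def [symmetric] algebra_simps gh)
      (metis gh h_def mult.assoc)
  also have "\<dots> = fc h u (fc h u h)" by (simp add: fu)
  also have "\<dots> = fc h (\<lambda>t. u t * u t) h" by (simp add: fc_mult [OF h u u])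
  finally have "(norm (y - y * g d))\<^sup>2 = norm (fc h (\<lambda>t. u t * u t) h)"
    by (metis cstar_identity)
  also have "\<dots> \<le> 2 * d"
  proof (rule norm_fc_self_le [OF h])
    show "continuous_on {-1..1} (\<lambda>t. u t * u t)" by (intro continuous_intros u)
    fix t :: real
    show "\<bar>u t * u t * t\<bar> \<le> 2 * d"
    proof (cases "\<bar>t\<bar> \<le> 2 * d")
      case True
      have "0 \<le> u t" "u t \<le> 1" by (auto simp: u_def cutoff_def)
      then have "u t * u t \<le> 1" by (simp add: mult_le_one)
      then have "(u t * u t) * \<bar>t\<bar> \<le> 1 * \<bar>t\<bar>" by (intro mult_right_mono) auto
      then show ?thesis using True by (simp add: abs_mult)
    next
      case False
      then have "u t = 0" using d by (simp add: u_def cutoff_def field_simps)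
      then show ?thesis using d by simp
    qed
  qed
  finally show ?thesis using that fixed by blast
qed

lemma pedersen_ideal_dense: "dense_ideal A (pedersen_ideal A)"
  unfolding dense_ideal_def
proof (intro conjI subsetI)
  show "two_sided_ideal A (pedersen_ideal A)" by (rule pedersen_ideal_two_sided)
  fix y assume y: "y \<in> A"
  show "y \<in> closure (pedersen_ideal A)"
    unfolding closure_approachable
  proof (intro allI impI)
    fix e :: real assume e: "e > 0"
    define r where "r = norm y + 1"
    have r: "r > 0" by (simp add: r_def add_nonneg_pos)
    define x where "x = inverse r *\<^sub>R y"
    have x: "x \<in> A" "norm x < 1" "y = r *\<^sub>R x"
      using y r by (auto simp: x_def subalg_scaleR [OF A] divide_simps) (simp add: r_def)
    define c where "c = e / r / 2"
    have c: "c > 0" using e r by (simp add: c_def)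
    obtain f where f: "locally_fixed A f" "(norm (x - x * f))\<^sup>2 \<le> 2 * (c\<^sup>2 / 2)"
      using locally_fixed_approx [OF x(1,2), of "c\<^sup>2 / 2"] c by (metis half_gt_zero zero_less_power)
    then have "norm (x - x * f) \<le> c" using c by (auto intro: power2_le_imp_le)
    then have "norm (r *\<^sub>R (x - x * f)) \<le> r * c" using r by simp
    also have "r * c < e" using e r by (simp add: c_def)
    finally have "dist (r *\<^sub>R (x * f)) y < e"
      by (simp add: x(3) dist_norm norm_minus_commute scaleR_diff_right)
    moreover have "r *\<^sub>R (x * f) \<in> pedersen_ideal A"
      unfolding pedersen_ideal_def scaleC_of_real [symmetric] using x f
      by (intro complex_vector.span_scale complex_vector.span_base) auto
    ultimately show "\<exists>z\<in>pedersen_ideal A. dist z y < e" by blast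
  qed
qed

lemma Ped_eq: "Ped A = pedersen_ideal A"
  unfolding Ped_def
proof (rule the_equality)
  show "dense_ideal A (pedersen_ideal A) \<and>
    (\<forall>K. dense_ideal A K \<and> K \<subseteq> pedersen_ideal A \<longrightarrow> K = pedersen_ideal A)"
    using pedersen_ideal_dense pedersen_ideal_least by blast
qed (use pedersen_ideal_dense pedersen_ideal_least in blast)

lemma Ped_dense: "dense_ideal A (Ped A)"
  and Ped_least: "dense_ideal A J \<Longrightarrow> Ped A \<subseteq> J"
  using pedersen_ideal_dense pedersen_ideal_least by (simp_all add: Ped_eq)

lemma Ped_subspace: "complex_vector.subspace (Ped A)"
  and Ped_subset: "x \<in> Ped A \<Longrightarrow> x \<in> A"
  and Ped_mult_left: "a \<in> A \<Longrightarrow> x \<in> Ped A \<Longrightarrow> a * x \<in> Ped A"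
  and Ped_mult_right: "a \<in> A \<Longrightarrow> x \<in> Ped A \<Longrightarrow> x * a \<in> Ped A"
  using Ped_dense by (auto simp: dense_ideal_def two_sided_ideal_def)

lemma Ped_absorbs: "e \<in> A \<Longrightarrow> f \<in> A \<Longrightarrow> e * f = f \<Longrightarrow> f \<in> Ped A"
  using dense_ideal_absorbs [OF A Ped_dense] .

text \<open>The adjoints again form a dense ideal, so minimality gives the inclusion.\<close>

lemma Ped_star: "x \<in> Ped A \<Longrightarrow> star x \<in> Ped A"
proof -
  have "dense_ideal A (star ` Ped A)"
    unfolding dense_ideal_def two_sided_ideal_def
  proof (intro conjI subsetI ballI)
    show "x \<in> A" if "x \<in> star ` Ped A" for x
      using that Ped_subset subalg_star [OF A] by auto
    show "complex_vector.subspace (star ` Ped A)"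
      unfolding complex_vector.subspace_def
    proof (intro conjI ballI allI)
      show "0 \<in> star ` Ped A" using complex_vector.subspace_0 [OF Ped_subspace] star_zero by (metis imageI)
      show "x + y \<in> star ` Ped A" if "x \<in> star ` Ped A" "y \<in> star ` Ped A" for x y
        using that complex_vector.subspace_add [OF Ped_subspace] by (auto simp flip: star_add)
      show "scaleC c x \<in> star ` Ped A" if x: "x \<in> star ` Ped A" for c x
      proof -
        obtain y where y: "y \<in> Ped A" "x = star y" using x by blast
        then have "scaleC c x = star (scaleC (cnj c) y)" by (simp add: star_scaleC)
        then show ?thesis using complex_vector.subspace_scale [OF Ped_subspace y(1)] by blast
      qed
    qed
    fix a x assume a: "a \<in> A" and x: "x \<in> star ` Ped A"
    obtain y where y: "y \<in> Ped A" "x = star y" using x by blast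
    have "a * x = star (y * star a)" "x * a = star (star a * y)" by (simp_all add: y star_simps)
    moreover have "y * star a \<in> Ped A" "star a * y \<in> Ped A"
      using y a by (auto intro: Ped_mult_left Ped_mult_right subalg_star [OF A])
    ultimately show "a * x \<in> star ` Ped A" "x * a \<in> star ` Ped A" by auto
  next
    fix x assume "x \<in> A"
    then have "star x \<in> closure (Ped A)" using Ped_dense subalg_star [OF A] by (auto simp: dense_ideal_def)
    then show "x \<in> closure (star ` Ped A)"
      unfolding closure_approachable by (auto simp: dist_norm) (metis norm_star star_diff star_star)
  qed
  then show "x \<in> Ped A \<Longrightarrow> star x \<in> Ped A" using Ped_least star_star by (metis imageE subsetD)
qed

text \<open>Idempotence of the Pedersen ideal. It lets later arguments spend one factor on heredity
  or on the trace property while the other keeps the product in the ideal.\<close>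

lemma Ped_factor_span: "Ped A \<subseteq> complex_vector.span {x * y |x y. x \<in> Ped A \<and> y \<in> Ped A}"
  unfolding Ped_eq pedersen_ideal_def [of A]
proof (rule complex_vector.span_mono, clarify)
  fix x f assume x: "x \<in> A" and "locally_fixed A f"
  then obtain e e' where e: "f \<in> A" "e \<in> A" "e' \<in> A" "e * f = f" "e' * e = e"
    unfolding locally_fixed_def by blast
  have "x * f = (x * e) * f" by (simp add: e mult.assoc)
  moreover have "x * e \<in> Ped A" "f \<in> Ped A"
    using e x Ped_absorbs Ped_mult_left by blast+
  ultimately show "\<exists>x' f'. x * f = x' * f' \<and> x' \<in> complex_vector.span {x * f |x f. x \<in> A \<and> locally_fixed A f}
      \<and> f' \<in> complex_vector.span {x * f |x f. x \<in> A \<and> locally_fixed A f}"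
    unfolding Ped_eq pedersen_ideal_def by blast
qed

end

section \<open>Elements of the form \<open>star x * x\<close> have no negative part\<close>

text \<open>A self-adjoint operator whose square vanishes is zero, by Cauchy-Schwarz.\<close>

lemma fc_eq_zero_of_square:
  assumes a: "sa_contraction a" and f: "continuous_on {-1..1} f"
    and z: "\<And>z. fc a (\<lambda>t. f t * f t) z = 0"
  shows "fc a f z = 0"
proof -
  have "(norm (fc a f z))\<^sup>2 \<le> norm z * norm (fc a f (fc a f z))"
    by (rule norm_power2_le_of_self_adjoint) (rule fc_star [OF a f])
  then show ?thesis by (simp add: z fc_mult [OF a f f, symmetric])
qed

text \<open>
  Kaplansky's argument: for \<open>y = x * k\<close> with \<open>k\<close> built from the negative part of \<open>star x * x\<close>,
  the element \<open>N = star y * y\<close> is negative, while \<open>y * star y\<close> is a sum of squares minus \<open>N\<close>;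
  comparing the powers of \<open>1 - N / 5\<close> and \<open>1 - y * star y / 5\<close> forces \<open>N = 0\<close>.
\<close>

lemma fc_abs_star_mult:
  fixes x :: "'a::cstar_algebra"
  assumes h_def: "h = star x * x" and norm_h: "norm h < 1"
  shows "fc h abs z = h * z"
proof -
  have h: "sa_contraction h" using norm_h by (simp add: sa_contraction_def h_def star_simps)
  define n :: "real \<Rightarrow> real" where "n t = max 0 (- t)" for t
  have n: "continuous_on S n" for S unfolding n_def by (intro continuous_intros)
  have n01: "0 \<le> n t" "n t \<le> 1" if "\<bar>t\<bar> \<le> 1" for t using that by (auto simp: n_def)
  \<comment> \<open>The negative part of \<open>h\<close> is so far only an operator; the extra
    factor \<open>h\<close> makes it an element, which acts as minus the square of the negative
    part.\<close>
  define k where "k = fc h n h"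
  have k: "k * v = fc h (\<lambda>t. n t * t) v" "star k = k" for v
    by (simp_all add: k_def fc_self_mult [OF h n] star_fc_self [OF h n])
  have "norm k \<le> 1"
    unfolding k_def
  proof (rule norm_fc_self_le [OF h n])
    fix t :: real assume t: "\<bar>t\<bar> \<le> 1"
    then show "\<bar>n t * t\<bar> \<le> 1" using n01 [OF t] by (simp add: abs_mult mult_le_one)
  qed
  define y where "y = x * k"
  have "(norm x)\<^sup>2 < 1" using norm_h by (simp add: h_def cstar_identity)
  then have x1: "norm x < 1" by (simp add: power_less_one_iff)
  have "norm y \<le> norm x * norm k" unfolding y_def by (rule norm_mult_ineq)
  also have "\<dots> \<le> norm x * 1" using \<open>norm k \<le> 1\<close> by (rule mult_left_mono) simp
  finally have y1: "norm y < 1" using x1 by simp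
  define N where "N = star y * y"
  define P where "P = y * star y"
  have N_mult: "N * v = fc h (\<lambda>t. - (n t ^ 5)) v" for v
  proof -
    have c: "continuous_on {-1..1} (\<lambda>t. n t * t)" by (intro continuous_intros n)
    have "N * v = k * (h * (k * v))" by (simp add: N_def y_def star_simps k(2) h_def mult.assoc)
    also have "\<dots> = fc h (\<lambda>t. (n t * t) * (t * (n t * t))) v"
      unfolding k fc_id [OF h, symmetric]
      by (simp add: fc_mult [OF h] c continuous_on_mult continuous_on_id)
    also have "(\<lambda>t. (n t * t) * (t * (n t * t))) = (\<lambda>t. - (n t ^ 5))"
      by (auto simp: fun_eq_iff n_def max_def power_def)
    finally show ?thesis .
  qed
  have sq: "norm (v - a * (a * v)) \<le> norm v" if a: "sa_contraction a" for a v :: 'a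
  proof -
    have "fc a (\<lambda>t. 1 - t * t) v = v - a * (a * v)"
      by (simp add: fc_diff [OF a] fc_mult [OF a] fc_const [OF a] fc_id [OF a] continuous_on_mult
          continuous_on_id continuous_on_const)
    moreover have "norm (fc a (\<lambda>t. 1 - t * t) v) \<le> 1 * norm v"
    proof (rule norm_fc_le [OF a])
      show "continuous_on {-1..1} (\<lambda>t::real. 1 - t * t)" by (intro continuous_intros)
      show "\<bar>1 - t * t\<bar> \<le> 1" if "\<bar>t\<bar> \<le> 1" for t :: real
        using that abs_square_le_1 [of t] by (simp add: power2_eq_square abs_le_iff)
    qed
    ultimately show ?thesis by simp
  qed
  \<comment> \<open>Up to the sign of \<open>b\<close>, these are the real and imaginary parts of
    \<open>y\<close>, so that P + N = 2 * a * a + 2 * b * b.\<close>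
  define a where "a = (1/2) *\<^sub>R (y + star y)"
  define b where "b = scaleC \<i> ((1/2) *\<^sub>R (y - star y))"
  have "norm (y + star y) \<le> 2 * norm y" "norm (y - star y) \<le> 2 * norm y"
    using norm_triangle_ineq [of y "star y"] norm_triangle_ineq4 [of y "star y"] by auto
  then have "norm a < 1" "norm b < 1" using y1 by (auto simp: a_def b_def norm_scaleC)
  moreover have "star b = b"
  proof -
    have "(1/2) *\<^sub>R (star y - y) = - ((1/2) *\<^sub>R (y - star y))"
      by (metis minus_diff_eq scaleR_minus_right)
    then show ?thesis
      by (simp add: b_def star_scaleC star_scaleR star_diff star_star
          complex_vector.scale_minus_left complex_vector.scale_minus_right)
  qed
  ultimately have a: "sa_contraction a" and b: "sa_contraction b"
    by (auto simp: sa_contraction_def a_def star_simps add.commute)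
  have aa: "4 *\<^sub>R (a * a) = y * y + P + N + star y * star y"
  proof -
    have "4 *\<^sub>R (a * a) = (y + star y) * (y + star y)" by (simp add: a_def)
    then show ?thesis by (simp add: P_def N_def distrib_left distrib_right)
  qed
  have ii: "scaleC \<i> (scaleC \<i> v) = - v" for v :: 'a
    using scaleC_of_real [of "-1" v] by (simp add: scaleC_scaleC)
  have bb: "4 *\<^sub>R (b * b) = P + N - y * y - star y * star y"
  proof -
    have "4 *\<^sub>R (b * b) = - ((y - star y) * (y - star y))"
      by (simp add: b_def mult_scaleC_left mult_scaleC_right scaleR_scaleC ii)
    then show ?thesis by (simp add: P_def N_def left_diff_distrib right_diff_distrib)
  qed
  have "P = 2 *\<^sub>R (a * a) + 2 *\<^sub>R (b * b) - N"
  proof -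
    have "2 *\<^sub>R (2 *\<^sub>R (a * a) + 2 *\<^sub>R (b * b)) = 4 *\<^sub>R (a * a) + 4 *\<^sub>R (b * b)"
      by (simp add: scaleR_add_right)
    also have "\<dots> = 2 *\<^sub>R (P + N)" unfolding aa bb by (simp add: scaleR_2)
    finally have "2 *\<^sub>R (a * a) + 2 *\<^sub>R (b * b) = P + N"
      by (metis scaleR_cancel_left zero_neq_numeral)
    then show ?thesis by simp
  qed
  then have P_mult: "P * v = 2 *\<^sub>R (a * (a * v)) + 2 *\<^sub>R (b * (b * v)) - N * v" for v
    by (simp add: distrib_right left_diff_distrib mult.assoc)
  \<comment> \<open>The constant is 5 = 2 + 2 + 1: this makes \<open>E\<close> the average of the
    contractions 1 - a * a (twice), 1 - b * b (twice) and 1 + N.\<close>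
  define E where "E v = v - (1/5) *\<^sub>R (P * v)" for v
  have E: "norm (E v) \<le> norm v" for v
  proof -
    have "v + N * v = fc h (\<lambda>t. 1 - n t ^ 5) v"
      using fc_add [OF h continuous_on_const, of "\<lambda>t. - (n t ^ 5)" 1 v]
      by (simp add: N_mult fc_const [OF h] continuous_intros n)
    also have "norm \<dots> \<le> 1 * norm v"
    proof (rule norm_fc_le [OF h])
      show "continuous_on {-1..1} (\<lambda>t. 1 - n t ^ 5)" by (intro continuous_intros n)
      show "\<bar>1 - n t ^ 5\<bar> \<le> 1" if "\<bar>t\<bar> \<le> 1" for t
        using n01 [OF that] power_le_one [of "n t" 5] zero_le_power [of "n t" 5] by (simp add: abs_le_iff)
    qed
    finally have Nv: "norm (v + N * v) \<le> norm v" by simp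
    have "5 *\<^sub>R E v = 2 *\<^sub>R (v - a * (a * v)) + 2 *\<^sub>R (v - b * (b * v)) + (v + N * v)"
    proof -
      have "5 *\<^sub>R v = 2 *\<^sub>R v + 2 *\<^sub>R v + v"
        using scaleR_add_left [of 4 1 v] scaleR_add_left [of 2 2 v] by simp
      then show ?thesis by (simp add: E_def P_mult scaleR_diff_right)
    qed
    also have "norm \<dots> \<le> 2 * norm v + 2 * norm v + norm v"
      using sq [OF a, of v] sq [OF b, of v]
      by (intro order_trans [OF norm_triangle_ineq] add_mono Nv) auto
    finally show ?thesis by simp
  qed
  define u where "u t = n t ^ 5 / 5" for t
  have u: "continuous_on {-1..1} u" and u0: "0 \<le> u t" for t
    unfolding u_def by (intro continuous_intros n, simp) (simp add: n_def)
  have fc_u: "fc h u v = - (1/5) *\<^sub>R (N * v)" for v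
    using fc_cmult [OF h, of "\<lambda>t. - (n t ^ 5)" "-1/5" v] unfolding N_mult u_def
    by (simp add: continuous_intros n)
  define F where "F v = v - (1/5) *\<^sub>R (N * v)" for v
  have fc_F: "fc h (\<lambda>t. 1 + u t) v = F v" for v
    using fc_add [OF h continuous_on_const u, of 1 v] by (simp add: fc_u F_def fc_const [OF h])
  have fc_F_pow: "fc h (\<lambda>t. (1 + u t) ^ j) v = (F ^^ j) v" for j v
  proof (induction j)
    case (Suc j)
    then show ?case
      using fc_mult [OF h, of "\<lambda>t. 1 + u t" "\<lambda>t. (1 + u t) ^ j" v] by (simp add: fc_F continuous_intros u)
  qed (simp add: fc_const [OF h])
  \<comment> \<open>From \<open>star y * (y * star y) = (star y * y) * star y\<close>: the powers of
    \<open>F\<close> at \<open>N\<close> are controlled by powers of the contraction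
    \<open>E\<close> at \<open>y\<close>.\<close>
  have EF: "star y * (E ^^ j) v = (F ^^ j) (star y * v)" for j v
    by (induction j) (simp_all add: E_def F_def right_diff_distrib P_def N_def mult.assoc[symmetric],
      simp add: mult.assoc)
  have "real j * norm (fc h u N) \<le> 1" for j
  proof -
    \<comment> \<open>Bernoulli's inequality bounds this quotient by 1. Hence j * u(h) N is no
      larger than the bounded quantity \<open>(F ^^ j) N\<close>, for every
      \<open>j\<close>.\<close>
    define G where "G t = real j * u t / (1 + u t) ^ j" for t
    have pos: "1 + u t > 0" for t using u0 [of t] by simp
    then have ne: "(1 + u t) ^ j \<noteq> 0" for t by (metis less_irrefl zero_less_power)
    have G: "continuous_on {-1..1} G"
      unfolding G_def by (intro continuous_intros u ballI ne)
    have "real j * norm (fc h u N) = norm (fc h (\<lambda>t. real j * u t) N)"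
      by (simp add: fc_cmult [OF h u])
    also have "(\<lambda>t. real j * u t) = (\<lambda>t. G t * (1 + u t) ^ j)" using ne by (simp add: G_def)
    also have "fc h (\<lambda>t. G t * (1 + u t) ^ j) N = fc h G ((F ^^ j) N)"
      by (subst fc_mult [OF h G]) (simp_all add: continuous_intros u fc_F_pow)
    also have "norm \<dots> \<le> 1 * norm ((F ^^ j) N)"
    proof (rule norm_fc_le [OF h G])
      show "\<bar>G t\<bar> \<le> 1" for t
      proof -
        have "real j * u t \<le> (1 + u t) ^ j"
          using Bernoulli_inequality [of "u t" j] u0 [of t] by linarith
        then show ?thesis using u0 [of t] pos [of t] by (simp add: G_def)
      qed
    qed
    also have "(F ^^ j) N = star y * (E ^^ j) y" by (simp add: EF N_def)
    also have "1 * norm (star y * (E ^^ j) y) \<le> norm y * norm ((E ^^ j) y)"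
      using norm_mult_ineq [of "star y"] by simp
    also have "norm ((E ^^ j) y) \<le> norm y" by (induction j) (auto intro: order_trans [OF E])
    also have "norm y * norm y \<le> 1" using y1 by (simp add: mult_le_one)
    finally show ?thesis by (simp add: mult_left_mono)
  qed
  then have "norm (fc h u N) \<le> 0"
    using reals_Archimedean2 [of "1 / norm (fc h u N)"]
    by (metis divide_less_eq not_le mult.commute order_less_le_trans)
  then have "N * N = 0" by (simp add: fc_u)
  moreover have "star N = N" by (simp add: N_def star_simps)
  ultimately have "N = 0" using cstar_identity [of N] by simp
  then have n5: "fc h (\<lambda>t. n t ^ 5) v = 0" for v
    using fc_cmult [OF h, of "\<lambda>t. - (n t ^ 5)" "-1" v] N_mult [of v] by (simp add: continuous_intros n)
  have np: "continuous_on {-1..1} (\<lambda>t. n t ^ j)" for j by (intro continuous_intros n)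
  \<comment> \<open>The exponent is first raised from 5 to 8, a power of 2, so that it can be halved
    down to 1.\<close>
  have "fc h (\<lambda>t. n t ^ 8) v = 0" for v
    using fc_mult [OF h np np, of 3 5 v] fc_mult_right [OF h np, of 3 0 0]
    by (simp add: n5 power_add [symmetric])
  then have "fc h (\<lambda>t. n t ^ 4) v = 0" for v
    by (intro fc_eq_zero_of_square [OF h np]) (simp add: power_add [symmetric])
  then have "fc h (\<lambda>t. n t ^ 2) v = 0" for v
    by (intro fc_eq_zero_of_square [OF h np]) (simp add: power_add [symmetric])
  then have "fc h n v = 0" for v
    by (intro fc_eq_zero_of_square [OF h n]) (simp add: power2_eq_square)
  moreover have "fc h abs z = fc h (\<lambda>t. t + 2 * n t) z"
    by (rule fc_cong) (simp add: n_def)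
  moreover have "fc h (\<lambda>t. t + 2 * n t) z = fc h (\<lambda>t. t) z + fc h (\<lambda>t. 2 * n t) z"
    by (intro fc_add [OF h] continuous_intros n)
  ultimately show ?thesis by (simp add: fc_cmult [OF h n] fc_id [OF h])
qed

section \<open>Full hereditary subalgebras\<close>

text \<open>For norm x < 1 both 1 - x and 1 + x are squares, so
  \<open>star b * b + star b * x * b\<close> is positive and lies below
  \<open>2 *\<^sub>R (star b * b)\<close>; heredity applies to it.\<close>

lemma hereditary_sandwich_self_adjoint:
  assumes H: "hereditary_cstar_subalgebra A" and b: "b \<in> A" and x: "star x = x"
  shows "star b * x * b \<in> A"
proof -
  have A: "cstar_subalgebra A" using H by (simp add: hereditary_cstar_subalgebra_def)
  have *: "star b * x * b \<in> A" if x: "star x = x" "norm x < 1" for x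
  proof -
    have sq: "\<exists>c. star c * c = star b * b - star b * v * b" if v: "star v = v" "norm v < 1" for v
    proof -
      obtain s where s: "star s = s" "2 *\<^sub>R s - s * s = v"
        using square_root_one_minus_exists [OF v] by blast
      have "star (b - s * b) * (b - s * b) = star b * b - star b * (2 *\<^sub>R s - s * s) * b"
        by (simp add: star_diff star_mult s(1) left_diff_distrib right_diff_distrib scaleR_2 distrib_left distrib_right mult.assoc)
      then show ?thesis using s(2) by metis
    qed
    obtain c where c: "star c * c = star b * b - star b * x * b" using sq x by blast
    obtain d where d: "star d * d = star b * b + star b * x * b"
      using sq [of "- x"] x by (auto simp: star_minus)
    \<comment> \<open>Chosen so that \<open>star a * a\<close> is the dominating element, twice
      \<open>star b * b\<close>, in the required form.\<close>
    define a where "a = sqrt 2 *\<^sub>R b"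
    have aa: "star a * a = star b * b + star b * b" by (simp add: a_def star_scaleR scaleR_2)
    have "a \<in> A" using b by (simp add: a_def subalg_scaleR [OF A])
    then have "star a * a \<in> positive_part A" by (auto simp: positive_part_def)
    moreover have "star d * d \<in> positive_part UNIV" by (auto simp: positive_part_def)
    moreover have "star a * a - star d * d = star c * c" by (simp add: aa c d)
    then have "star a * a - star d * d \<in> positive_part UNIV" by (auto simp: positive_part_def)
    ultimately have "star d * d \<in> A" using H by (auto simp: hereditary_cstar_subalgebra_def)
    then have "star d * d - star b * b \<in> A"
      using b by (simp add: subalg_diff [OF A] subalg_mult [OF A] subalg_star [OF A])
    then show ?thesis by (simp add: d)
  qed
  define r where "r = norm x + 1"
  have r: "r > 0" by (simp add: r_def add_nonneg_pos)
  have "star b * (inverse r *\<^sub>R x) * b \<in> A"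
    using r by (intro *) (auto simp: star_scaleR x divide_simps, simp add: r_def)
  then have "r *\<^sub>R (star b * (inverse r *\<^sub>R x) * b) \<in> A" by (rule subalg_scaleR [OF A])
  then show ?thesis using r by simp
qed

lemma cartesian_decomposition:
  fixes x :: "'a::cstar_algebra"
  assumes D: "cstar_subalgebra D" and x: "x \<in> D"
  obtains x1 x2 where "x1 \<in> D" "x2 \<in> D" "star x1 = x1" "star x2 = x2" "x = x1 + scaleC \<i> x2"
    "norm x1 \<le> norm x" "norm x2 \<le> norm x"
proof -
  define x1 where "x1 = (1/2) *\<^sub>R (x + star x)"
  define x2 where "x2 = scaleC (- \<i>) ((1/2) *\<^sub>R (x - star x))"
  have "(1/2) *\<^sub>R (star x - x) = - ((1/2) *\<^sub>R (x - star x))"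
    by (metis minus_diff_eq scaleR_minus_right)
  then have sa: "star x1 = x1" "star x2 = x2"
    by (simp_all add: x1_def x2_def star_simps add.commute
        complex_vector.scale_minus_left complex_vector.scale_minus_right)
  have "scaleC \<i> x2 = (1/2) *\<^sub>R (x - star x)" by (simp add: x2_def scaleC_scaleC)
  then have dec: "x = x1 + scaleC \<i> x2"
    by (simp add: x1_def scaleR_add_right [symmetric] scaleR_2 [symmetric])
  have D12: "x1 \<in> D" "x2 \<in> D"
    unfolding x1_def x2_def using x
    by (simp_all only: subalg_scaleR [OF D] subalg_scaleC [OF D] subalg_add [OF D] subalg_diff [OF D]
        subalg_star [OF D])
  have "norm x1 \<le> norm x" "norm x2 \<le> norm x"
    using norm_triangle_ineq [of x "star x"] norm_triangle_ineq4 [of x "star x"]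
    by (auto simp: x1_def x2_def norm_scaleC)
  then show ?thesis using that D12 sa dec by blast
qed

lemma hereditary_sandwich:
  assumes H: "hereditary_cstar_subalgebra A" and a: "a \<in> A" "b \<in> A"
  shows "a * x * b \<in> A"
proof -
  have A: "cstar_subalgebra A" using H by (simp add: hereditary_cstar_subalgebra_def)
  have diag: "star c * x * c \<in> A" if c: "c \<in> A" for c
  proof -
    obtain x1 x2 where sa: "star x1 = x1" "star x2 = x2" and "x = x1 + scaleC \<i> x2"
      using cartesian_decomposition [OF cstar_subalgebra_UNIV UNIV_I, of x] by metis
    then have "star c * x * c = star c * x1 * c + scaleC \<i> (star c * x2 * c)"
      by (simp add: distrib_left distrib_right mult_scaleC_left mult_scaleC_right)
    then show ?thesis
      using hereditary_sandwich_self_adjoint [OF H c] sa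
      by (simp add: subalg_add [OF A] subalg_scaleC [OF A])
  qed
  define q where "q c = star c * x * c" for c
  define a' where "a' = star a"
  have a': "a' \<in> A" using a by (simp add: a'_def subalg_star [OF A])
  \<comment> \<open>Polarization with two terms: \<open>s\<close> contains \<open>a * x * b\<close>
    and \<open>star b * x * a'\<close> with equal signs, \<i> times \<open>t\<close> contains them
    with opposite signs.\<close>
  define s where "s = q (a' + b) - q a' - q b"
  define t where "t = q (a' + scaleC \<i> b) - q a' - q b"
  have ii: "scaleC \<i> (scaleC \<i> v) = - v" for v :: 'a
    using scaleC_of_real [of "-1" v] by (simp add: scaleC_scaleC)
  have s: "s = a * x * b + star b * x * a'"
    by (simp add: s_def q_def a'_def star_simps distrib_left distrib_right)
  have t: "scaleC \<i> t = star b * x * a' - a * x * b"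
    by (simp add: t_def q_def a'_def star_simps distrib_left distrib_right left_diff_distrib mult.assoc mult_scaleC_left mult_scaleC_right
        scaleC_add_right ii complex_vector.scale_right_diff_distrib complex_vector.scale_minus_left
        complex_vector.scale_minus_right)
  have "s - scaleC \<i> t = 2 *\<^sub>R (a * x * b)" unfolding s t by (simp add: scaleR_2)
  then have "a * x * b = (1/2) *\<^sub>R (s - scaleC \<i> t)" by simp
  moreover have "s \<in> A" "t \<in> A"
    unfolding s_def t_def q_def using a' a
    by (simp_all only: diag subalg_add [OF A] subalg_scaleC [OF A] subalg_diff [OF A])
  ultimately show ?thesis
    by (simp add: subalg_scaleR [OF A] subalg_diff [OF A] subalg_scaleC [OF A])
qed

lemma span_mult_in_span:
  fixes x y :: "'a::cstar_algebra"
  assumes x: "x \<in> complex_vector.span S" and y: "y \<in> complex_vector.span T"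
  shows "x * y \<in> complex_vector.span {s * t |s t. s \<in> S \<and> t \<in> T}" (is "_ \<in> complex_vector.span ?G")
proof -
  have "complex_vector.span S \<subseteq> {v. v * y \<in> complex_vector.span ?G}"
  proof (rule complex_vector.span_minimal [OF _ subspace_mult_in_span(2)], clarify)
    fix s assume s: "s \<in> S"
    have "complex_vector.span T \<subseteq> {v. s * v \<in> complex_vector.span ?G}"
      by (rule complex_vector.span_minimal [OF _ subspace_mult_in_span(1)]) (use s in \<open>auto intro: complex_vector.span_base\<close>)
    then show "s * y \<in> complex_vector.span ?G" using y by blast
  qed
  then show ?thesis using x by blast
qed

lemma closure_two_sided_ideal:
  assumes J: "two_sided_ideal UNIV (J :: 'a::cstar_algebra set)"
  shows "two_sided_ideal UNIV (closure J)"
proof -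
  have sub: "complex_vector.subspace J" using J by (simp add: two_sided_ideal_def)
  have img: "f x \<in> closure J" if "bounded_linear f" "f ` J \<subseteq> J" "x \<in> closure J" for f x
  proof -
    have "f ` closure J \<subseteq> closure J"
      using that closure_subset by (intro image_closure_subset linear_continuous_on) auto
    then show ?thesis using that by blast
  qed
  show ?thesis
    unfolding two_sided_ideal_def complex_vector.subspace_def
  proof (intro conjI allI ballI)
    show "0 \<in> closure J" using complex_vector.subspace_0 [OF sub] closure_subset by blast
    fix x y assume x: "x \<in> closure J" and y: "y \<in> closure J"
    obtain f g where f: "\<And>n. f n \<in> J" "f \<longlonglongrightarrow> x" and g: "\<And>n. g n \<in> J" "g \<longlonglongrightarrow> y"
      using x y unfolding closure_sequential by blast
    then have "\<And>n. f n + g n \<in> J" "(\<lambda>n. f n + g n) \<longlonglongrightarrow> x + y"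
      by (auto intro: complex_vector.subspace_add [OF sub] tendsto_add)
    then show "x + y \<in> closure J"
      unfolding closure_sequential by (intro exI [of _ "\<lambda>n. f n + g n"]) auto
  next
    fix c x assume "x \<in> closure J"
    then show "scaleC c x \<in> closure J"
    proof (rule img [rotated 2])
      show "bounded_linear (scaleC c :: 'a \<Rightarrow> 'a)"
        by (rule bounded_linear_intro [of _ "cmod c"])
          (auto simp: scaleC_add_right scaleR_scaleC norm_scaleC mult.commute)
    qed (use complex_vector.subspace_scale [OF sub] in blast)
  next
    fix a x :: 'a assume "a \<in> UNIV" "x \<in> closure J"
    then show "a * x \<in> closure J" "x * a \<in> closure J"
      using J by (auto simp: two_sided_ideal_def image_subset_iff
          intro!: img [of "\<lambda>x. a * x"] img [of "\<lambda>x. x * a"] bounded_linear_mult_right bounded_linear_mult_left)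
  qed auto
qed

locale full_hereditary =
  fixes A :: "'a::cstar_algebra set"
  assumes hereditary: "hereditary_cstar_subalgebra A" and full: "full A"
begin

abbreviation P :: "'a set" where "P \<equiv> Ped A"
abbreviation PB :: "'a set" where "PB \<equiv> Ped (UNIV :: 'a set)"

lemma A: "cstar_subalgebra A"
  using hereditary by (simp add: hereditary_cstar_subalgebra_def)

text \<open>Split the Pedersen factor into products of two: heredity pulls the inner one together
  with \<open>x\<close> and \<open>a\<close> into \<open>A\<close>, and the outer one keeps the
  result in the ideal.\<close>

lemma Ped_sandwich: "p \<in> P \<Longrightarrow> a \<in> A \<Longrightarrow> p * x * a \<in> P" "a \<in> A \<Longrightarrow> p \<in> P \<Longrightarrow> a * x * p \<in> P"
proof -
  have sub: "complex_vector.subspace {v. v * x * a \<in> P}" "complex_vector.subspace {v. a * x * v \<in> P}" for a x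
    using Ped_subspace [OF A] unfolding complex_vector.subspace_def
    by (auto simp: distrib_right distrib_left mult_scaleC_left mult_scaleC_right)
  show "p * x * a \<in> P" if "p \<in> P" "a \<in> A" for a
  proof -
    have "complex_vector.span {x * y |x y. x \<in> P \<and> y \<in> P} \<subseteq> {v. v * x * a \<in> P}"
    proof (rule complex_vector.span_minimal [OF _ sub(1)], clarify)
      fix p q assume "p \<in> P" "q \<in> P"
      then show "p * q * x * a \<in> P"
        using hereditary_sandwich [OF hereditary, of q a x] Ped_mult_right [OF A, of "q * x * a" p] that
          Ped_subset [OF A] by (simp add: mult.assoc)
    qed
    then show ?thesis using that Ped_factor_span [OF A] by blast
  qed
  show "a * x * p \<in> P" if "a \<in> A" "p \<in> P" for a
  proof -
    have "complex_vector.span {x * y |x y. x \<in> P \<and> y \<in> P} \<subseteq> {v. a * x * v \<in> P}"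
    proof (rule complex_vector.span_minimal [OF _ sub(2)], clarify)
      fix p q assume "p \<in> P" "q \<in> P"
      then show "a * x * (p * q) \<in> P"
        using hereditary_sandwich [OF hereditary, of a p x] Ped_mult_left [OF A, of "a * x * p" q] that
          Ped_subset [OF A] by (simp add: mult.assoc)
    qed
    then show ?thesis using that Ped_factor_span [OF A] by blast
  qed
qed

text \<open>Being locally fixed is monotone in the algebra, which is not visible from minimality
  among dense ideals.\<close>

lemma Ped_subset_Ped: "P \<subseteq> PB"
  unfolding Ped_eq [OF A] Ped_eq [OF cstar_subalgebra_UNIV] pedersen_ideal_def locally_fixed_def
  by (rule complex_vector.span_mono) blast

definition gens :: "'a set" where
  "gens = {x * p * q * y |x p q y. p \<in> P \<and> q \<in> P}"

lemma gensI: "p \<in> P \<Longrightarrow> q \<in> P \<Longrightarrow> x * p * q * y \<in> gens"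
  by (auto simp: gens_def)

lemma gens_mult: "g \<in> gens \<Longrightarrow> g * a \<in> gens" "g \<in> gens \<Longrightarrow> a * g \<in> gens"
proof -
  assume "g \<in> gens"
  then obtain x p q y where g: "g = x * p * q * y" "p \<in> P" "q \<in> P" by (auto simp: gens_def)
  have "g * a = x * p * q * (y * a)" "a * g = (a * x) * p * q * y" by (simp_all add: g(1) mult.assoc)
  then show "g * a \<in> gens" "a * g \<in> gens" using gensI [OF g(2,3)] by simp_all
qed

text \<open>Outer factors in \<open>P\<close> as well are what permits comparing the extension with
  the original trace on \<open>P\<close>.\<close>

lemma Ped_factor4: "P \<subseteq> complex_vector.span {x * p * q * y |x p q y. x \<in> P \<and> p \<in> P \<and> q \<in> P \<and> y \<in> P}"
proof -
  let ?G2 = "{x * y |x y. x \<in> P \<and> y \<in> P}"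
  have "complex_vector.span ?G2 \<subseteq> complex_vector.span {s * t |s t. s \<in> ?G2 \<and> t \<in> ?G2}"
    using span_mult_in_span [where S = ?G2 and T = ?G2] Ped_factor_span [OF A]
    by (intro complex_vector.span_minimal complex_vector.subspace_span) blast
  moreover have "{s * t |s t. s \<in> ?G2 \<and> t \<in> ?G2} \<subseteq>
      {x * p * q * y |x p q y. x \<in> P \<and> p \<in> P \<and> q \<in> P \<and> y \<in> P}"
    by (auto simp: mult.assoc) blast
  ultimately show ?thesis
    using Ped_factor_span [OF A] complex_vector.span_mono by (meson order_trans)
qed

lemma span_gens_dense: "dense_ideal UNIV (complex_vector.span gens)"
proof -
  have ideal: "two_sided_ideal UNIV (complex_vector.span gens)"
    unfolding two_sided_ideal_def
  proof (intro conjI ballI)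
    fix a x :: 'a assume x: "x \<in> complex_vector.span gens"
    have "complex_vector.span gens \<subseteq> {v. v * a \<in> complex_vector.span gens}"
      by (rule complex_vector.span_minimal [OF _ subspace_mult_in_span(2)])
        (auto intro: complex_vector.span_base gens_mult)
    then show "x * a \<in> complex_vector.span gens" using x by blast
    have "complex_vector.span gens \<subseteq> {v. a * v \<in> complex_vector.span gens}"
      by (rule complex_vector.span_minimal [OF _ subspace_mult_in_span(1)])
        (auto intro: complex_vector.span_base gens_mult)
    then show "a * x \<in> complex_vector.span gens" using x by blast
  qed (auto intro: complex_vector.subspace_span)
  have "P \<subseteq> complex_vector.span gens"
    by (rule order_trans [OF Ped_factor4 complex_vector.span_mono]) (use gensI in blast)
  then have "A \<subseteq> closure (complex_vector.span gens)"
    using Ped_dense [OF A] closure_mono unfolding dense_ideal_def by blast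
  then have "UNIV \<subseteq> closure (complex_vector.span gens)"
    using full closure_two_sided_ideal [OF ideal] unfolding full_def
    by (metis hull_minimal closed_closure)
  then show ?thesis using ideal by (simp add: dense_ideal_def)
qed

lemma Ped_UNIV_eq: "PB = complex_vector.span gens"
proof
  show "PB \<subseteq> complex_vector.span gens"
    using Ped_least [OF cstar_subalgebra_UNIV span_gens_dense] .
  show "complex_vector.span gens \<subseteq> PB"
  proof (rule complex_vector.span_minimal [OF _ Ped_subspace [OF cstar_subalgebra_UNIV]])
    show "gens \<subseteq> PB"
      using Ped_subset_Ped Ped_mult_left [OF cstar_subalgebra_UNIV] Ped_mult_right [OF cstar_subalgebra_UNIV]
      unfolding gens_def by blast
  qed
qed

subsection \<open>An approximate unit\<close>

definition left_gens :: "'a set" where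
  "left_gens = {b * p |b p. p \<in> P}"

definition square_sums :: "'a set" where
  "square_sums = {\<Sum>m\<leftarrow>ms. m * star m |ms. set ms \<subseteq> left_gens}"

lemma square_sums_0: "0 \<in> square_sums"
  unfolding square_sums_def by (rule CollectI, rule exI [of _ "[]"]) simp

lemma square_sums_add: "q \<in> square_sums \<Longrightarrow> m \<in> left_gens \<Longrightarrow> q + m * star m \<in> square_sums"
proof -
  assume "q \<in> square_sums" and m: "m \<in> left_gens"
  then obtain ms where "set ms \<subseteq> left_gens" "q = (\<Sum>m\<leftarrow>ms. m * star m)" by (auto simp: square_sums_def)
  with m show ?thesis
    unfolding square_sums_def by (intro CollectI exI [of _ "m # ms"]) (simp add: add.commute)
qed

lemma left_gensI: "p \<in> P \<Longrightarrow> b * p \<in> left_gens"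
  by (auto simp: left_gens_def)

lemma left_gensE:
  assumes "m \<in> left_gens"
  obtains b p where "m = b * p" "p \<in> P"
  using assms by (auto simp: left_gens_def)

lemma left_gens_diff_mult: "m \<in> left_gens \<Longrightarrow> m - b * m \<in> left_gens"
  by (elim left_gensE) (metis left_gensI left_diff_distrib mult.assoc)

lemma left_gens_scaleR: "m \<in> left_gens \<Longrightarrow> r *\<^sub>R m \<in> left_gens"
  by (elim left_gensE) (metis left_gensI mult_scaleR_left)

text \<open>The elements \<open>w\<close> for which \<open>u = 1 - w\<close> is a contraction and \<open>1 - star u * u\<close> is a sum of squares.\<close>

definition small_units :: "'a set" where
  "small_units = {w. (\<forall>y. norm (y - w * y) \<le> norm y) \<and> w + star w - star w * w \<in> square_sums}"

text \<open>Compose the contractions: 1 - w' = (1 - v)(1 - w), where \<open>v\<close> nearly fixes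
  what \<open>w\<close> leaves over from \<open>m\<close>. Errors that are already small do not
  grow, and the new defect is the old one plus the single square
  \<open>m3 * star m3\<close>.\<close>

lemma small_units_improve:
  assumes w: "w \<in> small_units" and m: "m \<in> left_gens" and e: "e > 0"
  shows "\<exists>w'\<in>small_units. (\<forall>y. norm (y - w' * y) \<le> norm (y - w * y)) \<and> norm (m - w' * m) < e"
proof -
  define m' where "m' = m - w * m"
  have m': "m' \<in> left_gens" using m by (simp add: m'_def left_gens_diff_mult)
  define c where "c = inverse (norm m' + 1)"
  have c: "c > 0" by (simp add: c_def add_nonneg_pos)
  define m1 where "m1 = c *\<^sub>R m'"
  have m1: "m1 \<in> left_gens" using m' by (simp add: m1_def left_gens_scaleR)
  have "norm m1 < 1" using c by (simp add: m1_def c_def divide_simps add_nonneg_pos)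
  define h where "h = m1 * star m1"
  have h1: "norm h < 1" using \<open>norm m1 < 1\<close> by (simp add: h_def norm_mult_star power_less_one_iff)
  then have h: "sa_contraction h" by (simp add: sa_contraction_def h_def star_simps)
  \<comment> \<open>This is where positivity of \<open>m1 * star m1\<close> enters: functions of |t|
    may be used, and \<open>h\<close> itself supplies a factor |t|.\<close>
  have fc_abs: "fc h abs z = h * z" for z
    using fc_abs_star_mult [of h "star m1"] h1 by (simp add: h_def star_star)
  \<comment> \<open>The squared error of \<open>m1\<close> will be at most \<open>d\<close>, hence
    below the square of c * e; undoing the scaling by \<open>c\<close> leaves
    \<open>e\<close>.\<close>
  define d where "d = (c * e / 2)\<^sup>2"
  have d: "d > 0" using c e by (simp add: d_def)
  \<comment> \<open>A regularized 1 / |t|, so that g t * |t| equals 1 as soon as |t| is at least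
    \<open>d\<close>.\<close>
  define g where "g t = inverse (max \<bar>t\<bar> d)" for t
  have g: "continuous_on S g" for S
    unfolding g_def using d by (intro continuous_intros) (auto simp: max_def)
  have g0: "0 < g t" and gt: "g t * \<bar>t\<bar> \<le> 1" for t
    using d by (auto simp: g_def max_def divide_simps)
  define v where "v = fc h g h"
  have v: "star v = v" by (simp add: v_def star_fc_self [OF h g])
  have v_mult: "v * z = fc h (\<lambda>t. g t * \<bar>t\<bar>) z" for z
  proof -
    have "v * z = fc h g (fc h abs z)" by (simp add: v_def fc_abs fc_mult_right [OF h g])
    also have "\<dots> = fc h (\<lambda>t. g t * \<bar>t\<bar>) z"
      by (rule fc_mult [OF h g, symmetric]) (intro continuous_intros)
    finally show ?thesis .
  qed
  define u where "u t = 1 - g t * \<bar>t\<bar>" for t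
  have cga: "continuous_on S (\<lambda>t. g t * \<bar>t\<bar>)" for S by (intro continuous_intros g)
  have u: "continuous_on S u" for S unfolding u_def by (intro continuous_intros g)
  have u01: "0 \<le> u t" "u t \<le> 1" for t using gt [of t] g0 [of t] by (auto simp: u_def)
  have fu: "fc h u z = z - v * z" for z
    unfolding u_def using fc_diff [OF h continuous_on_const cga, of 1 z]
    by (simp add: v_mult fc_const [OF h])
  have contr: "norm (z - v * z) \<le> norm z" for z
    using norm_fc_le [OF h u, of 1 z] u01 by (simp add: fu)
  have small: "norm (m1 - v * m1) < c * e"
  proof -
    have hv: "h * v = v * h"
    proof -
      have "h * v = fc h g (h * h)" unfolding v_def by (rule fc_commute [OF h g h refl])
      then show ?thesis by (simp add: v_def fc_mult_right [OF h g])
    qed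
    have "(m1 - v * m1) * star (m1 - v * m1) = h - v * h - v * (h - v * h)"
      unfolding star_diff star_mult v left_diff_distrib right_diff_distrib
      by (simp add: h_def mult.assoc) (metis h_def hv mult.assoc)
    also have "\<dots> = fc h (\<lambda>t. u t * u t) h" by (simp add: fu fc_mult [OF h u u])
    finally have "(norm (m1 - v * m1))\<^sup>2 = norm (fc h (\<lambda>t. u t * u t) h)"
      by (metis norm_mult_star)
    also have "\<dots> \<le> d"
    proof (rule norm_fc_self_le [OF h])
      show "continuous_on {-1..1} (\<lambda>t. u t * u t)" by (intro continuous_intros u)
      fix t :: real
      show "\<bar>u t * u t * t\<bar> \<le> d"
      proof (cases "\<bar>t\<bar> \<le> d")
        case True
        have "u t * u t \<le> 1" using u01 [of t] by (simp add: mult_le_one)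
        then have "(u t * u t) * \<bar>t\<bar> \<le> 1 * \<bar>t\<bar>" by (intro mult_right_mono) auto
        then show ?thesis using True by (simp add: abs_mult)
      next
        case False
        then have "u t = 0" using d by (simp add: u_def g_def max_def)
        then show ?thesis using d by simp
      qed
    qed
    also have "d < (c * e)\<^sup>2" using c e by (simp add: d_def power_strict_mono)
    finally show ?thesis using c e by (auto intro: power2_less_imp_less)
  qed
  \<comment> \<open>A square root of (2 * s - s * s) / |t| for s = g t * |t|; the missing |t| comes
    from \<open>m1 * star m1\<close> in the middle of \<open>m2 * star m2\<close>.\<close>
  define psi where "psi t = sqrt (g t * (2 - g t * \<bar>t\<bar>))" for t
  have psi: "continuous_on S psi" for S unfolding psi_def by (intro continuous_intros g)
  have psi2: "psi t * psi t = g t * (2 - g t * \<bar>t\<bar>)" for t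
    using g0 [of t] gt [of t] by (simp add: psi_def)
  define m2 where "m2 = fc h psi m1"
  obtain b p where bp: "m1 = b * p" "p \<in> P" using m1 by (auto simp: left_gens_def)
  have m2: "m2 \<in> left_gens"
    using bp unfolding m2_def left_gens_def by (auto simp: fc_mult_right [OF h psi])
  have m22: "m2 * star m2 = 2 *\<^sub>R v - v * v"
  proof (rule eq_of_left_mult)
    fix z
    have "m2 * star m2 * z = m2 * (star m1 * fc h psi z)"
      by (simp add: m2_def mult.assoc fc_star [OF h psi])
    also have "\<dots> = fc h psi (fc h abs (fc h psi z))"
      unfolding fc_abs m2_def fc_mult_right [OF h psi, symmetric] by (simp add: h_def mult.assoc)
    also have "\<dots> = fc h (\<lambda>t. psi t * (\<bar>t\<bar> * psi t)) z"
      by (simp add: fc_mult [OF h] psi continuous_intros)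
    also have "(\<lambda>t. psi t * (\<bar>t\<bar> * psi t)) = (\<lambda>t. 2 * (g t * \<bar>t\<bar>) - (g t * \<bar>t\<bar>) * (g t * \<bar>t\<bar>))"
    proof
      fix t
      have "psi t * (\<bar>t\<bar> * psi t) = (psi t * psi t) * \<bar>t\<bar>" by simp
      then show "psi t * (\<bar>t\<bar> * psi t) = 2 * (g t * \<bar>t\<bar>) - (g t * \<bar>t\<bar>) * (g t * \<bar>t\<bar>)"
        by (simp add: psi2 left_diff_distrib right_diff_distrib)
    qed
    also have "fc h \<dots> z = 2 *\<^sub>R (v * z) - v * (v * z)"
      by (subst fc_diff [OF h]) (simp_all add: continuous_intros g fc_cmult [OF h cga] fc_mult [OF h cga cga] v_mult)
    finally show "m2 * star m2 * z = (2 *\<^sub>R v - v * v) * z" by (simp add: left_diff_distrib mult.assoc)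
  qed
  \<comment> \<open>The adjoint of 1 - w applied to \<open>m2\<close>, since the old contraction
    encloses the new defect \<open>m2 * star m2\<close>.\<close>
  define m3 where "m3 = m2 - star w * m2"
  have m3: "m3 \<in> left_gens" using m2 by (simp add: m3_def left_gens_diff_mult)
  define w' where "w' = w + v - v * w"
  have w'_mult: "z - w' * z = (z - w * z) - v * (z - w * z)" for z
    by (simp add: w'_def algebra_simps)
  have le: "norm (z - w' * z) \<le> norm (z - w * z)" for z
    unfolding w'_mult by (rule contr)
  have "w' + star w' - star w' * w' = (w + star w - star w * w) + m3 * star m3"
  proof -
    have "m3 * star m3 = (m2 * star m2) - star w * (m2 * star m2) - (m2 * star m2) * w + star w * (m2 * star m2) * w"
      by (simp add: m3_def star_simps algebra_simps)
    then show ?thesis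
      unfolding m22 by (simp add: w'_def star_simps v algebra_simps scaleR_2)
  qed
  moreover have "w + star w - star w * w \<in> square_sums" using w by (simp add: small_units_def)
  ultimately have "w' + star w' - star w' * w' \<in> square_sums" using m3 by (simp add: square_sums_add)
  moreover have "norm (z - w' * z) \<le> norm z" for z
    using le [of z] w by (auto simp: small_units_def intro: order_trans)
  ultimately have "w' \<in> small_units" by (simp add: small_units_def)
  moreover have "norm (m - w' * m) < e"
  proof -
    have "m - w' * m = inverse c *\<^sub>R (m1 - v * m1)"
      using c unfolding w'_mult m'_def [symmetric] by (simp add: m1_def scaleR_diff_right)
    then have "norm (m - w' * m) = inverse c * norm (m1 - v * m1)" using c by simp
    also have "\<dots> < inverse c * (c * e)" using small c by (intro mult_strict_left_mono) auto
    also have "inverse c * (c * e) = e" using c by simp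
    finally show ?thesis .
  qed
  ultimately show ?thesis using le by blast
qed

end

section \<open>Approximation on arbitrary finite sets\<close>

context full_hereditary
begin

text \<open>Improvement is demanded from every starting point \<open>w\<close>, so that elements can
  be treated one after another without spoiling what has been reached.\<close>

definition improvable :: "'a set" where
  "improvable = {z. \<forall>w\<in>small_units. \<forall>e>0. \<exists>w'\<in>small_units.
     (\<forall>y. norm (y - w' * y) \<le> norm (y - w * y)) \<and> norm (z - w' * z) < e}"

lemma improvableD:
  assumes "z \<in> improvable" "w \<in> small_units" "e > 0"
  obtains w' where "w' \<in> small_units" "\<And>y. norm (y - w' * y) \<le> norm (y - w * y)" "norm (z - w' * z) < e"
  using assms unfolding improvable_def by blast

lemma improvable_subspace: "complex_vector.subspace improvable"
  unfolding complex_vector.subspace_def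
proof (intro conjI ballI allI)
  show "0 \<in> improvable" unfolding improvable_def by auto
  fix x y assume x: "x \<in> improvable" and y: "y \<in> improvable"
  show "x + y \<in> improvable"
    unfolding improvable_def
  proof (intro CollectI ballI allI impI)
    fix w and e :: real assume w: "w \<in> small_units" and e: "e > 0"
    obtain w1 where w1: "w1 \<in> small_units" "\<And>y. norm (y - w1 * y) \<le> norm (y - w * y)" "norm (x - w1 * x) < e / 2"
      using improvableD [OF x w, of "e / 2"] e by (metis half_gt_zero)
    obtain w2 where w2: "w2 \<in> small_units" "\<And>y. norm (y - w2 * y) \<le> norm (y - w1 * y)" "norm (y - w2 * y) < e / 2"
      using improvableD [OF y w1(1), of "e / 2"] e by (metis half_gt_zero)
    have "(x + y) - w2 * (x + y) = (x - w2 * x) + (y - w2 * y)" by (simp add: distrib_left)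
    then have "norm ((x + y) - w2 * (x + y)) \<le> norm (x - w2 * x) + norm (y - w2 * y)"
      by (metis norm_triangle_ineq)
    then have "norm ((x + y) - w2 * (x + y)) < e" using w2(2) [of x] w1(3) w2(3) by linarith
    moreover have "norm (z - w2 * z) \<le> norm (z - w * z)" for z
      using w1(2) w2(2) order_trans by blast
    ultimately show "\<exists>w'\<in>small_units. (\<forall>z. norm (z - w' * z) \<le> norm (z - w * z)) \<and>
        norm ((x + y) - w' * (x + y)) < e"
      using w2(1) by blast
  qed
next
  fix c x assume x: "x \<in> improvable"
  show "scaleC c x \<in> improvable"
    unfolding improvable_def
  proof (intro CollectI ballI allI impI)
    fix w and e :: real assume w: "w \<in> small_units" and e: "e > 0"
    have pos: "cmod c + 1 > 0" by (simp add: add_nonneg_pos)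
    obtain w1 where w1: "w1 \<in> small_units" "\<And>y. norm (y - w1 * y) \<le> norm (y - w * y)"
        "norm (x - w1 * x) < e / (cmod c + 1)"
      using improvableD [OF x w, of "e / (cmod c + 1)"] e pos by (metis divide_pos_pos)
    have "scaleC c x - w1 * scaleC c x = scaleC c (x - w1 * x)"
      by (simp add: mult_scaleC_right complex_vector.scale_right_diff_distrib)
    then have "norm (scaleC c x - w1 * scaleC c x) = cmod c * norm (x - w1 * x)" by (simp add: norm_scaleC)
    also have "\<dots> \<le> (cmod c + 1) * norm (x - w1 * x)" by (intro mult_right_mono) auto
    also have "\<dots> < e" using w1(3) pos by (simp add: pos_less_divide_eq mult.commute)
    finally show "\<exists>w'\<in>small_units. (\<forall>z. norm (z - w' * z) \<le> norm (z - w * z)) \<and>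
        norm (scaleC c x - w' * scaleC c x) < e"
      using w1 by blast
  qed
qed

text \<open>A generator is \<open>m * b\<close> with \<open>m\<close> in \<open>left_gens\<close>,
  and the error of \<open>m\<close> is multiplied by \<open>b\<close>. Passing from the span to its
  closure uses that 1 - w is a contraction.\<close>

lemma improvable_UNIV: "improvable = UNIV"
proof -
  have "gens \<subseteq> improvable"
  proof
    fix g assume "g \<in> gens"
    then obtain x p q y where g: "g = x * p * q * y" "p \<in> P" by (auto simp: gens_def)
    define m where "m = x * p"
    define b where "b = q * y"
    have m: "m \<in> left_gens" "g = m * b" using g by (auto simp: m_def b_def left_gensI mult.assoc)
    show "g \<in> improvable"
      unfolding improvable_def
    proof (intro CollectI ballI allI impI)
      fix w and e :: real assume w: "w \<in> small_units" and e: "e > 0"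
      have pos: "norm b + 1 > 0" by (simp add: add_nonneg_pos)
      obtain w1 where w1: "w1 \<in> small_units" "\<And>y. norm (y - w1 * y) \<le> norm (y - w * y)"
          "norm (m - w1 * m) < e / (norm b + 1)"
        using small_units_improve [OF w m(1), of "e / (norm b + 1)"] e pos by (metis divide_pos_pos)
      have "norm (g - w1 * g) = norm ((m - w1 * m) * b)" by (simp add: m(2) left_diff_distrib mult.assoc)
      also have "\<dots> \<le> norm (m - w1 * m) * norm b" by (rule norm_mult_ineq)
      also have "\<dots> \<le> norm (m - w1 * m) * (norm b + 1)" by (intro mult_left_mono) auto
      also have "\<dots> < e" using w1(3) pos by (simp add: pos_less_divide_eq)
      finally show "\<exists>w'\<in>small_units. (\<forall>z. norm (z - w' * z) \<le> norm (z - w * z)) \<and> norm (g - w' * g) < e"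
        using w1 by blast
    qed
  qed
  then have span: "complex_vector.span gens \<subseteq> improvable"
    by (rule complex_vector.span_minimal [OF _ improvable_subspace])
  have "z \<in> improvable" for z
    unfolding improvable_def
  proof (intro CollectI ballI allI impI)
    fix w and e :: real assume w: "w \<in> small_units" and e: "e > 0"
    have "z \<in> closure (complex_vector.span gens)" using span_gens_dense by (auto simp: dense_ideal_def)
    then obtain x where x: "x \<in> complex_vector.span gens" "dist x z < e / 2"
      using e unfolding closure_approachable by (metis half_gt_zero)
    obtain w1 where w1: "w1 \<in> small_units" "\<And>y. norm (y - w1 * y) \<le> norm (y - w * y)" "norm (x - w1 * x) < e / 2"
      using improvableD [OF _ w, of x "e / 2"] e x(1) span by (metis half_gt_zero subsetD)
    have "z - w1 * z = ((z - x) - w1 * (z - x)) + (x - w1 * x)" by (simp add: right_diff_distrib)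
    then have "norm (z - w1 * z) \<le> norm ((z - x) - w1 * (z - x)) + norm (x - w1 * x)"
      by (metis norm_triangle_ineq)
    also have "norm ((z - x) - w1 * (z - x)) \<le> norm (z - x)" using w1(1) by (simp add: small_units_def)
    finally have "norm (z - w1 * z) < e" using w1(3) x(2) by (simp add: dist_norm norm_minus_commute)
    then show "\<exists>w'\<in>small_units. (\<forall>y. norm (y - w' * y) \<le> norm (y - w * y)) \<and> norm (z - w' * z) < e"
      using w1 by blast
  qed
  then show ?thesis by blast
qed

lemma approximate_unit:
  assumes "finite S" "e > 0"
  shows "\<exists>q\<in>square_sums. \<forall>y\<in>S. norm (y - q * y) < e"
proof -
  have "\<exists>w\<in>small_units. \<forall>y\<in>S. norm (y - w * y) < e"
    using \<open>finite S\<close>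
  proof (induction S)
    case empty
    have "0 \<in> small_units" by (simp add: small_units_def square_sums_0)
    then show ?case by blast
  next
    case (insert z S)
    then obtain w where w: "w \<in> small_units" "\<forall>y\<in>S. norm (y - w * y) < e" by blast
    obtain w1 where w1: "w1 \<in> small_units" "\<And>y. norm (y - w1 * y) \<le> norm (y - w * y)" "norm (z - w1 * z) < e"
      using improvableD [OF _ w(1) \<open>e > 0\<close>, of z] improvable_UNIV by blast
    then have "\<forall>y\<in>insert z S. norm (y - w1 * y) < e"
      using w(2) by (metis insert_iff order_le_less_trans)
    then show ?case using w1(1) by blast
  qed
  then obtain w where w: "w \<in> small_units" "\<And>y. y \<in> S \<Longrightarrow> norm (y - w * y) < e" by blast
  have contr: "norm (z - w * z) \<le> norm z" for z using w(1) by (simp add: small_units_def)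
  \<comment> \<open>The adjoint of a contraction is a contraction, read off from
    \<open>star v * v = star z * (v - w * v)\<close>.\<close>
  have contr': "norm (z - star w * z) \<le> norm z" for z
  proof (cases "z - star w * z = 0")
    case False
    define v where "v = z - star w * z"
    have "star v * v = star z * (v - w * v)"
      by (simp add: v_def star_simps algebra_simps)
    then have "(norm v)\<^sup>2 \<le> norm z * norm (v - w * v)"
      by (metis cstar_identity norm_mult_ineq norm_star)
    also have "\<dots> \<le> norm z * norm v" by (intro mult_left_mono contr) auto
    finally show ?thesis using False by (simp add: v_def power2_eq_square)
  qed simp
  \<comment> \<open>Here 1 - q is the adjoint of 1 - w composed with 1 - w, so \<open>q\<close> does
    at least as well as \<open>w\<close> and is itself a sum of squares.\<close>
  define q where "q = w + star w - star w * w"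
  have "norm (y - q * y) < e" if y: "y \<in> S" for y
  proof -
    have "y - q * y = (y - w * y) - star w * (y - w * y)" by (simp add: q_def algebra_simps)
    then have "norm (y - q * y) \<le> norm (y - w * y)" using contr' [of "y - w * y"] by metis
    then show ?thesis using w(2) [OF y] by simp
  qed
  moreover have "q \<in> square_sums" using w(1) by (simp add: small_units_def q_def)
  ultimately show ?thesis by blast
qed

end

lemma nonneg_Reals_approx:
  assumes "\<And>e. e > 0 \<Longrightarrow> \<exists>r\<in>\<real>\<^sub>\<ge>\<^sub>0. cmod (r - c) \<le> e"
  shows "c \<in> \<real>\<^sub>\<ge>\<^sub>0"
proof -
  have "c \<in> closure \<real>\<^sub>\<ge>\<^sub>0"
    unfolding closure_approachable dist_norm
  proof (intro allI impI)
    fix e :: real assume "e > 0"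
    then obtain r where "r \<in> \<real>\<^sub>\<ge>\<^sub>0" "cmod (r - c) \<le> e / 2" using assms [of "e / 2"] by auto
    with \<open>e > 0\<close> show "\<exists>y\<in>\<real>\<^sub>\<ge>\<^sub>0. cmod (y - c) < e" by (intro bexI [of _ r]) auto
  qed
  then show ?thesis using closure_closed [OF closed_nonneg_Reals_complex] by simp
qed

section \<open>Traces on the Pedersen ideal\<close>

text \<open>Continuity is replaced by boundedness on C*-subalgebras, and the convention on values
  outside the domain is dropped; \<open>real_traces_iff\<close> is the link.\<close>

definition ped_trace :: "'a::cstar_algebra set \<Rightarrow> ('a \<Rightarrow> complex) \<Rightarrow> bool" where
  "ped_trace A \<tau> \<longleftrightarrow> ped_linear A \<tau> \<and>
     (\<forall>x\<in>Ped A. \<forall>y\<in>Ped A. \<tau> (x * y) = \<tau> (y * x)) \<and>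
     (\<forall>x\<in>Ped A. \<tau> (star x) = cnj (\<tau> x)) \<and>
     (\<forall>D. cstar_subalgebra D \<and> D \<subseteq> Ped A \<longrightarrow> (\<exists>C. \<forall>x\<in>D. cmod (\<tau> x) \<le> C * norm x))"

lemma real_traces_iff:
  assumes A: "cstar_subalgebra A"
  shows "\<tau> \<in> real_traces A \<longleftrightarrow> \<tau> \<in> extensional (Ped A) \<and> ped_trace A \<tau>"
  unfolding real_traces_def ped_trace_def
  using continuous_ped_iff_bounded [OF Ped_subspace [OF A]] by blast

context
  fixes A :: "'a::cstar_algebra set" and \<tau> :: "'a \<Rightarrow> complex"
  assumes A: "cstar_subalgebra A" and \<tau>: "ped_trace A \<tau>"
begin

lemma tr_add: "x \<in> Ped A \<Longrightarrow> y \<in> Ped A \<Longrightarrow> \<tau> (x + y) = \<tau> x + \<tau> y"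
  and tr_scale: "x \<in> Ped A \<Longrightarrow> \<tau> (scaleC c x) = c * \<tau> x"
  and tr_commute: "x \<in> Ped A \<Longrightarrow> y \<in> Ped A \<Longrightarrow> \<tau> (x * y) = \<tau> (y * x)"
  and tr_star: "x \<in> Ped A \<Longrightarrow> \<tau> (star x) = cnj (\<tau> x)"
  and tr_bounded: "cstar_subalgebra D \<Longrightarrow> D \<subseteq> Ped A \<Longrightarrow> \<exists>C. \<forall>x\<in>D. cmod (\<tau> x) \<le> C * norm x"
  using \<tau> by (auto simp: ped_trace_def ped_linear_def)

lemma tr_0: "\<tau> 0 = 0"
  using tr_scale [OF complex_vector.subspace_0 [OF Ped_subspace [OF A]], of 0] by simp

lemma tr_diff: "x \<in> Ped A \<Longrightarrow> y \<in> Ped A \<Longrightarrow> \<tau> (x - y) = \<tau> x - \<tau> y"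
  using tr_add [of "x - y" y] complex_vector.subspace_diff [OF Ped_subspace [OF A], of x y] by simp

text \<open>For p = q * r the trace property is used twice, \<tau>(q r x) = \<tau>(r x q) = \<tau>(x
  q r), each time with both factors in the ideal.\<close>

lemma tr_commute_subalg:
  assumes p: "p \<in> Ped A" and x: "x \<in> A"
  shows "\<tau> (p * x) = \<tau> (x * p)"
proof -
  note left = Ped_mult_left [OF A x] and right = Ped_mult_right [OF A x]
  have "complex_vector.span {x * y |x y. x \<in> Ped A \<and> y \<in> Ped A} \<subseteq> {p \<in> Ped A. \<tau> (p * x) = \<tau> (x * p)}"
  proof (rule complex_vector.span_minimal, clarify, intro conjI)
    fix q r assume q: "q \<in> Ped A" and r: "r \<in> Ped A"
    then show "q * r \<in> Ped A" by (simp add: Ped_mult_left [OF A] Ped_subset [OF A])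
    have "\<tau> (q * (r * x)) = \<tau> (r * (x * q))"
      using q r by (simp add: tr_commute [of q "r * x"] left right mult.assoc)
    then show "\<tau> (q * r * x) = \<tau> (x * (q * r))"
      using q r by (simp add: tr_commute [of r "x * q"] left right mult.assoc)
  next
    show "complex_vector.subspace {p \<in> Ped A. \<tau> (p * x) = \<tau> (x * p)}"
      using Ped_subspace [OF A] unfolding complex_vector.subspace_def
      by (auto simp: distrib_left distrib_right mult_scaleC_left mult_scaleC_right tr_add tr_scale left right)
  qed
  then show ?thesis using p Ped_factor_span [OF A] by blast
qed

end

context full_hereditary
begin

text \<open>For p = x * f with e * f = f, rotation turns the argument into
  \<open>f * b * q * x * e\<close>. For all \<open>b\<close> at once these elements lie in one
  C*-subalgebra inside the ideal, where \<sigma> is bounded.\<close>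

lemma tr_sandwich_bounded:
  assumes \<sigma>: "ped_trace A \<sigma>" and p: "p \<in> P" and q: "q \<in> P"
  shows "\<exists>C\<ge>0. \<forall>b. cmod (\<sigma> (p * b * q)) \<le> C * norm b"
proof -
  have PA: "x \<in> A" if "x \<in> P" for x using that Ped_subset [OF A] by blast
  note sand = Ped_sandwich(1) [OF _ PA]
  have "complex_vector.span {x * f |x f. x \<in> A \<and> locally_fixed A f} \<subseteq>
     {p \<in> P. \<exists>C\<ge>0. \<forall>b. cmod (\<sigma> (p * b * q)) \<le> C * norm b}"
  proof (rule complex_vector.span_minimal, clarify, intro conjI)
    fix x f assume x: "x \<in> A" and "locally_fixed A f"
    then obtain e e' where e: "f \<in> A" "e \<in> A" "e' \<in> A" "star e = e" "e * f = f" "e' * e = e"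
      unfolding locally_fixed_def by blast
    have f: "f \<in> P" using e Ped_absorbs [OF A] by blast
    then show "x * f \<in> P" using x Ped_mult_left [OF A] by blast
    \<comment> \<open>The factor \<open>star e'\<close> on the right makes \<open>D\<close> closed
      under adjoints; since \<open>e\<close> is self-adjoint, \<open>e' * e = e\<close> also gives
      \<open>e * star e' = e\<close>.\<close>
    define D where "D = {d \<in> A. e' * d = d \<and> d * star e' = d}"
    have "cstar_subalgebra D"
      unfolding cstar_subalgebra_def
    proof (intro conjI ballI)
      show "complex_vector.subspace D"
        using subalg_subspace [OF A] unfolding D_def complex_vector.subspace_def
        by (auto simp: distrib_left distrib_right mult_scaleC_left mult_scaleC_right)
      have "D = A \<inter> {d. e' * d = d} \<inter> {d. d * star e' = d}" by (auto simp: D_def)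
      moreover have "closed \<dots>"
        by (intro closed_Int subalg_closed [OF A] closed_Collect_eq continuous_intros)
      ultimately show "closed D" by simp
      show "star d \<in> D" if "d \<in> D" for d
        using that unfolding D_def by (auto simp: subalg_star [OF A]) (metis star_mult star_star)+
      show "d * d' \<in> D" if "d \<in> D" "d' \<in> D" for d d'
        using that unfolding D_def by (auto simp: subalg_mult [OF A]) (metis mult.assoc)+
    qed
    moreover have "D \<subseteq> P" using Ped_absorbs [OF A e(3)] by (auto simp: D_def)
    ultimately obtain C where C: "\<And>d. d \<in> D \<Longrightarrow> cmod (\<sigma> d) \<le> C * norm d"
      using tr_bounded [OF A \<sigma>] by blast
    define K where "K = max 0 C * (norm f * norm (q * x * e))"
    have "cmod (\<sigma> (x * f * b * q)) \<le> K * norm b" for b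
    proof -
      have fbq: "f * b * q \<in> P" using f q sand by blast
      have "\<sigma> (x * f * b * q) = \<sigma> (x * (f * b * q))" by (simp add: mult.assoc)
      also have "\<dots> = \<sigma> ((f * b * q) * x)" using tr_commute_subalg [OF A \<sigma> fbq x] by simp
      also have "(f * b * q) * x = e * (f * b * q * x)" by (metis e(5) mult.assoc)
      also have "\<sigma> (e * (f * b * q * x)) = \<sigma> (f * b * q * x * e)"
        using tr_commute_subalg [OF A \<sigma> Ped_mult_right [OF A x fbq] e(2)] by simp
      finally have eq: "\<sigma> (x * f * b * q) = \<sigma> (f * b * q * x * e)" .
      have "e' * f = f" by (metis e(5,6) mult.assoc)
      moreover have "e * star e' = e" by (metis e(4,6) star_mult)
      moreover have "f * b * q * x * e \<in> A"
        by (rule subalg_mult [OF A subalg_mult [OF A PA [OF fbq] x] e(2)])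
      ultimately have "f * b * q * x * e \<in> D" unfolding D_def by (auto simp: mult.assoc) (metis mult.assoc)
      then have "cmod (\<sigma> (x * f * b * q)) \<le> C * norm (f * b * q * x * e)" unfolding eq by (rule C)
      also have "\<dots> \<le> max 0 C * norm (f * b * q * x * e)" by (intro mult_right_mono) auto
      also have "\<dots> \<le> max 0 C * ((norm f * norm b) * norm (q * x * e))"
      proof (rule mult_left_mono)
        have "f * b * q * x * e = (f * b) * (q * x * e)" by (simp only: mult.assoc)
        then have "norm (f * b * q * x * e) \<le> norm (f * b) * norm (q * x * e)"
          by (simp only: norm_mult_ineq)
        also have "\<dots> \<le> (norm f * norm b) * norm (q * x * e)"
          by (rule mult_right_mono [OF norm_mult_ineq norm_ge_zero])
        finally show "norm (f * b * q * x * e) \<le> (norm f * norm b) * norm (q * x * e)" .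
      qed simp
      finally show ?thesis by (simp only: K_def mult.assoc mult.commute [of "norm b"])
    qed
    moreover have "K \<ge> 0" by (simp add: K_def)
    ultimately show "\<exists>C\<ge>0. \<forall>b. cmod (\<sigma> (x * f * b * q)) \<le> C * norm b" by blast
  next
    show "complex_vector.subspace {p \<in> P. \<exists>C\<ge>0. \<forall>b. cmod (\<sigma> (p * b * q)) \<le> C * norm b}"
      unfolding complex_vector.subspace_def
    proof (intro conjI ballI allI)
      show "0 \<in> {p \<in> P. \<exists>C\<ge>0. \<forall>b. cmod (\<sigma> (p * b * q)) \<le> C * norm b}"
        using complex_vector.subspace_0 [OF Ped_subspace [OF A]] by (auto simp: tr_0 [OF A \<sigma>])
      fix x y
      assume x: "x \<in> {p \<in> P. \<exists>C\<ge>0. \<forall>b. cmod (\<sigma> (p * b * q)) \<le> C * norm b}"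
      then obtain C where C: "x \<in> P" "C \<ge> 0" "\<And>b. cmod (\<sigma> (x * b * q)) \<le> C * norm b" by blast
      show "scaleC c x \<in> {p \<in> P. \<exists>C\<ge>0. \<forall>b. cmod (\<sigma> (p * b * q)) \<le> C * norm b}" for c
      proof -
        have "cmod (\<sigma> (scaleC c x * b * q)) \<le> (cmod c * C) * norm b" for b
          using C(3) [of b] sand [OF C(1) q, of b]
          by (simp add: mult_scaleC_left tr_scale [OF A \<sigma>] norm_mult mult.assoc mult_left_mono)
        then show ?thesis
          using C(1,2) complex_vector.subspace_scale [OF Ped_subspace [OF A]]
          by (intro CollectI conjI exI [of _ "cmod c * C"]) auto
      qed
      assume y: "y \<in> {p \<in> P. \<exists>C\<ge>0. \<forall>b. cmod (\<sigma> (p * b * q)) \<le> C * norm b}"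
      then obtain C' where C': "y \<in> P" "C' \<ge> 0" "\<And>b. cmod (\<sigma> (y * b * q)) \<le> C' * norm b" by blast
      have "cmod (\<sigma> ((x + y) * b * q)) \<le> (C + C') * norm b" for b
      proof -
        have "\<sigma> ((x + y) * b * q) = \<sigma> (x * b * q) + \<sigma> (y * b * q)"
          using sand [OF C(1) q, of b] sand [OF C'(1) q, of b] by (simp add: distrib_right tr_add [OF A \<sigma>])
        then show ?thesis
          using C(3) [of b] C'(3) [of b] norm_triangle_ineq [of "\<sigma> (x * b * q)" "\<sigma> (y * b * q)"]
          by (simp add: distrib_right)
      qed
      then show "x + y \<in> {p \<in> P. \<exists>C\<ge>0. \<forall>b. cmod (\<sigma> (p * b * q)) \<le> C * norm b}"
        using C(1,2) C'(1,2) complex_vector.subspace_add [OF Ped_subspace [OF A]]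
        by (intro CollectI conjI exI [of _ "C + C'"]) auto
    qed
  qed
  then show ?thesis using p unfolding Ped_eq [OF A] pedersen_ideal_def by blast
qed

subsection \<open>Extension of traces\<close>

text \<open>Lists of quadruples are formal sums of generators. The extension is first a function of
  the list, and the work lies in showing that it depends only on \<open>val\<close>.\<close>

definition valid :: "('a \<times> 'a \<times> 'a \<times> 'a) list \<Rightarrow> bool" where
  "valid ps \<longleftrightarrow> (\<forall>(x, p, q, y)\<in>set ps. p \<in> P \<and> q \<in> P)"

definition val :: "('a \<times> 'a \<times> 'a \<times> 'a) list \<Rightarrow> 'a" where
  "val ps = (\<Sum>(x, p, q, y)\<leftarrow>ps. x * p * q * y)"

definition val_trace :: "('a \<Rightarrow> complex) \<Rightarrow> ('a \<times> 'a \<times> 'a \<times> 'a) list \<Rightarrow> complex" where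
  "val_trace \<sigma> ps = (\<Sum>(x, p, q, y)\<leftarrow>ps. \<sigma> (q * (y * x) * p))"

definition val_trace_insert :: "('a \<Rightarrow> complex) \<Rightarrow> ('a \<times> 'a \<times> 'a \<times> 'a) list \<Rightarrow> 'a \<Rightarrow> complex" where
  "val_trace_insert \<sigma> ps w = (\<Sum>(x, p, q, y)\<leftarrow>ps. \<sigma> (q * (y * w * x) * p))"

lemma valid_simps [simp]: "valid []" "valid ((x, p, q, y) # ps) \<longleftrightarrow> p \<in> P \<and> q \<in> P \<and> valid ps"
    "valid (ps @ qs) \<longleftrightarrow> valid ps \<and> valid qs"
  and val_simps [simp]: "val [] = 0" "val ((x, p, q, y) # ps) = x * p * q * y + val ps"
    "val (ps @ qs) = val ps + val qs"
  and val_trace_simps [simp]: "val_trace \<sigma> [] = 0"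
    "val_trace \<sigma> ((x, p, q, y) # ps) = \<sigma> (q * (y * x) * p) + val_trace \<sigma> ps"
    "val_trace \<sigma> (ps @ qs) = val_trace \<sigma> ps + val_trace \<sigma> qs"
  and val_trace_insert_simps [simp]: "val_trace_insert \<sigma> [] w = 0"
    "val_trace_insert \<sigma> ((x, p, q, y) # ps) w = \<sigma> (q * (y * w * x) * p) + val_trace_insert \<sigma> ps w"
  by (simp_all add: valid_def val_def val_trace_def val_trace_insert_def ball_Un)

lemma P_in_A: "p \<in> P \<Longrightarrow> p \<in> A"
  using Ped_subset [OF A] by blast

lemma P_sandwich: "p \<in> P \<Longrightarrow> q \<in> P \<Longrightarrow> p * x * q \<in> P"
  using Ped_sandwich(1) P_in_A by blast

lemma val_exists:
  assumes "z \<in> PB"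
  shows "\<exists>ps. valid ps \<and> val ps = z"
proof -
  have "complex_vector.span gens \<subseteq> {z. \<exists>ps. valid ps \<and> val ps = z}"
  proof (rule complex_vector.span_minimal)
    show "gens \<subseteq> {z. \<exists>ps. valid ps \<and> val ps = z}"
    proof
      fix g assume "g \<in> gens"
      then obtain x p q y where "g = x * p * q * y" "p \<in> P" "q \<in> P" by (auto simp: gens_def)
      then show "g \<in> {z. \<exists>ps. valid ps \<and> val ps = z}"
        by (intro CollectI exI [of _ "[(x, p, q, y)]"]) simp
    qed
    show "complex_vector.subspace {z. \<exists>ps. valid ps \<and> val ps = z}"
      unfolding complex_vector.subspace_def
    proof (intro conjI ballI allI)
      show "0 \<in> {z. \<exists>ps. valid ps \<and> val ps = z}" by (intro CollectI exI [of _ "[]"]) simp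
      fix u v assume "u \<in> {z. \<exists>ps. valid ps \<and> val ps = z}"
      then obtain ps where ps: "valid ps" "val ps = u" by blast
      show "scaleC c u \<in> {z. \<exists>ps. valid ps \<and> val ps = z}" for c
      proof -
        let ?qs = "map (\<lambda>(x, p, q, y). (scaleC c x, p, q, y)) ps"
        have "valid ?qs" using ps(1) by (auto simp: valid_def)
        moreover have "val ?qs = scaleC c (val ps)"
          by (induction ps) (auto simp: mult_scaleC_left scaleC_add_right)
        ultimately show ?thesis using ps(2) by blast
      qed
      assume "v \<in> {z. \<exists>ps. valid ps \<and> val ps = z}"
      then obtain qs where "valid qs" "val qs = v" by blast
      then show "u + v \<in> {z. \<exists>ps. valid ps \<and> val ps = z}"
        using ps by (intro CollectI exI [of _ "ps @ qs"]) simp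
    qed
  qed
  then show ?thesis using assms Ped_UNIV_eq by blast
qed

lemma left_gens_sandwich: "m \<in> left_gens \<Longrightarrow> m' \<in> left_gens \<Longrightarrow> star m * z * m' \<in> P"
proof (elim left_gensE)
  fix b p b' p' assume m: "m = b * p" "m' = b' * p'" "p \<in> P" "p' \<in> P"
  then have "star p * (star b * z * b') * p' \<in> P" by (intro P_sandwich Ped_star [OF A])
  then show "star m * z * m' \<in> P" by (simp add: m star_simps mult.assoc)
qed

context
  fixes \<sigma> :: "'a \<Rightarrow> complex"
  assumes \<sigma>: "ped_trace A \<sigma>"
begin

text \<open>The square splits the argument into \<open>q * y * m\<close> and
  \<open>star m * x * p\<close>, both in \<open>P\<close>; after commuting them,
  \<open>x * p * q * y\<close> appears as one block and the list enters only through its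
  value.\<close>

lemma val_trace_insert_square:
  assumes m: "m \<in> left_gens"
  shows "valid ps \<Longrightarrow> val_trace_insert \<sigma> ps (m * star m) = \<sigma> (star m * val ps * m)"
proof (induction ps)
  case Nil
  then show ?case by (simp add: tr_0 [OF A \<sigma>])
next
  case (Cons r ps)
  obtain x p q y where r: "r = (x, p, q, y)" by (cases r) auto
  have pq: "p \<in> P" "q \<in> P" "valid ps" using Cons.prems by (auto simp: r)
  obtain b a where ba: "m = b * a" "a \<in> P" using m by (rule left_gensE)
  have 1: "q * y * m \<in> P" using P_sandwich [OF pq(2) ba(2), of "y * b"] by (simp add: ba mult.assoc)
  have 2: "star m * x * p \<in> P"
    using P_sandwich [OF Ped_star [OF A ba(2)] pq(1), of "star b * x"] by (simp add: ba star_simps mult.assoc)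
  have "\<sigma> (q * (y * (m * star m) * x) * p) = \<sigma> ((q * y * m) * (star m * x * p))" by (simp add: mult.assoc)
  also have "\<dots> = \<sigma> ((star m * x * p) * (q * y * m))" by (rule tr_commute [OF A \<sigma> 1 2])
  finally have "\<sigma> (q * (y * (m * star m) * x) * p) = \<sigma> (star m * (x * p * q * y) * m)"
    by (simp add: mult.assoc)
  then show ?case
    using Cons.IH [OF pq(3)] left_gens_sandwich [OF m m]
    by (simp add: r distrib_left distrib_right tr_add [OF A \<sigma>])
qed

lemma val_trace_insert_add:
  "valid ps \<Longrightarrow> val_trace_insert \<sigma> ps (v + w) = val_trace_insert \<sigma> ps v + val_trace_insert \<sigma> ps w"
proof (induction ps)
  case (Cons r ps)
  then show ?case
    by (cases r) (simp add: distrib_left distrib_right tr_add [OF A \<sigma>] P_sandwich)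
qed simp

lemma val_trace_insert_cong:
  assumes "valid ps" "valid qs" "val ps = val qs" "w \<in> square_sums"
  shows "val_trace_insert \<sigma> ps w = val_trace_insert \<sigma> qs w"
proof -
  have 0: "valid ps \<Longrightarrow> val_trace_insert \<sigma> ps 0 = 0" for ps
    by (induction ps) (auto simp: tr_0 [OF A \<sigma>])
  obtain ms where ms: "set ms \<subseteq> left_gens" "w = (\<Sum>m\<leftarrow>ms. m * star m)"
    using assms(4) by (auto simp: square_sums_def)
  have "valid ps \<Longrightarrow> val_trace_insert \<sigma> ps (\<Sum>m\<leftarrow>ms. m * star m) = (\<Sum>m\<leftarrow>ms. \<sigma> (star m * val ps * m))" for ps
    using ms(1) by (induction ms) (auto simp: 0 val_trace_insert_add val_trace_insert_square)
  then show ?thesis using assms ms by simp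
qed

text \<open>The constant comes from \<open>tr_sandwich_bounded\<close> and is fixed before
  \<open>w\<close>. Only the left factors \<open>x\<close> have to be nearly fixed, since the error
  contains \<open>x - w * x\<close>.\<close>

lemma val_trace_insert_approx:
  "valid ps \<Longrightarrow> \<exists>C\<ge>0. \<forall>w d. (\<forall>x\<in>fst ` set ps. norm (x - w * x) \<le> d) \<longrightarrow>
     cmod (val_trace \<sigma> ps - val_trace_insert \<sigma> ps w) \<le> C * d"
proof (induction ps)
  case (Cons r ps)
  obtain x p q y where r: "r = (x, p, q, y)" by (cases r) auto
  have pq: "p \<in> P" "q \<in> P" "valid ps" using Cons.prems by (auto simp: r)
  obtain C where C: "C \<ge> 0" "\<And>w d. \<forall>x\<in>fst ` set ps. norm (x - w * x) \<le> d \<Longrightarrow>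
     cmod (val_trace \<sigma> ps - val_trace_insert \<sigma> ps w) \<le> C * d"
    using Cons.IH pq(3) by blast
  obtain K where K: "K \<ge> 0" "\<And>b. cmod (\<sigma> (q * b * p)) \<le> K * norm b"
    using tr_sandwich_bounded [OF \<sigma> pq(2,1)] by blast
  show ?case
  proof (intro exI [of _ "K * norm y + C"] conjI allI impI)
    show "0 \<le> K * norm y + C" using K C by simp
    fix w and d :: real assume d: "\<forall>x\<in>fst ` set (r # ps). norm (x - w * x) \<le> d"
    have "q * (y * x) * p - q * (y * w * x) * p = q * (y * (x - w * x)) * p"
      by (simp add: left_diff_distrib right_diff_distrib mult.assoc)
    then have "\<sigma> (q * (y * x) * p) - \<sigma> (q * (y * w * x) * p) = \<sigma> (q * (y * (x - w * x)) * p)"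
      using pq by (simp add: tr_diff [OF A \<sigma>, symmetric] P_sandwich)
    also have "cmod \<dots> \<le> K * norm (y * (x - w * x))" by (rule K)
    also have "\<dots> \<le> K * (norm y * norm (x - w * x))" using K(1) by (intro mult_left_mono norm_mult_ineq)
    also have "\<dots> \<le> K * (norm y * d)" using K(1) d r by (intro mult_left_mono) auto
    finally have 1: "cmod (\<sigma> (q * (y * x) * p) - \<sigma> (q * (y * w * x) * p)) \<le> K * (norm y * d)" .
    have 2: "cmod (val_trace \<sigma> ps - val_trace_insert \<sigma> ps w) \<le> C * d" using C(2) d by simp
    have "val_trace \<sigma> (r # ps) - val_trace_insert \<sigma> (r # ps) w =
      (\<sigma> (q * (y * x) * p) - \<sigma> (q * (y * w * x) * p)) + (val_trace \<sigma> ps - val_trace_insert \<sigma> ps w)"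
      by (simp add: r)
    then show "cmod (val_trace \<sigma> (r # ps) - val_trace_insert \<sigma> (r # ps) w) \<le> (K * norm y + C) * d"
      using norm_triangle_mono [OF 1 2] by (simp only: distrib_right mult.assoc)
  qed
qed auto

text \<open>Inserting an approximate unit in the middle of each product makes the sum depend on its value only.\<close>

lemma val_trace_cong:
  assumes "valid ps" "valid qs" "val ps = val qs"
  shows "val_trace \<sigma> ps = val_trace \<sigma> qs"
proof -
  obtain C where C: "C \<ge> 0" "\<And>w d. \<forall>x\<in>fst ` set ps. norm (x - w * x) \<le> d \<Longrightarrow>
     cmod (val_trace \<sigma> ps - val_trace_insert \<sigma> ps w) \<le> C * d"
    using val_trace_insert_approx [OF assms(1)] by blast
  obtain C' where C': "C' \<ge> 0" "\<And>w d. \<forall>x\<in>fst ` set qs. norm (x - w * x) \<le> d \<Longrightarrow>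
     cmod (val_trace \<sigma> qs - val_trace_insert \<sigma> qs w) \<le> C' * d"
    using val_trace_insert_approx [OF assms(2)] by blast
  have "cmod (val_trace \<sigma> ps - val_trace \<sigma> qs) \<le> 0 + e" if e: "e > 0" for e
  proof -
    define d where "d = e / (C + C' + 1)"
    have d: "d > 0" using e C C' by (simp add: d_def)
    obtain w where w: "w \<in> square_sums" "\<And>x. x \<in> fst ` set ps \<union> fst ` set qs \<Longrightarrow> norm (x - w * x) < d"
      using approximate_unit [OF _ d, of "fst ` set ps \<union> fst ` set qs"] by blast
    have "cmod (val_trace \<sigma> ps - val_trace_insert \<sigma> ps w) \<le> C * d"
      "cmod (val_trace \<sigma> qs - val_trace_insert \<sigma> qs w) \<le> C' * d"
      by (rule C(2) C'(2), use w(2) in \<open>auto intro: less_imp_le\<close>)+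
    moreover have "val_trace_insert \<sigma> ps w = val_trace_insert \<sigma> qs w"
      using assms w by (intro val_trace_insert_cong)
    ultimately have "cmod (val_trace \<sigma> ps - val_trace \<sigma> qs) \<le> C * d + C' * d"
      by (metis norm_diff_triangle_le norm_minus_commute)
    also have "\<dots> \<le> (C + C' + 1) * d" using d by (simp add: algebra_simps)
    also have "\<dots> = e" using C(1) C'(1) by (simp add: d_def)
    finally show ?thesis by simp
  qed
  then have "cmod (val_trace \<sigma> ps - val_trace \<sigma> qs) \<le> 0" by (rule field_le_epsilon)
  then show ?thesis by simp
qed

end

lemmas PB_subspace = Ped_subspace [OF cstar_subalgebra_UNIV]
lemmas PB_mult_left = Ped_mult_left [OF cstar_subalgebra_UNIV UNIV_I]
lemmas PB_mult_right = Ped_mult_right [OF cstar_subalgebra_UNIV UNIV_I]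
lemmas PB_star = Ped_star [OF cstar_subalgebra_UNIV]

lemma gens_in_PB: "g \<in> gens \<Longrightarrow> g \<in> PB"
  by (simp add: Ped_UNIV_eq complex_vector.span_base)

lemma val_in_PB: "valid ps \<Longrightarrow> val ps \<in> PB"
proof (induction ps)
  case Nil
  then show ?case using complex_vector.subspace_0 [OF PB_subspace] by simp
next
  case (Cons r ps)
  then show ?case
    by (cases r) (simp add: complex_vector.subspace_add [OF PB_subspace] gens_in_PB [OF gensI])
qed

definition rep :: "'a \<Rightarrow> ('a \<times> 'a \<times> 'a \<times> 'a) list" where
  "rep z = (SOME ps. valid ps \<and> val ps = z)"

definition extend :: "('a \<Rightarrow> complex) \<Rightarrow> 'a \<Rightarrow> complex" where
  "extend \<sigma> = (\<lambda>z\<in>PB. val_trace \<sigma> (rep z))"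

lemma rep: "z \<in> PB \<Longrightarrow> valid (rep z) \<and> val (rep z) = z"
  unfolding rep_def by (rule someI_ex) (rule val_exists)


lemma PB_induct [consumes 1, case_names zero add scale gens]:
  assumes z: "z \<in> PB" and "Q 0"
    and "\<And>x y. x \<in> PB \<Longrightarrow> y \<in> PB \<Longrightarrow> Q x \<Longrightarrow> Q y \<Longrightarrow> Q (x + y)"
    and "\<And>c x. x \<in> PB \<Longrightarrow> Q x \<Longrightarrow> Q (scaleC c x)"
    and "\<And>x p q y. p \<in> P \<Longrightarrow> q \<in> P \<Longrightarrow> Q (x * p * q * y)"
  shows "Q z"
proof -
  have "complex_vector.span gens \<subseteq> {z \<in> PB. Q z}"
  proof (rule complex_vector.span_minimal)
    show "gens \<subseteq> {z \<in> PB. Q z}" using assms(5) gens_in_PB unfolding gens_def by blast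
    show "complex_vector.subspace {z \<in> PB. Q z}"
      using PB_subspace assms unfolding complex_vector.subspace_def by blast
  qed
  then show ?thesis using z Ped_UNIV_eq by blast
qed

end

section \<open>Uniform boundedness and factorization in a C*-subalgebra\<close>

lemma bilinear_bounded_on_closed_subspace:
  fixes B :: "'a::cstar_algebra \<Rightarrow> 'a \<Rightarrow> complex"
  assumes D: "real_vector.subspace D" "closed D"
    and add: "\<And>x x' y. x \<in> D \<Longrightarrow> x' \<in> D \<Longrightarrow> y \<in> D \<Longrightarrow> B (x + x') y = B x y + B x' y"
    and scale: "\<And>r x y. x \<in> D \<Longrightarrow> y \<in> D \<Longrightarrow> B (r *\<^sub>R x) y = of_real r * B x y"
    and bl: "\<And>x. x \<in> D \<Longrightarrow> \<exists>C. \<forall>y\<in>D. cmod (B x y) \<le> C * norm y"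
    and br: "\<And>y. y \<in> D \<Longrightarrow> \<exists>C. \<forall>x\<in>D. cmod (B x y) \<le> C * norm x"
  shows "\<exists>C\<ge>0. \<forall>x\<in>D. \<forall>y\<in>D. cmod (B x y) \<le> C * (norm x * norm y)"
proof -
  have D0: "0 \<in> D" and Dadd: "\<And>x y. x \<in> D \<Longrightarrow> y \<in> D \<Longrightarrow> x + y \<in> D"
    and Ddiff: "\<And>x y. x \<in> D \<Longrightarrow> y \<in> D \<Longrightarrow> x - y \<in> D"
    and Dscale: "\<And>r x. x \<in> D \<Longrightarrow> r *\<^sub>R x \<in> D"
    using D(1) by (auto simp: real_vector.subspace_0 real_vector.subspace_add real_vector.subspace_diff
        real_vector.subspace_scale)
  have diff: "B (x - x') y = B x y - B x' y" if "x \<in> D" "x' \<in> D" "y \<in> D" for x x' y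
    using add [of "x - x'" x' y] that by (simp add: Ddiff)
  \<comment> \<open>Baire's theorem on the complete space \<open>D\<close>: these sets are closed by
    continuity in the first variable and cover \<open>D\<close> by boundedness in the second, so one
    of them has interior.\<close>
  define K where "K n = {x \<in> D. \<forall>y\<in>D. cmod (B x y) \<le> real n * norm y}" for n :: nat
  have closed_K: "closed (K n)" for n
    unfolding closed_sequential_limits
  proof (intro allI impI, elim conjE)
    fix f l assume f: "\<forall>i. f i \<in> K n" and l: "f \<longlonglongrightarrow> l"
    have fD: "f i \<in> D" for i using f by (simp add: K_def)
    have lD: "l \<in> D" by (rule closed_sequentially [OF D(2) _ l]) (rule fD)
    have "cmod (B l y) \<le> real n * norm y" if y: "y \<in> D" for y
    proof -
      obtain C where C: "\<And>x. x \<in> D \<Longrightarrow> cmod (B x y) \<le> C * norm x" using br [OF y] by blast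
      have "(\<lambda>i. B (f i) y - B l y) \<longlonglongrightarrow> 0"
      proof (rule Lim_null_comparison)
        show "\<forall>\<^sub>F i in sequentially. norm (B (f i) y - B l y) \<le> C * norm (f i - l)"
          using C Ddiff [OF fD lD] by (simp add: diff [OF fD lD y, symmetric])
        show "(\<lambda>i. C * norm (f i - l)) \<longlonglongrightarrow> 0"
          using tendsto_mult_left [OF tendsto_norm [OF LIM_zero [OF l]], of C] by simp
      qed
      then have "(\<lambda>i. B (f i) y) \<longlonglongrightarrow> B l y" by (rule LIM_zero_cancel)
      then have "(\<lambda>i. cmod (B (f i) y)) \<longlonglongrightarrow> cmod (B l y)" by (rule tendsto_norm)
      moreover have "cmod (B (f i) y) \<le> real n * norm y" for i using f y by (simp add: K_def)
      ultimately show ?thesis by (intro LIMSEQ_le_const2) auto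
    qed
    then show "l \<in> K n" using lD by (simp add: K_def)
  qed
  have "\<exists>n. (top_of_set D) interior_of (K n) \<noteq> {}"
  proof (rule ccontr)
    assume "\<not> (\<exists>n. (top_of_set D) interior_of (K n) \<noteq> {})"
    then have empty: "(top_of_set D) interior_of (K n) = {}" for n by blast
    have cl: "closedin (top_of_set D) (K n)" for n
      using closed_K [of n] by (intro closed_subset) (auto simp: K_def)
    have "(top_of_set D) interior_of (\<Union>(range K)) = {}"
    proof (rule Baire_category_alt)
      show "completely_metrizable_space (top_of_set D) \<or> locally_compact_space (top_of_set D) \<and> regular_space (top_of_set D)"
        using completely_metrizable_space_closedin [OF completely_metrizable_space_euclidean, of D] D(2)
        by simp
    qed (use empty cl in auto)
    moreover have "\<Union>(range K) = D"
    proof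
      show "D \<subseteq> \<Union>(range K)"
      proof
        fix x assume x: "x \<in> D"
        then obtain C where C: "\<And>y. y \<in> D \<Longrightarrow> cmod (B x y) \<le> C * norm y" using bl by blast
        obtain n :: nat where "C \<le> real n" using real_arch_simple by blast
        then have "x \<in> K n"
          unfolding K_def using x by (auto intro!: order_trans [OF C] mult_right_mono)
        then show "x \<in> \<Union>(range K)" by blast
      qed
    qed (auto simp: K_def)
    moreover have "(top_of_set D) interior_of D = D"
      by (simp add: interior_of_openin)
    ultimately show False using D0 by simp
  qed
  then obtain n x0 where "x0 \<in> (top_of_set D) interior_of (K n)" by blast
  then obtain T where T: "openin (top_of_set D) T" "x0 \<in> T" "T \<subseteq> K n"
    unfolding interior_of_def by blast
  then obtain r where r: "r > 0" "\<And>x. x \<in> D \<Longrightarrow> dist x x0 < r \<Longrightarrow> x \<in> K n"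
    unfolding openin_euclidean_subtopology_iff by blast
  have x0: "x0 \<in> K n" using T by blast
  then have x0D: "x0 \<in> D" by (simp add: K_def)
  \<comment> \<open>Translating to the centre \<open>x0\<close> costs a factor 2, as
    \<open>x\<close> is a difference of two points of \<open>K n\<close>; rescaling to norm r / 2
    costs another.\<close>
  have near: "cmod (B x y) \<le> 2 * real n * norm y" if "x \<in> D" "norm x < r" "y \<in> D" for x y
  proof -
    have "x0 + x \<in> K n" using that x0D by (intro r Dadd) (auto simp: dist_norm)
    then have "cmod (B (x0 + x) y) \<le> real n * norm y" "cmod (B x0 y) \<le> real n * norm y"
      using x0 that by (auto simp: K_def)
    moreover have "B x y = B (x0 + x) y - B x0 y" using that x0D by (simp add: add)
    ultimately show ?thesis using norm_triangle_ineq4 [of "B (x0 + x) y" "B x0 y"] by simp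
  qed
  have "cmod (B x y) \<le> (4 * real n / r) * (norm x * norm y)" if x: "x \<in> D" and y: "y \<in> D" for x y
  proof (cases "x = 0")
    case True
    then show ?thesis using scale [of 0 y 0] D0 y by simp
  next
    case False
    define s where "s = r / (2 * norm x)"
    have s: "s > 0" using False r by (simp add: s_def)
    have "norm (s *\<^sub>R x) < r" using False r by (simp add: s_def)
    then have "cmod (B (s *\<^sub>R x) y) \<le> 2 * real n * norm y" using x y by (intro near Dscale)
    then have "s * cmod (B x y) \<le> 2 * real n * norm y" using s x y by (simp add: scale norm_mult)
    then have "cmod (B x y) \<le> 2 * real n * norm y / s" using s by (simp add: pos_le_divide_eq mult.commute)
    also have "\<dots> = (4 * real n / r) * (norm x * norm y)" using False by (simp add: s_def)
    finally show ?thesis .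
  qed
  moreover have "4 * real n / r \<ge> 0" using r by simp
  ultimately show ?thesis by blast
qed

text \<open>Turns a bound on a form evaluated at products \<open>x * y\<close> into a bound at a
  single element; the norm bounds on the factors keep the constant uniform.\<close>

lemma self_adjoint_factorization:
  assumes D: "cstar_subalgebra D" and a: "sa_contraction a" "a \<in> D"
  shows "\<exists>x\<in>D. \<exists>y\<in>D. a = x * y \<and> norm x \<le> 1 \<and> norm y \<le> 1"
proof -
  define f where "f t = sqrt \<bar>t\<bar>" for t
  have f: "continuous_on {-1..1} f" unfolding f_def by (intro continuous_intros)
  \<comment> \<open>In this library \<open>sqrt\<close> is an odd function, so t = sqrt |t| * sqrt t
    holds for negative t too.\<close>
  have g: "continuous_on {-1..1} sqrt" by (intro continuous_intros)
  have elem: "\<exists>e\<in>D. \<forall>y. fc a k y = e * y" if "continuous_on {-1..1} k" "k 0 = 0" for k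
    using that a(2) subalg_mult [OF D a(2)]
    by (intro fc_element_exists [OF a(1)] subalg_real_subspace [OF D] subalg_closed [OF D])
  obtain x where x: "x \<in> D" "\<And>z. fc a f z = x * z" using elem [OF f] by (auto simp: f_def)
  obtain y where y: "y \<in> D" "\<And>z. fc a sqrt z = y * z" using elem [OF g] by auto
  have "a = x * y"
  proof (rule eq_of_left_mult)
    fix z
    have "a * z = fc a (\<lambda>t. f t * sqrt t) z"
      unfolding fc_id [OF a(1), symmetric]
    proof (rule fc_cong)
      show "t = f t * sqrt t" for t
        using real_sqrt_minus [of "- t"] by (cases "t \<ge> 0") (simp_all add: f_def)
    qed
    then show "a * z = x * y * z" by (simp add: fc_mult [OF a(1) f g] x y mult.assoc)
  qed
  moreover have "norm x \<le> 1"
    by (rule norm_le_of_left_mult) (use norm_fc_le [OF a(1) f, of 1] x in \<open>auto simp: f_def\<close>)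
  moreover have "norm y \<le> 1"
  proof (rule norm_le_of_left_mult)
    fix z
    have "\<bar>sqrt t\<bar> \<le> 1" if "\<bar>t\<bar> \<le> 1" for t using that by (metis real_sqrt_abs2 real_sqrt_le_1_iff real_sqrt_abs real_sqrt_mult_self)
    then show "norm (y * z) \<le> 1 * norm z" using norm_fc_le [OF a(1) g, of 1 z] y by simp
  qed simp
  ultimately show ?thesis using x y by blast
qed

section \<open>The extension is a continuous self-adjoint trace\<close>

context full_hereditary
begin

context
  fixes \<sigma> :: "'a \<Rightarrow> complex"
  assumes \<sigma>: "ped_trace A \<sigma>"
begin

lemma extend_val: "valid ps \<Longrightarrow> extend \<sigma> (val ps) = val_trace \<sigma> ps"
  using rep [OF val_in_PB, of ps] val_trace_cong [OF \<sigma>, of "rep (val ps)" ps]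
  by (simp add: extend_def val_in_PB)

lemma extend_gens: "p \<in> P \<Longrightarrow> q \<in> P \<Longrightarrow> extend \<sigma> (x * p * q * y) = \<sigma> (q * (y * x) * p)"
  using extend_val [of "[(x, p, q, y)]"] by simp

lemma extend_add: "x \<in> PB \<Longrightarrow> y \<in> PB \<Longrightarrow> extend \<sigma> (x + y) = extend \<sigma> x + extend \<sigma> y"
  using extend_val [of "rep x @ rep y"] extend_val [of "rep x"] extend_val [of "rep y"] rep
  by simp

lemma extend_scale:
  assumes "x \<in> PB"
  shows "extend \<sigma> (scaleC c x) = c * extend \<sigma> x"
proof -
  have "valid ps \<Longrightarrow> valid (map (\<lambda>(x, p, q, y). (scaleC c x, p, q, y)) ps) \<and>
    val (map (\<lambda>(x, p, q, y). (scaleC c x, p, q, y)) ps) = scaleC c (val ps) \<and>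
    val_trace \<sigma> (map (\<lambda>(x, p, q, y). (scaleC c x, p, q, y)) ps) = c * val_trace \<sigma> ps" for ps
    by (induction ps)
      (auto simp: mult_scaleC_left mult_scaleC_right scaleC_add_right distrib_left tr_scale [OF A \<sigma>] P_sandwich)
  then show ?thesis using extend_val rep [OF assms] by metis
qed

lemma extend_0: "extend \<sigma> 0 = 0"
  using extend_val [of "[]"] by simp

text \<open>A product of two generators is again of generator form, with
  \<open>q * y * x' * p' * q'\<close> as one of the inner factors. Its image is the value of
  \<sigma> on a cyclic word, which can be cut into two elements of \<open>P\<close>.\<close>

lemma extend_commute:
  assumes "x \<in> PB" "y \<in> PB"
  shows "extend \<sigma> (x * y) = extend \<sigma> (y * x)"
proof -
  have "\<forall>y\<in>PB. extend \<sigma> (x * y) = extend \<sigma> (y * x)"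
    using assms(1)
  proof (induction x rule: PB_induct)
    case (gens x p q y)
    note 1 = gens
    show ?case
    proof
      fix z assume "z \<in> PB"
      then show "extend \<sigma> (x * p * q * y * z) = extend \<sigma> (z * (x * p * q * y))"
      proof (induction z rule: PB_induct)
        case (gens x' p' q' y')
        have a: "q * y * x' * p' \<in> P" and b: "q' * y' * x * p \<in> P"
          using P_sandwich [OF 1(2) gens(1), of "y * x'"] P_sandwich [OF gens(2) 1(1), of "y' * x"]
          by (simp_all add: mult.assoc)
        have c: "q * y * x' * p' * q' \<in> P" "q' * y' * x * p * q \<in> P"
          using a b 1 gens P_in_A by (auto intro: Ped_mult_right [OF A])
        have "extend \<sigma> (x * p * q * y * (x' * p' * q' * y')) = extend \<sigma> (x * p * (q * y * x' * p' * q') * y')"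
          by (simp add: mult.assoc)
        also have "\<dots> = \<sigma> ((q * y * x' * p' * q') * (y' * x) * p)" by (rule extend_gens [OF 1(1) c(1)])
        also have "\<dots> = \<sigma> ((q * y * x' * p') * (q' * y' * x * p))" by (simp add: mult.assoc)
        also have "\<dots> = \<sigma> ((q' * y' * x * p) * (q * y * x' * p'))" by (rule tr_commute [OF A \<sigma> a b])
        also have "\<dots> = \<sigma> ((q' * y' * x * p * q) * (y * x') * p')" by (simp add: mult.assoc)
        also have "\<dots> = extend \<sigma> (x' * p' * (q' * y' * x * p * q) * y)"
          by (rule extend_gens [OF gens(1) c(2), symmetric])
        finally show ?case by (simp add: mult.assoc)
      qed (simp_all add: distrib_left distrib_right mult_scaleC_left mult_scaleC_right extend_add extend_scale
          PB_mult_left PB_mult_right extend_0)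
    qed
  qed (simp_all add: distrib_left distrib_right mult_scaleC_left mult_scaleC_right extend_add extend_scale
      PB_mult_left PB_mult_right extend_0)
  then show ?thesis using assms(2) by blast
qed

lemma extend_star:
  assumes "x \<in> PB"
  shows "extend \<sigma> (star x) = cnj (extend \<sigma> x)"
  using assms
proof (induction x rule: PB_induct)
  case (gens x p q y)
  have "star (x * p * q * y) = star y * star q * star p * star x" by (simp add: star_simps mult.assoc)
  then have "extend \<sigma> (star (x * p * q * y)) = \<sigma> (star p * (star x * star y) * star q)"
    using gens by (simp add: extend_gens Ped_star [OF A])
  also have "star p * (star x * star y) * star q = star (q * (y * x) * p)"
    by (simp add: star_simps mult.assoc)
  also have "\<sigma> \<dots> = cnj (\<sigma> (q * (y * x) * p))" using gens by (intro tr_star [OF A \<sigma>] P_sandwich)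
  finally show ?case using gens by (simp add: extend_gens)
qed (simp_all add: star_simps extend_add extend_scale PB_star extend_0)

text \<open>On a generator \<open>b\<close> ends up between \<open>q\<close> and \<open>p\<close>,
  where \<open>tr_sandwich_bounded\<close> applies.\<close>

lemma extend_mult_bounded:
  assumes "z \<in> PB"
  shows "\<exists>C\<ge>0. \<forall>b. cmod (extend \<sigma> (z * b)) \<le> C * norm b"
  using assms
proof (induction z rule: PB_induct)
  case zero
  then show ?case by (auto simp: extend_0)
next
  case (add x y)
  then obtain C C' where C: "C \<ge> 0" "\<And>b. cmod (extend \<sigma> (x * b)) \<le> C * norm b"
    and C': "C' \<ge> 0" "\<And>b. cmod (extend \<sigma> (y * b)) \<le> C' * norm b" by blast
  have "cmod (extend \<sigma> ((x + y) * b)) \<le> (C + C') * norm b" for b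
    using norm_triangle_mono [OF C(2) C'(2), of b b] add(1,2)
    by (simp add: distrib_right extend_add PB_mult_right)
  then show ?case using C(1) C'(1) by (intro exI [of _ "C + C'"]) auto
next
  case (scale c x)
  then obtain C where C: "C \<ge> 0" "\<And>b. cmod (extend \<sigma> (x * b)) \<le> C * norm b" by blast
  have "cmod (extend \<sigma> (scaleC c x * b)) \<le> (cmod c * C) * norm b" for b
    using mult_left_mono [OF C(2) norm_ge_zero, of c b] scale(1)
    by (simp add: mult_scaleC_left extend_scale PB_mult_right norm_mult mult.assoc)
  then show ?case using C(1) by (intro exI [of _ "cmod c * C"]) auto
next
  case (gens x p q y)
  obtain K where K: "K \<ge> 0" "\<And>b. cmod (\<sigma> (q * b * p)) \<le> K * norm b"
    using tr_sandwich_bounded [OF \<sigma> gens(2,1)] by blast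
  have "cmod (extend \<sigma> (x * p * q * y * b)) \<le> (K * (norm y * norm x)) * norm b" for b
  proof -
    have "extend \<sigma> (x * p * q * y * b) = \<sigma> (q * (y * b * x) * p)"
      using extend_gens [OF gens, of x "y * b"] by (simp add: mult.assoc)
    then have "cmod (extend \<sigma> (x * p * q * y * b)) \<le> K * norm (y * b * x)" using K(2) by simp
    also have "\<dots> \<le> K * ((norm y * norm b) * norm x)"
      by (intro mult_left_mono order_trans [OF norm_mult_ineq mult_right_mono [OF norm_mult_ineq]] K(1)) simp
    finally show ?thesis by (simp only: mult_ac)
  qed
  then show ?case using K(1) by (intro exI [of _ "K * (norm y * norm x)"]) auto
qed

text \<open>
  By uniform boundedness the separately continuous form \<open>extend \<sigma> (x * y)\<close> is bounded on \<open>D\<close>, and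
  self-adjoint elements of \<open>D\<close> factor within \<open>D\<close>.
\<close>

lemma extend_bounded:
  assumes D: "cstar_subalgebra D" "D \<subseteq> PB"
  shows "\<exists>C. \<forall>x\<in>D. cmod (extend \<sigma> x) \<le> C * norm x"
proof -
  have scaleR: "extend \<sigma> (r *\<^sub>R x) = of_real r * extend \<sigma> x" if "x \<in> PB" for r x
    using extend_scale [OF that, of "of_real r"] by (simp add: scaleC_of_real)
  have "\<exists>C\<ge>0. \<forall>x\<in>D. \<forall>y\<in>D. cmod (extend \<sigma> (x * y)) \<le> C * (norm x * norm y)"
  proof (rule bilinear_bounded_on_closed_subspace [OF subalg_real_subspace [OF D(1)] subalg_closed [OF D(1)]])
    fix x assume x: "x \<in> D"
    then obtain C where C: "\<And>b. cmod (extend \<sigma> (x * b)) \<le> C * norm b"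
      using extend_mult_bounded D(2) by blast
    then show "\<exists>C. \<forall>y\<in>D. cmod (extend \<sigma> (x * y)) \<le> C * norm y" by blast
    have "extend \<sigma> (y * x) = extend \<sigma> (x * y)" if "y \<in> D" for y
      using that x D(2) by (auto intro: extend_commute)
    then show "\<exists>C. \<forall>y\<in>D. cmod (extend \<sigma> (y * x)) \<le> C * norm y" using C by metis
  qed (use D(2) in \<open>auto simp: distrib_right scaleR PB_mult_right subset_iff intro!: extend_add\<close>)
  then obtain C where C: "C \<ge> 0" "\<And>x y. x \<in> D \<Longrightarrow> y \<in> D \<Longrightarrow> cmod (extend \<sigma> (x * y)) \<le> C * (norm x * norm y)"
    by blast
  have sa: "cmod (extend \<sigma> d) \<le> 2 * C * norm d" if d: "d \<in> D" "star d = d" for d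
  proof (cases "d = 0")
    case False
    \<comment> \<open>Norm 1/2 meets the strict bound of the functional calculus; it accounts for
      the factor 2, and the Cartesian decomposition doubles it again.\<close>
    define a where "a = inverse (2 * norm d) *\<^sub>R d"
    have aD: "a \<in> D" using d by (simp add: a_def subalg_scaleR [OF D(1)])
    have "sa_contraction a" using False d by (simp add: sa_contraction_def a_def star_scaleR)
    then obtain x y where xy: "x \<in> D" "y \<in> D" "a = x * y" "norm x \<le> 1" "norm y \<le> 1"
      using self_adjoint_factorization [OF D(1) _ aD] by blast
    have "cmod (extend \<sigma> a) \<le> C * (norm x * norm y)" using xy C by simp
    also have "\<dots> \<le> C * 1" using C(1) xy by (intro mult_left_mono mult_le_one) auto
    finally have "cmod (extend \<sigma> a) \<le> C" by simp
    moreover have "d = (2 * norm d) *\<^sub>R a" using False by (simp add: a_def)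
    then have "extend \<sigma> d = of_real (2 * norm d) * extend \<sigma> a" using aD D(2) scaleR by (metis subsetD)
    then have "cmod (extend \<sigma> d) = 2 * norm d * cmod (extend \<sigma> a)" by (simp add: norm_mult)
    ultimately show ?thesis
      using mult_left_mono [of "cmod (extend \<sigma> a)" C "2 * norm d"] by (simp only: mult_ac) simp
  qed (simp add: extend_0)
  have "cmod (extend \<sigma> x) \<le> 4 * C * norm x" if x: "x \<in> D" for x
  proof -
    obtain x1 x2 where D12: "x1 \<in> D" "x2 \<in> D" and sa': "star x1 = x1" "star x2 = x2"
      and dec: "x = x1 + scaleC \<i> x2" and "norm x1 \<le> norm x" "norm x2 \<le> norm x"
      using cartesian_decomposition [OF D(1) x] by metis
    then have b: "cmod (extend \<sigma> x1) \<le> 2 * C * norm x" "cmod (extend \<sigma> x2) \<le> 2 * C * norm x"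
      using sa [OF D12(1) sa'(1)] sa [OF D12(2) sa'(2)] C(1)
      by (meson mult_left_mono order_trans mult_nonneg_nonneg zero_le_numeral)+
    have "x1 \<in> PB" "x2 \<in> PB" "scaleC \<i> x2 \<in> PB"
      using D12 D(2) complex_vector.subspace_scale [OF PB_subspace] by blast+
    then have "extend \<sigma> x = extend \<sigma> x1 + \<i> * extend \<sigma> x2"
      by (subst dec) (simp add: extend_add extend_scale)
    then show ?thesis
      using norm_triangle_ineq [of "extend \<sigma> x1" "\<i> * extend \<sigma> x2"] b by (simp add: norm_mult)
  qed
  then show ?thesis by blast
qed

lemma ped_trace_extend: "ped_trace UNIV (extend \<sigma>)"
  unfolding ped_trace_def ped_linear_def
  using extend_add extend_scale extend_commute extend_star extend_bounded by blast

lemma extend_eq_on_Ped: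
  assumes "p \<in> P"
  shows "extend \<sigma> p = \<sigma> p"
proof -
  have "complex_vector.span {x * p * q * y |x p q y. x \<in> P \<and> p \<in> P \<and> q \<in> P \<and> y \<in> P} \<subseteq>
     {p \<in> P. extend \<sigma> p = \<sigma> p}"
  proof (rule complex_vector.span_minimal, clarify, intro conjI)
    fix x p q y assume "x \<in> P" "p \<in> P" "q \<in> P" "y \<in> P"
    then have 1: "x * p \<in> P" "q * y \<in> P" and 2: "x * p * q * y \<in> P"
      using P_in_A by (auto intro!: Ped_mult_left [OF A] subalg_mult [OF A])
    show "x * p * q * y \<in> P" by (rule 2)
    show "extend \<sigma> (x * p * q * y) = \<sigma> (x * p * q * y)"
      using extend_gens [OF \<open>p \<in> P\<close> \<open>q \<in> P\<close>, of x y] tr_commute [OF A \<sigma> 1] by (simp add: mult.assoc)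
  next
    show "complex_vector.subspace {p \<in> P. extend \<sigma> p = \<sigma> p}"
      using Ped_subspace [OF A] Ped_subset_Ped unfolding complex_vector.subspace_def
      by (auto simp: extend_0 tr_0 [OF A \<sigma>] tr_add [OF A \<sigma>] tr_scale [OF A \<sigma>] extend_add extend_scale subset_iff)
  qed
  then show ?thesis using assms Ped_factor4 by blast
qed

end

end

context full_hereditary
begin

subsection \<open>Positivity of the extension\<close>

lemma square_sums_star: "q \<in> square_sums \<Longrightarrow> star q = q"
proof -
  have "star (\<Sum>m\<leftarrow>ms. m * star m) = (\<Sum>m\<leftarrow>ms. m * star m)" for ms :: "'a list"
    by (induction ms) (auto simp: star_simps)
  then show "q \<in> square_sums \<Longrightarrow> star q = q" by (auto simp: square_sums_def)
qed

lemma left_gens_in_PB: "m \<in> left_gens \<Longrightarrow> m \<in> PB"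
  using Ped_subset_Ped PB_mult_left by (auto elim: left_gensE)

context
  fixes \<sigma> :: "'a \<Rightarrow> complex"
  assumes \<sigma>: "ped_trace A \<sigma>" and pos: "\<And>a. a \<in> P \<inter> positive_part A \<Longrightarrow> \<sigma> a \<in> \<real>\<^sub>\<ge>\<^sub>0"
begin

lemma extend_sandwich_sum:
  assumes q: "q \<in> square_sums" and x: "x \<in> PB" and nonneg: "\<And>m. m \<in> left_gens \<Longrightarrow> extend \<sigma> (x * (m * star m) * y) \<in> \<real>\<^sub>\<ge>\<^sub>0"
  shows "extend \<sigma> (x * q * y) \<in> \<real>\<^sub>\<ge>\<^sub>0"
proof -
  have "set ms \<subseteq> left_gens \<Longrightarrow> extend \<sigma> (x * (\<Sum>m\<leftarrow>ms. m * star m) * y) \<in> \<real>\<^sub>\<ge>\<^sub>0" for ms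
    using x nonneg by (induction ms)
      (auto simp: extend_0 [OF \<sigma>] distrib_left distrib_right extend_add [OF \<sigma>] PB_mult_right)
  then show ?thesis using q by (auto simp: square_sums_def)
qed

lemma extend_mult_diff: "z \<in> PB \<Longrightarrow> extend \<sigma> (z * v) - extend \<sigma> (z * v') = extend \<sigma> (z * (v - v'))"
  using extend_add [OF \<sigma> PB_mult_right PB_mult_right, of z z "v - v'" v']
  by (simp add: distrib_left [symmetric])

text \<open>Inserting a sum of squares turns \<open>star y * y\<close> into a sum of terms
  \<open>star x * x\<close> with \<open>x = star m * y\<close> in \<open>P\<close>, where positivity
  of \<sigma> is known.\<close>

lemma extend_left_gens_nonneg:
  assumes y: "y \<in> left_gens"
  shows "extend \<sigma> (star y * y) \<in> \<real>\<^sub>\<ge>\<^sub>0"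
proof (rule nonneg_Reals_approx)
  fix e :: real assume e: "e > 0"
  have yB: "star y \<in> PB" using y left_gens_in_PB PB_star by blast
  obtain C where C: "C \<ge> 0" "\<And>b. cmod (extend \<sigma> (star y * b)) \<le> C * norm b"
    using extend_mult_bounded [OF \<sigma> yB] by blast
  define d where "d = e / (C + 1)"
  have d: "d > 0" using e C by (simp add: d_def)
  obtain q where q: "q \<in> square_sums" "norm (y - q * y) < d"
    using approximate_unit [OF _ d, of "{y}"] by auto
  have "extend \<sigma> (star y * q * y) \<in> \<real>\<^sub>\<ge>\<^sub>0"
  proof (rule extend_sandwich_sum [OF q(1) yB])
    fix m assume m: "m \<in> left_gens"
    define x where "x = star m * y"
    have x: "x \<in> P"
      using left_gensE [OF y] left_gensE [OF m]
      by (metis (no_types) P_sandwich Ped_star [OF A] mult.assoc star_mult x_def)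
    have "star x * x \<in> P \<inter> positive_part A"
      using x P_in_A by (auto simp: positive_part_def intro!: Ped_mult_right [OF A] Ped_star [OF A])
    then have "extend \<sigma> (star x * x) \<in> \<real>\<^sub>\<ge>\<^sub>0" using pos by (simp add: extend_eq_on_Ped [OF \<sigma>])
    then show "extend \<sigma> (star y * (m * star m) * y) \<in> \<real>\<^sub>\<ge>\<^sub>0" by (simp add: x_def star_simps mult.assoc)
  qed
  moreover have "cmod (extend \<sigma> (star y * q * y) - extend \<sigma> (star y * y)) \<le> e"
  proof -
    have "cmod (extend \<sigma> (star y * q * y) - extend \<sigma> (star y * y)) =
        cmod (extend \<sigma> (star y * y) - extend \<sigma> (star y * (q * y)))"
      by (simp only: norm_minus_commute mult.assoc)
    also have "\<dots> = cmod (extend \<sigma> (star y * (y - q * y)))"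
      by (simp only: extend_mult_diff [OF yB])
    also have "\<dots> \<le> C * norm (y - q * y)" by (rule C)
    also have "\<dots> \<le> C * d" using q C by (intro mult_left_mono) auto
    also have "\<dots> \<le> (C + 1) * d" using d by simp
    also have "\<dots> = e" using C(1) by (simp add: d_def)
    finally show ?thesis .
  qed
  ultimately show "\<exists>r\<in>\<real>\<^sub>\<ge>\<^sub>0. cmod (r - extend \<sigma> (star y * y)) \<le> e" by blast
qed

text \<open>The approximate unit acts from the left, so for an action on the right of
  \<open>q * y\<close> the adjoint \<open>star (q * y)\<close> is what must be nearly fixed; this is
  why \<open>w\<close> is taken self-adjoint.\<close>

lemma extend_right_approx:
  assumes "h \<in> PB"
  shows "\<exists>S C. finite S \<and> C \<ge> 0 \<and> (\<forall>w d. star w = w \<longrightarrow> (\<forall>s\<in>S. norm (s - w * s) \<le> d) \<longrightarrow>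
    cmod (extend \<sigma> (h * w) - extend \<sigma> h) \<le> C * d)"
  using assms
proof (induction h rule: PB_induct)
  case zero
  show ?case by (intro exI [of _ "{}"] exI [of _ 0]) (simp add: extend_0 [OF \<sigma>])
next
  case (add x y)
  then obtain S C T C' where S: "finite S" "C \<ge> 0" "finite T" "C' \<ge> 0"
    and C: "\<And>w d. star w = w \<Longrightarrow> \<forall>s\<in>S. norm (s - w * s) \<le> d \<Longrightarrow> cmod (extend \<sigma> (x * w) - extend \<sigma> x) \<le> C * d"
    and C': "\<And>w d. star w = w \<Longrightarrow> \<forall>s\<in>T. norm (s - w * s) \<le> d \<Longrightarrow> cmod (extend \<sigma> (y * w) - extend \<sigma> y) \<le> C' * d"
    by metis
  have "cmod (extend \<sigma> ((x + y) * w) - extend \<sigma> (x + y)) \<le> (C + C') * d"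
    if "star w = w" "\<forall>s\<in>S \<union> T. norm (s - w * s) \<le> d" for w d
  proof -
    have "extend \<sigma> ((x + y) * w) - extend \<sigma> (x + y) =
      (extend \<sigma> (x * w) - extend \<sigma> x) + (extend \<sigma> (y * w) - extend \<sigma> y)"
      using add(1,2) by (simp add: distrib_right extend_add [OF \<sigma>] PB_mult_right)
    then show ?thesis
      using norm_triangle_mono [OF C C', of w d w d] that by (simp add: distrib_right)
  qed
  then show ?case using S by (intro exI [of _ "S \<union> T"] exI [of _ "C + C'"]) auto
next
  case (scale c x)
  then obtain S C where S: "finite S" "C \<ge> 0"
    and C: "\<And>w d. star w = w \<Longrightarrow> \<forall>s\<in>S. norm (s - w * s) \<le> d \<Longrightarrow> cmod (extend \<sigma> (x * w) - extend \<sigma> x) \<le> C * d"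
    by metis
  have "cmod (extend \<sigma> (scaleC c x * w) - extend \<sigma> (scaleC c x)) \<le> (cmod c * C) * d"
    if "star w = w" "\<forall>s\<in>S. norm (s - w * s) \<le> d" for w d
    using mult_left_mono [OF C [OF that] norm_ge_zero, of c] scale(1)
    by (simp add: mult_scaleC_left extend_scale [OF \<sigma>] PB_mult_right norm_mult [symmetric] right_diff_distrib mult.assoc)
  then show ?case using S by (intro exI [of _ S] exI [of _ "cmod c * C"]) auto
next
  case (gens x p q y)
  have xp: "x * p \<in> PB" using gens(1) Ped_subset_Ped PB_mult_left by blast
  obtain C where C: "C \<ge> 0" "\<And>b. cmod (extend \<sigma> ((x * p) * b)) \<le> C * norm b"
    using extend_mult_bounded [OF \<sigma> xp] by blast
  define s where "s = star (q * y)"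
  have "cmod (extend \<sigma> (x * p * q * y * w) - extend \<sigma> (x * p * q * y)) \<le> C * d"
    if w: "star w = w" and d: "\<forall>s\<in>{s}. norm (s - w * s) \<le> d" for w d
  proof -
    have "extend \<sigma> (x * p * q * y * w) - extend \<sigma> (x * p * q * y) = extend \<sigma> ((x * p) * (q * y * w - q * y))"
      using extend_mult_diff [OF xp, of "q * y * w" "q * y"] by (simp only: mult.assoc)
    then have "cmod (extend \<sigma> (x * p * q * y * w) - extend \<sigma> (x * p * q * y)) =
        cmod (extend \<sigma> ((x * p) * (q * y * w - q * y)))" by simp
    also have "\<dots> \<le> C * norm (q * y * w - q * y)" by (rule C)
    also have "norm (q * y * w - q * y) = norm (s - w * s)"
    proof -
      have "s - w * s = - star (q * y * w - q * y)" by (simp add: s_def star_diff star_mult w)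
      then show ?thesis by simp
    qed
    also have "C * norm (s - w * s) \<le> C * d" using d C(1) by (simp add: mult_left_mono)
    finally show ?thesis .
  qed
  then show ?case using C(1) by (intro exI [of _ "{s}"] exI [of _ C]) auto
qed

text \<open>Only \<open>star z * z\<close> is known to lie in the Pedersen ideal, not
  \<open>z\<close>, so nothing can be inserted between the two factors. A square
  \<open>m * star m\<close> is put on the right instead, and rotation produces
  \<open>star (z * m) * (z * m)\<close> with \<open>z * m\<close> in
  \<open>left_gens\<close>.\<close>

lemma extend_nonneg:
  assumes h: "star z * z \<in> PB"
  shows "extend \<sigma> (star z * z) \<in> \<real>\<^sub>\<ge>\<^sub>0"
proof (rule nonneg_Reals_approx)
  fix e :: real assume e: "e > 0"
  define h where "h = star z * z"
  have hB: "h \<in> PB" using h by (simp add: h_def)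
  obtain S C where S: "finite S" "C \<ge> 0"
    and C: "\<And>w d. star w = w \<Longrightarrow> \<forall>s\<in>S. norm (s - w * s) \<le> d \<Longrightarrow> cmod (extend \<sigma> (h * w) - extend \<sigma> h) \<le> C * d"
    using extend_right_approx [OF hB] by blast
  define d where "d = e / (C + 1)"
  have d: "d > 0" using e S by (simp add: d_def)
  obtain q where q: "q \<in> square_sums" "\<forall>s\<in>S. norm (s - q * s) < d"
    using approximate_unit [OF S(1) d] by auto
  have tr: "ped_trace UNIV (extend \<sigma>)" by (rule ped_trace_extend [OF \<sigma>])
  have nonneg: "extend \<sigma> (h * (m * star m)) \<in> \<real>\<^sub>\<ge>\<^sub>0" if m: "m \<in> left_gens" for m
  proof -
    have "z * m \<in> left_gens"
      using m by (elim left_gensE) (metis left_gensI mult.assoc)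
    have "extend \<sigma> (h * (m * star m)) = extend \<sigma> ((h * m) * star m)" by (simp add: mult.assoc)
    also have "\<dots> = extend \<sigma> (star m * (h * m))"
      using hB by (intro tr_commute_subalg [OF cstar_subalgebra_UNIV tr] PB_mult_right) auto
    also have "star m * (h * m) = star (z * m) * (z * m)" by (simp add: h_def star_simps mult.assoc)
    finally show ?thesis using extend_left_gens_nonneg [OF \<open>z * m \<in> left_gens\<close>] by simp
  qed
  have "set ms \<subseteq> left_gens \<Longrightarrow> extend \<sigma> (h * (\<Sum>m\<leftarrow>ms. m * star m)) \<in> \<real>\<^sub>\<ge>\<^sub>0" for ms
    using hB nonneg by (induction ms)
      (auto simp: extend_0 [OF \<sigma>] distrib_left extend_add [OF \<sigma>] PB_mult_right)
  then have "extend \<sigma> (h * q) \<in> \<real>\<^sub>\<ge>\<^sub>0" using q(1) by (auto simp: square_sums_def)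
  moreover have "cmod (extend \<sigma> (h * q) - extend \<sigma> h) \<le> e"
  proof -
    have "cmod (extend \<sigma> (h * q) - extend \<sigma> h) \<le> C * d"
      using q square_sums_star by (intro C) (auto intro: less_imp_le)
    also have "\<dots> \<le> (C + 1) * d" using d by simp
    also have "\<dots> = e" using S(2) by (simp add: d_def)
    finally show ?thesis .
  qed
  ultimately show "\<exists>r\<in>\<real>\<^sub>\<ge>\<^sub>0. cmod (r - extend \<sigma> (star z * z)) \<le> e" unfolding h_def by blast
qed

end

subsection \<open>The restriction map\<close>

lemma ped_trace_restrict:
  assumes "ped_trace UNIV \<tau>"
  shows "ped_trace A (restrict \<tau> P)"
proof -
  have sub: "x \<in> PB" if "x \<in> P" for x using that Ped_subset_Ped by blast
  have "x * y \<in> P" "x + y \<in> P" "scaleC c x \<in> P" "star x \<in> P" if "x \<in> P" "y \<in> P" for x y c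
    using that P_in_A Ped_subspace [OF A]
    by (auto intro: Ped_mult_left [OF A] Ped_star [OF A] complex_vector.subspace_add complex_vector.subspace_scale)
  then show ?thesis
    using assms sub Ped_subset_Ped unfolding ped_trace_def ped_linear_def by (auto simp: subset_iff)
qed

text \<open>On generators any trace of the large ideal satisfies \<tau>(x p q y) = \<tau>(q y x p),
  so it is determined by its restriction.\<close>

lemma extend_restrict:
  assumes \<tau>: "ped_trace UNIV \<tau>" and z: "z \<in> PB"
  shows "extend (restrict \<tau> P) z = \<tau> z"
proof -
  define \<sigma> where "\<sigma> = restrict \<tau> P"
  have \<sigma>: "ped_trace A \<sigma>" unfolding \<sigma>_def by (rule ped_trace_restrict [OF \<tau>])
  have "extend \<sigma> z = \<tau> z"
    using z
  proof (induction z rule: PB_induct)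
    case (gens x p q y)
    have "q * (y * x) * p \<in> P" using gens by (simp add: P_sandwich)
    then have "extend \<sigma> (x * p * q * y) = \<tau> ((q * y) * (x * p))"
      using extend_gens [OF \<sigma> gens] by (simp add: \<sigma>_def mult.assoc)
    also have "\<dots> = \<tau> ((x * p) * (q * y))"
      using gens(2) Ped_subset_Ped
      by (intro tr_commute_subalg [OF cstar_subalgebra_UNIV \<tau>] PB_mult_right) auto
    finally show ?case by (simp only: mult.assoc)
  qed (simp_all add: extend_0 [OF \<sigma>] extend_add [OF \<sigma>] extend_scale [OF \<sigma>] tr_0 [OF cstar_subalgebra_UNIV \<tau>]
      tr_add [OF cstar_subalgebra_UNIV \<tau>] tr_scale [OF cstar_subalgebra_UNIV \<tau>])
  then show ?thesis by (simp only: \<sigma>_def)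
qed

lemma restrict_in_real_traces: "\<tau> \<in> real_traces UNIV \<Longrightarrow> restrict \<tau> P \<in> real_traces A"
  by (simp add: real_traces_iff A cstar_subalgebra_UNIV ped_trace_restrict)

lemma extend_in_real_traces: "\<sigma> \<in> real_traces A \<Longrightarrow> extend \<sigma> \<in> real_traces UNIV"
  by (auto simp: real_traces_iff A cstar_subalgebra_UNIV ped_trace_extend) (simp add: extend_def)

lemma extend_restrict_eq: "\<tau> \<in> real_traces UNIV \<Longrightarrow> extend (restrict \<tau> P) = \<tau>"
proof -
  assume "\<tau> \<in> real_traces UNIV"
  then have \<tau>: "\<tau> \<in> extensional PB" "ped_trace UNIV \<tau>" by (auto simp: real_traces_iff cstar_subalgebra_UNIV)
  show ?thesis
  proof (rule extensionalityI)
    show "extend (restrict \<tau> P) \<in> extensional PB" by (simp add: extend_def)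
  qed (use \<tau> extend_restrict in auto)
qed

lemma restrict_extend_eq: "\<sigma> \<in> real_traces A \<Longrightarrow> restrict (extend \<sigma>) P = \<sigma>"
proof -
  assume "\<sigma> \<in> real_traces A"
  then have \<sigma>: "\<sigma> \<in> extensional P" "ped_trace A \<sigma>" by (auto simp: real_traces_iff A)
  show ?thesis
    by (rule extensionalityI [OF _ \<sigma>(1)]) (auto simp: extend_eq_on_Ped [OF \<sigma>(2)])
qed

lemma continuous_map_restrict: "continuous_map (trace_topology (UNIV :: 'a set)) (trace_topology A) (\<lambda>\<tau>. restrict \<tau> P)"
  unfolding trace_topology_def [of A] continuous_map_in_subtopology
proof
  show "(\<lambda>\<tau>. restrict \<tau> P) \<in> topspace (trace_topology UNIV) \<rightarrow> real_traces A"
    by (auto simp: topspace_trace_topology restrict_in_real_traces)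
  show "continuous_map (trace_topology UNIV) (product_topology (\<lambda>_. euclidean) P) (\<lambda>\<tau>. restrict \<tau> P)"
    unfolding continuous_map_componentwise
  proof (intro conjI ballI)
    fix k assume k: "k \<in> P"
    then have "k \<in> PB" using Ped_subset_Ped by blast
    then have "continuous_map (trace_topology (UNIV :: 'a set)) euclidean (\<lambda>\<tau>. \<tau> k)"
      unfolding trace_topology_def
      by (intro continuous_map_from_subtopology continuous_map_product_projection)
    then show "continuous_map (trace_topology UNIV) euclidean (\<lambda>\<tau>. restrict \<tau> P k)" using k by simp
  qed auto
qed

lemma continuous_map_extend: "continuous_map (trace_topology A) (trace_topology (UNIV :: 'a set)) extend"
  unfolding trace_topology_def [of "UNIV :: 'a set"] continuous_map_in_subtopology
proof
  show "extend \<in> topspace (trace_topology A) \<rightarrow> real_traces UNIV"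
    by (auto simp: topspace_trace_topology extend_in_real_traces)
  show "continuous_map (trace_topology A) (product_topology (\<lambda>_. euclidean) PB) extend"
    unfolding continuous_map_componentwise
  proof (intro conjI ballI)
    show "extend ` topspace (trace_topology A) \<subseteq> extensional PB" by (auto simp: extend_def)
    fix k assume k: "k \<in> PB"
    have proj: "continuous_map (trace_topology A) euclidean (\<lambda>\<sigma>. \<sigma> p)" if "p \<in> P" for p
      unfolding trace_topology_def using that
      by (intro continuous_map_from_subtopology continuous_map_product_projection)
    have "valid ps \<Longrightarrow> continuous_map (trace_topology A) euclidean (\<lambda>\<sigma>. val_trace \<sigma> ps)" for ps
    proof (induction ps)
      case (Cons r ps)
      then show ?case
        by (cases r) (auto intro!: continuous_map_add proj P_sandwich)
    qed simp
    \<comment> \<open>The representation \<open>rep k\<close> is chosen without reference to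
      \<sigma>, so evaluation at \<open>k\<close> is a fixed finite sum of evaluations at points of
      \<open>P\<close>.\<close>
    then show "continuous_map (trace_topology A) euclidean (\<lambda>\<sigma>. extend \<sigma> k)"
      using k rep [OF k] by (simp add: extend_def)
  qed
qed

lemma homeomorphic_maps_restrict_extend:
  "homeomorphic_maps (trace_topology (UNIV :: 'a set)) (trace_topology A) (\<lambda>\<tau>. restrict \<tau> P) extend"
  unfolding homeomorphic_maps_def topspace_trace_topology
  using continuous_map_restrict continuous_map_extend extend_restrict_eq restrict_extend_eq by blast

lemma restrict_positive_traces: "(\<lambda>\<tau>. restrict \<tau> P) ` positive_traces UNIV = positive_traces A"
proof
  show "(\<lambda>\<tau>. restrict \<tau> P) ` positive_traces UNIV \<subseteq> positive_traces A"
    using Ped_subset_Ped by (auto simp: positive_traces_def restrict_in_real_traces positive_part_def subset_iff)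
  show "positive_traces A \<subseteq> (\<lambda>\<tau>. restrict \<tau> P) ` positive_traces UNIV"
  proof
    fix \<sigma> assume "\<sigma> \<in> positive_traces A"
    then have \<sigma>: "\<sigma> \<in> real_traces A" "\<And>a. a \<in> P \<inter> positive_part A \<Longrightarrow> \<sigma> a \<in> \<real>\<^sub>\<ge>\<^sub>0"
      by (auto simp: positive_traces_def)
    then have tr: "ped_trace A \<sigma>" by (simp add: real_traces_iff A)
    have "extend \<sigma> \<in> positive_traces UNIV"
      using extend_in_real_traces [OF \<sigma>(1)] extend_nonneg [OF tr \<sigma>(2)]
      by (auto simp: positive_traces_def positive_part_def)
    then show "\<sigma> \<in> (\<lambda>\<tau>. restrict \<tau> P) ` positive_traces UNIV"
      using restrict_extend_eq [OF \<sigma>(1)] by (metis imageI)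
  qed
qed

lemma trace_space_iso: "ordered_tvs_iso (trace_space (UNIV :: 'a set)) (trace_space A) (\<lambda>\<tau>. restrict \<tau> P)"
  unfolding ordered_tvs_iso_def trace_space_def ordered_tvs.simps topspace_trace_topology
proof (intro conjI ballI allI)
  show "homeomorphic_map (trace_topology (UNIV :: 'a set)) (trace_topology A) (\<lambda>\<tau>. restrict \<tau> P)"
    using homeomorphic_maps_restrict_extend homeomorphic_map_maps by blast
qed (use restrict_positive_traces Ped_subset_Ped in \<open>auto simp: fun_eq_iff restrict_def\<close>)

end

subsection \<open>The dual map\<close>

lemma continuous_map_compact_open_compose:
  assumes h: "continuous_map X Y h"
    and F: "\<And>\<phi>. \<phi> \<in> F \<Longrightarrow> (\<lambda>x\<in>topspace X. \<phi> (h x)) \<in> G"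
  shows "continuous_map (compact_open_topology Y F) (compact_open_topology X G) (\<lambda>\<phi>. \<lambda>x\<in>topspace X. \<phi> (h x))"
  unfolding compact_open_topology_def [of X]
proof (rule continuous_on_generated_topo)
  let ?r = "\<lambda>\<phi>. \<lambda>x\<in>topspace X. \<phi> (h x)"
  let ?S = "{{\<phi> \<in> G. \<phi> ` K \<subseteq> W} |K W. compactin X K \<and> open W}"
  fix U assume "U \<in> ?S"
  then obtain K W where U: "U = {\<phi> \<in> G. \<phi> ` K \<subseteq> W}" "compactin X K" "open W" by blast
  have "?r -` U \<inter> topspace (compact_open_topology Y F) = {\<phi> \<in> F. \<phi> ` (h ` K) \<subseteq> W}"
    using F compactin_subset_topspace [OF U(2)]
    by (auto simp: U(1) topspace_compact_open_topology image_subset_iff subset_iff)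
  moreover have "openin (compact_open_topology Y F) {\<phi> \<in> F. \<phi> ` (h ` K) \<subseteq> W}"
    unfolding compact_open_topology_def
    using image_compactin [OF U(2) h] U(3) by (intro topology_generated_by_Basis) blast
  ultimately show "openin (compact_open_topology Y F) (?r -` U \<inter> topspace (compact_open_topology Y F))" by simp
next
  let ?S = "{{\<phi> \<in> G. \<phi> ` K \<subseteq> W} |K W. compactin X K \<and> open W}"
  have "\<Union>?S = G"
    using topspace_compact_open_topology [of X G] unfolding compact_open_topology_def topology_generated_by_topspace .
  then show "(\<lambda>\<phi>. \<lambda>x\<in>topspace X. \<phi> (h x)) ` topspace (compact_open_topology Y F) \<subseteq> \<Union>?S"
    using F by (auto simp: topspace_compact_open_topology)
qed

text \<open>The isomorphism predicate does not demand closure under addition. Functionals restricted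
  to \<open>real_traces\<close> need it: otherwise their value at a sum would be the default
  value.\<close>

lemma vadd_in_real_traces:
  assumes A: "cstar_subalgebra A" and \<sigma>: "\<sigma> \<in> real_traces A" and \<tau>: "\<tau> \<in> real_traces A"
  shows "vadd (trace_space A) \<sigma> \<tau> \<in> real_traces A"
proof -
  have s: "ped_trace A \<sigma>" and t: "ped_trace A \<tau>" using \<sigma> \<tau> by (simp_all add: real_traces_iff A)
  note mem = Ped_mult_left [OF A] Ped_subset [OF A] Ped_star [OF A]
    complex_vector.subspace_add [OF Ped_subspace [OF A]] complex_vector.subspace_scale [OF Ped_subspace [OF A]]
  have "ped_trace A (\<lambda>x\<in>Ped A. \<sigma> x + \<tau> x)"
    unfolding ped_trace_def
  proof (intro conjI allI impI ballI)
    show "ped_linear A (\<lambda>x\<in>Ped A. \<sigma> x + \<tau> x)"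
      by (simp add: ped_linear_def mem tr_add [OF A s] tr_add [OF A t] tr_scale [OF A s] tr_scale [OF A t]
          distrib_left)
    show "(\<lambda>x\<in>Ped A. \<sigma> x + \<tau> x) (x * y) = (\<lambda>x\<in>Ped A. \<sigma> x + \<tau> x) (y * x)"
      if "x \<in> Ped A" "y \<in> Ped A" for x y
      using that by (simp add: mem tr_commute [OF A s, of x y] tr_commute [OF A t, of x y])
    show "(\<lambda>x\<in>Ped A. \<sigma> x + \<tau> x) (star x) = cnj ((\<lambda>x\<in>Ped A. \<sigma> x + \<tau> x) x)"
      if "x \<in> Ped A" for x
      using that by (simp add: mem tr_star [OF A s] tr_star [OF A t])
  next
    fix D assume D: "cstar_subalgebra D \<and> D \<subseteq> Ped A"
    obtain C where C: "\<And>x. x \<in> D \<Longrightarrow> cmod (\<sigma> x) \<le> C * norm x" using tr_bounded [OF A s] D by blast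
    obtain C' where C': "\<And>x. x \<in> D \<Longrightarrow> cmod (\<tau> x) \<le> C' * norm x" using tr_bounded [OF A t] D by blast
    have "cmod ((\<lambda>x\<in>Ped A. \<sigma> x + \<tau> x) x) \<le> (C + C') * norm x" if "x \<in> D" for x
      using norm_triangle_mono [OF C [OF that] C' [OF that]] that D by (auto simp: distrib_right)
    then show "\<exists>C. \<forall>x\<in>D. cmod ((\<lambda>x\<in>Ped A. \<sigma> x + \<tau> x) x) \<le> C * norm x" by blast
  qed
  then show ?thesis by (simp add: real_traces_iff A trace_space_def)
qed

lemma vscale_in_real_traces:
  assumes A: "cstar_subalgebra A" and \<tau>: "\<tau> \<in> real_traces A"
  shows "vscale (trace_space A) r \<tau> \<in> real_traces A"
proof -
  have t: "ped_trace A \<tau>" using \<tau> by (simp add: real_traces_iff A)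
  note mem = Ped_mult_left [OF A] Ped_subset [OF A] Ped_star [OF A]
    complex_vector.subspace_add [OF Ped_subspace [OF A]] complex_vector.subspace_scale [OF Ped_subspace [OF A]]
  let ?t = "\<lambda>x\<in>Ped A. complex_of_real r * \<tau> x"
  have "ped_trace A ?t"
    unfolding ped_trace_def
  proof (intro conjI allI impI ballI)
    show "ped_linear A ?t"
      by (simp add: ped_linear_def mem tr_add [OF A t] tr_scale [OF A t] distrib_left)
    show "?t (x * y) = ?t (y * x)" if "x \<in> Ped A" "y \<in> Ped A" for x y
      using that by (simp add: mem tr_commute [OF A t, of x y])
    show "?t (star x) = cnj (?t x)" if "x \<in> Ped A" for x
      using that by (simp add: mem tr_star [OF A t])
  next
    fix D assume D: "cstar_subalgebra D \<and> D \<subseteq> Ped A"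
    obtain C where C: "\<And>x. x \<in> D \<Longrightarrow> cmod (\<tau> x) \<le> C * norm x" using tr_bounded [OF A t] D by blast
    have "cmod (?t x) \<le> (\<bar>r\<bar> * C) * norm x" if "x \<in> D" for x
      using mult_left_mono [OF C [OF that], of "\<bar>r\<bar>"] that D by (auto simp: norm_mult mult.assoc)
    then show "\<exists>C. \<forall>x\<in>D. cmod (?t x) \<le> C * norm x" by blast
  qed
  then show ?thesis by (simp add: real_traces_iff A trace_space_def)
qed

context
  fixes A B :: "'a::cstar_algebra set" and f g
  assumes A: "cstar_subalgebra A" and B: "cstar_subalgebra B"
    and iso: "ordered_tvs_iso (trace_space B) (trace_space A) f"
    and fg: "homeomorphic_maps (trace_topology B) (trace_topology A) f g"
begin

lemma iso_maps: "\<tau> \<in> real_traces B \<Longrightarrow> f \<tau> \<in> real_traces A" "\<sigma> \<in> real_traces A \<Longrightarrow> g \<sigma> \<in> real_traces B"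
    "\<tau> \<in> real_traces B \<Longrightarrow> g (f \<tau>) = \<tau>" "\<sigma> \<in> real_traces A \<Longrightarrow> f (g \<sigma>) = \<sigma>"
  using fg by (auto simp: homeomorphic_maps_def topspace_trace_topology continuous_map_def Pi_iff)

lemma iso_linear:
    "\<sigma> \<in> real_traces B \<Longrightarrow> \<tau> \<in> real_traces B \<Longrightarrow> f (vadd (trace_space B) \<sigma> \<tau>) = vadd (trace_space A) (f \<sigma>) (f \<tau>)"
    "\<tau> \<in> real_traces B \<Longrightarrow> f (vscale (trace_space B) r \<tau>) = vscale (trace_space A) r (f \<tau>)"
  and iso_cone: "f ` positive_traces B = positive_traces A"
proof -
  have "vtopology (trace_space B) = trace_topology B" "vcone (trace_space B) = positive_traces B"
    "vcone (trace_space A) = positive_traces A"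
    by (simp_all add: trace_space_def)
  then show "\<sigma> \<in> real_traces B \<Longrightarrow> \<tau> \<in> real_traces B \<Longrightarrow> f (vadd (trace_space B) \<sigma> \<tau>) = vadd (trace_space A) (f \<sigma>) (f \<tau>)"
    "\<tau> \<in> real_traces B \<Longrightarrow> f (vscale (trace_space B) r \<tau>) = vscale (trace_space A) r (f \<tau>)"
    "f ` positive_traces B = positive_traces A"
    using iso by (simp_all add: ordered_tvs_iso_def topspace_trace_topology)
qed

text \<open>Apply \<open>g\<close> to the linearity of \<open>f\<close> at \<open>g \<sigma>\<close>
  and \<open>g \<tau>\<close>; closure of the trace space of \<open>B\<close> is what permits
  cancelling \<open>g\<close> against \<open>f\<close>.\<close>

lemma inverse_linear:
    "\<sigma> \<in> real_traces A \<Longrightarrow> \<tau> \<in> real_traces A \<Longrightarrow> g (vadd (trace_space A) \<sigma> \<tau>) = vadd (trace_space B) (g \<sigma>) (g \<tau>)"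
    "\<tau> \<in> real_traces A \<Longrightarrow> g (vscale (trace_space A) r \<tau>) = vscale (trace_space B) r (g \<tau>)"
  using iso_maps iso_linear vadd_in_real_traces [OF B] vscale_in_real_traces [OF B] by metis+

lemma dual_map_in_trace_dual:
  assumes "\<phi> \<in> trace_dual A"
  shows "(\<lambda>\<tau>\<in>real_traces B. \<phi> (f \<tau>)) \<in> trace_dual B"
proof -
  have "continuous_map (trace_topology B) euclideanreal (\<phi> \<circ> f)"
    using assms fg by (auto simp: trace_dual_def homeomorphic_maps_def intro: continuous_map_compose)
  then have "continuous_map (trace_topology B) euclideanreal (\<lambda>\<tau>\<in>real_traces B. \<phi> (f \<tau>))"
    by (rule continuous_map_eq) (simp add: topspace_trace_topology)
  then show ?thesis
    using assms
    by (simp add: trace_dual_def iso_maps iso_linear vadd_in_real_traces [OF B] vscale_in_real_traces [OF B])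
qed

lemma dual_inverse_in_trace_dual:
  assumes "\<phi> \<in> trace_dual B"
  shows "(\<lambda>\<sigma>\<in>real_traces A. \<phi> (g \<sigma>)) \<in> trace_dual A"
proof -
  have "continuous_map (trace_topology A) euclideanreal (\<phi> \<circ> g)"
    using assms fg by (auto simp: trace_dual_def homeomorphic_maps_def intro: continuous_map_compose)
  then have "continuous_map (trace_topology A) euclideanreal (\<lambda>\<sigma>\<in>real_traces A. \<phi> (g \<sigma>))"
    by (rule continuous_map_eq) (simp add: topspace_trace_topology)
  then show ?thesis
    using assms
    by (simp add: trace_dual_def iso_maps inverse_linear vadd_in_real_traces [OF A] vscale_in_real_traces [OF A])
qed

lemma trace_dual_space_iso:
  "ordered_tvs_iso (trace_dual_space A) (trace_dual_space B) (\<lambda>\<phi>. \<lambda>\<tau>\<in>real_traces B. \<phi> (f \<tau>))"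
proof -
  let ?F = "\<lambda>\<phi>. \<lambda>\<tau>\<in>real_traces B. \<phi> (f \<tau>)" and ?G = "\<lambda>\<phi>. \<lambda>\<sigma>\<in>real_traces A. \<phi> (g \<sigma>)"
  let ?X = "compact_open_topology (trace_topology A) (trace_dual A)"
    and ?Y = "compact_open_topology (trace_topology B) (trace_dual B)"
  have GF: "?G (?F \<phi>) = \<phi>" if "\<phi> \<in> trace_dual A" for \<phi>
    by (rule extensionalityI [of _ "real_traces A"]) (use that in \<open>simp_all add: trace_dual_def iso_maps\<close>)
  have FG: "?F (?G \<phi>) = \<phi>" if "\<phi> \<in> trace_dual B" for \<phi>
    by (rule extensionalityI [of _ "real_traces B"]) (use that in \<open>simp_all add: trace_dual_def iso_maps\<close>)
  have "continuous_map ?X ?Y ?F"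
    using continuous_map_compact_open_compose [of "trace_topology B" "trace_topology A" f "trace_dual A" "trace_dual B"]
      fg dual_map_in_trace_dual by (simp add: topspace_trace_topology homeomorphic_maps_def)
  moreover have "continuous_map ?Y ?X ?G"
    using continuous_map_compact_open_compose [of "trace_topology A" "trace_topology B" g "trace_dual B" "trace_dual A"]
      fg dual_inverse_in_trace_dual by (simp add: topspace_trace_topology homeomorphic_maps_def)
  ultimately have "homeomorphic_maps ?X ?Y ?F ?G"
    unfolding homeomorphic_maps_def topspace_compact_open_topology using GF FG by blast
  then have homeo: "homeomorphic_map ?X ?Y ?F" using homeomorphic_map_maps by blast
  have cone: "?F ` {\<phi> \<in> trace_dual A. \<forall>\<tau>\<in>positive_traces A. 0 \<le> \<phi> \<tau>} =
      {\<phi> \<in> trace_dual B. \<forall>\<tau>\<in>positive_traces B. 0 \<le> \<phi> \<tau>}" (is "?F ` ?CA = ?CB")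
  proof
    have sub: "positive_traces B \<subseteq> real_traces B" "positive_traces A \<subseteq> real_traces A"
      by (auto simp: positive_traces_def)
    show "?F ` ?CA \<subseteq> ?CB"
    proof clarify
      fix \<phi> assume \<phi>: "\<phi> \<in> trace_dual A" "\<forall>\<tau>\<in>positive_traces A. 0 \<le> \<phi> \<tau>"
      have "0 \<le> ?F \<phi> \<tau>" if \<tau>: "\<tau> \<in> positive_traces B" for \<tau>
      proof -
        have "f \<tau> \<in> positive_traces A" using \<tau> iso_cone by blast
        moreover have "\<tau> \<in> real_traces B" using \<tau> sub by blast
        ultimately show ?thesis using \<phi> by simp
      qed
      then show "?F \<phi> \<in> trace_dual B \<and> (\<forall>\<tau>\<in>positive_traces B. 0 \<le> ?F \<phi> \<tau>)"
        using dual_map_in_trace_dual [OF \<phi>(1)] by blast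
    qed
    show "?CB \<subseteq> ?F ` ?CA"
    proof
      fix \<phi> assume \<phi>: "\<phi> \<in> ?CB"
      have "g \<sigma> \<in> positive_traces B" if \<sigma>: "\<sigma> \<in> positive_traces A" for \<sigma>
      proof -
        obtain \<tau> where "\<tau> \<in> positive_traces B" "\<sigma> = f \<tau>" using \<sigma> iso_cone by blast
        then show ?thesis using iso_maps(3) sub by auto
      qed
      then have "?G \<phi> \<in> ?CA" using \<phi> dual_inverse_in_trace_dual sub by auto
      moreover have "\<phi> = ?F (?G \<phi>)" using FG \<phi> by simp
      ultimately show "\<phi> \<in> ?F ` ?CA" by blast
    qed
  qed
  show ?thesis
    unfolding ordered_tvs_iso_def trace_dual_space_def ordered_tvs.simps topspace_compact_open_topology
    using homeo cone by (auto simp: fun_eq_iff iso_maps)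
qed

end

theorem corollary5p4:
  fixes A :: "'b::cstar_algebra set"
  assumes "hereditary_cstar_subalgebra A" and "full A"
  shows "ordered_tvs_iso (trace_space (UNIV :: 'b set)) (trace_space A)
           (\<lambda>\<tau>. restrict \<tau> (Ped A)) \<and>
         ordered_tvs_iso (trace_dual_space A) (trace_dual_space (UNIV :: 'b set))
           (\<lambda>\<phi>. \<lambda>\<tau>\<in>real_traces (UNIV :: 'b set). \<phi> (restrict \<tau> (Ped A)))"
proof -
  interpret full_hereditary A using assms by unfold_locales
  show ?thesis
    using trace_space_iso
      trace_dual_space_iso [OF A cstar_subalgebra_UNIV trace_space_iso homeomorphic_maps_restrict_extend]
    by blast
qed

end
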